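(* Let $(A,\mathscr{A},\mu)$ be a semi-finite measure space, let $\langle F,G\rangle$ be a Köthe dual pair of Banach function spaces over a measure space $(B,\mathscr{B},\nu)$, and let $T \in \mathcal{L}(L^{\infty}(A),G)$ be a $\sigma(L^{\infty}(A),L^{1}(A))$-to-$\sigma(G,F)$ continuous linear operator, with adjoint $S \in \mathcal{L}(F,L^{1}(A))$. If $T \in M(L^{\infty}(A),G)$, then, for any Banach dual pair $\langle X,Y\rangle$, $T \otimes I_{Y}$ has a unique extension to a $\sigma(L^{\infty}(A;Y),L^{1}(A;X))$-to-$\sigma(G(Y),F \tilde{\otimes} X)$ continuous linear operator $T_{Y} \in \mathcal{L}(L^{\infty}(A;Y),G(Y))$. In this situation, $T_{Y}$ is the $Y$-valued extension of $T$ with respect to $\langle X,Y\rangle$, and the adjoint $S_{X} \in \mathcal{L}(F \tilde{\otimes} X,L^{1}(A;X))$ of $T_{Y}$ is the unique bounded extension of $S \otimes I_{X}$. Moreover, $S \in M(F,L^{1}(A)) = \mathcal{L}_{r}(F,L^{1}(A))$, and $\|S_{X}\| \leq \|S\|_{r}$ and $\|T_{Y}\| \leq \|T\|_{M(L^{\infty}(A),G)}$.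
   Context: All spaces are over a fixed field $\mathbb{K}\in\{\mathbb{R},\mathbb{C}\}$. $\mathcal{L}(V,W)$ denotes bounded linear operators. Dual pairs. A Banach dual pair $\langle X,Y\rangle$ consists of Banach spaces $X,Y$ and a bounded bilinear form $\langle\cdot,\cdot\rangle:X\times Y\to\mathbb{K}$ such that $x\mapsto\langle x,\cdot\rangle$, $X\to Y^{*}$, and $y\mapsto\langle\cdot,y\rangle$, $Y\to X^{*}$, are injective. $\sigma(X,Y)$ is the locally convex topology on $X$ generated by the seminorms $|\langle\cdot,y\rangle|$, $y\in Y$; $\sigma(Y,X)$ is defined similarly. The order in which the two members of a pair are written is immaterial. For dual pairs $\langle X_1,Y_1\rangle$, $\langle X_2,Y_2\rangle$, a $\sigma(X_1,Y_1)$-to-$\sigma(X_2,Y_2)$ continuous linear $U:X_1\to X_2$ has an adjoint $U':Y_2\to Y_1$ determined by $\langle x_1,U'y_2\rangle=\langle Ux_1,y_2\rangle$; $U$ and $U'$ are automatically bounded, and $U''=U$. Function spaces. A measure space is semi-finite if every measurable set of positive measure contains a measurable subset of finite positive measure. $L^{0}(A)$ is the Riesz space of a.e. classes of measurable $\mathbb{K}$-valued functions, $L^{0}(A;Y)$ the space of a.e. classes of strongly measurable functions $A\to Y$. A Banach function space on $(A,\mathscr A,\mu)$ is an order ideal $E$ of $L^{0}(A)$ with a Banach lattice norm. $E(Y)=\{f\in L^{0}(A;Y):\|f\|_{Y}\in E\}$ with norm $\big\|\,\|f\|_{Y}\big\|_{E}$; $E\tilde{\otimes}Y$ is the closure in $E(Y)$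 of the algebraic tensor product $E\otimes Y$ (with $(e\otimes y)(a)=e(a)y$). $L^{p}(A;Y)$ is $E(Y)$ for $E=L^p(A)$. A Köthe dual pair on a measure space is a Banach dual pair $\langle D,E\rangle$ of Banach function spaces on that space with $D\cdot E\subset L^{1}$ and $\langle d,e\rangle=\int de$; for $A$ semi-finite, $\langle L^1(A),L^\infty(A)\rangle$ is one. If $\langle D,E\rangle$ is a Köthe dual pair and $\langle X,Y\rangle$ a Banach dual pair, then $\langle D(X),E(Y)\rangle$ and $\langle D\tilde{\otimes}X,E(Y)\rangle$ are Banach dual pairs under $\langle d,e\rangle=\int\langle d(a),e(a)\rangle_{\langle X,Y\rangle}\,d\mu(a)$. Adjoints are with respect to the dualities $\langle L^1(A),L^\infty(A)\rangle$ and $\langle F,G\rangle$ (for $T$), and $\langle L^1(A;X),L^\infty(A;Y)\rangle$ and $\langle F\tilde\otimes X,G(Y)\rangle$ (for $T_Y$). Dominated and regular operators. A linear $U:E\to G$ between Banach lattices is dominated by a positive $R\in\mathcal{L}(E,G)$ if $|Ue|\le R|e|$ for all $e\in E$. $M(E,G)$ is the set of linear operators dominated by some positive operator; $\|U\|_{M(E,G)}=\inf\{\|R\|:R\text{ positive and dominating }U\}$. $U$ is regular if it is a linear combination of positive operators; $\mathcal{L}_{r}(E,G)\subset M(E,G)$ is the space of regular operators and $\|U\|_{r}:=\|U\|_{M(E,G)}$ for $U$ regular. Extensions. $T\otimes I_Y$ is the linear operator on $E\otimes Y$ with $(T\otimes I_Y)(e\otimes y)=Te\otimes y$. For $T\in\mathcal{L}(E,G)$,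 the $Y$-valued extension of $T$ with respect to $\langle X,Y\rangle$ is the (necessarily unique) $T_Y\in\mathcal{L}(E(Y),G(Y))$ with $\langle x,T_Ye\rangle=T\langle x,e\rangle$ for all $e\in E(Y)$, $x\in X$, where $\langle x,e\rangle$ denotes the function $a\mapsto\langle x,e(a)\rangle$. *)

theory Defs
  imports "HOL-Analysis.Analysis"
begin

section \<open>The scalar field\<close>

text \<open>A type of this class is, via \<open>to_complex\<close>, isometrically isomorphic to the real or to the
  complex field; this renders a fixed scalar field that is either of the two.\<close>

class real_or_complex = real_normed_field + banach + second_countable_topology +
  fixes to_complex :: "'a \<Rightarrow> complex"
  assumes to_complex_add: "to_complex (x + y) = to_complex x + to_complex y"
    and to_complex_mult: "to_complex (x * y) = to_complex x * to_complex y"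
    and to_complex_scaleR: "to_complex (r *\<^sub>R x) = r *\<^sub>R to_complex x"
    and norm_to_complex: "cmod (to_complex x) = norm x"
    and range_to_complex: "range to_complex = \<real> \<or> range to_complex = UNIV"

instantiation real :: real_or_complex
begin
definition to_complex_real :: "real \<Rightarrow> complex" where "to_complex_real = complex_of_real"
instance by standard (simp_all add: to_complex_real_def Reals_def scaleR_conv_of_real)
end

instantiation complex :: real_or_complex
begin
definition to_complex_complex :: "complex \<Rightarrow> complex" where "to_complex_complex = id"
instance by standard (simp_all add: to_complex_complex_def)
end


section \<open>Normed spaces with explicit carrier\<close>

text \<open>Function spaces are subsets of a space of equivalence classes and carry their own norms, and
  there is no library class of normed spaces over a scalar field other than the reals. Normed
  spaces are therefore records with an explicit carrier; operations are unspecified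
  outside of it.\<close>

record ('k, 'v) nspace =
  vcarrier :: "'v set"
  vadd :: "'v \<Rightarrow> 'v \<Rightarrow> 'v"
  vzero :: "'v"
  vscale :: "'k \<Rightarrow> 'v \<Rightarrow> 'v"
  vnorm :: "'v \<Rightarrow> real"

definition vdiff :: "('k::real_or_complex, 'v) nspace \<Rightarrow> 'v \<Rightarrow> 'v \<Rightarrow> 'v" where
  "vdiff V u v = vadd V u (vscale V (- 1) v)"

locale normed_space_on =
  fixes V :: "('k::real_or_complex, 'v) nspace"
  assumes zero_closed: "vzero V \<in> vcarrier V"
    and add_closed: "\<lbrakk>u \<in> vcarrier V; v \<in> vcarrier V\<rbrakk> \<Longrightarrow> vadd V u v \<in> vcarrier V"
    and scale_closed: "v \<in> vcarrier V \<Longrightarrow> vscale V c v \<in> vcarrier V"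
    and add_assoc: "\<lbrakk>u \<in> vcarrier V; v \<in> vcarrier V; w \<in> vcarrier V\<rbrakk>
      \<Longrightarrow> vadd V (vadd V u v) w = vadd V u (vadd V v w)"
    and add_commute: "\<lbrakk>u \<in> vcarrier V; v \<in> vcarrier V\<rbrakk> \<Longrightarrow> vadd V u v = vadd V v u"
    and add_zero: "v \<in> vcarrier V \<Longrightarrow> vadd V v (vzero V) = v"
    and diff_self: "v \<in> vcarrier V \<Longrightarrow> vdiff V v v = vzero V"
    and scale_add_right: "\<lbrakk>u \<in> vcarrier V; v \<in> vcarrier V\<rbrakk>
      \<Longrightarrow> vscale V c (vadd V u v) = vadd V (vscale V c u) (vscale V c v)"
    and scale_add_left: "v \<in> vcarrier V
      \<Longrightarrow> vscale V (c + d) v = vadd V (vscale V c v) (vscale V d v)"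
    and scale_scale: "v \<in> vcarrier V \<Longrightarrow> vscale V c (vscale V d v) = vscale V (c * d) v"
    and scale_one: "v \<in> vcarrier V \<Longrightarrow> vscale V 1 v = v"
    and norm_nonneg: "v \<in> vcarrier V \<Longrightarrow> 0 \<le> vnorm V v"
    and norm_eq_zero: "v \<in> vcarrier V \<Longrightarrow> vnorm V v = 0 \<longleftrightarrow> v = vzero V"
    and norm_triangle: "\<lbrakk>u \<in> vcarrier V; v \<in> vcarrier V\<rbrakk>
      \<Longrightarrow> vnorm V (vadd V u v) \<le> vnorm V u + vnorm V v"
    and norm_scale: "v \<in> vcarrier V \<Longrightarrow> vnorm V (vscale V c v) = norm c * vnorm V v"

locale banach_space_on = normed_space_on +
  assumes complete: "\<lbrakk>\<forall>n. \<sigma> n \<in> vcarrier V;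
      \<forall>\<epsilon>>0. \<exists>N. \<forall>m\<ge>N. \<forall>n\<ge>N. vnorm V (vdiff V (\<sigma> m) (\<sigma> n)) < \<epsilon>\<rbrakk>
    \<Longrightarrow> \<exists>v\<in>vcarrier V. (\<lambda>n. vnorm V (vdiff V (\<sigma> n) v)) \<longlonglongrightarrow> 0"

text \<open>A library type of class \<open>banach\<close> is a space over the reals only, so the scalar multiplication
  \<open>s\<close> by the field \<open>'k\<close> is a separate parameter. If \<open>banach_space_on (type_space s)\<close>, then
  \<open>s (of_real r) = scaleR r\<close>, because \<open>\<lambda>r. s (of_real r) x\<close> is additive and continuous.\<close>

definition type_space :: "('k::real_or_complex \<Rightarrow> 'x \<Rightarrow> 'x) \<Rightarrow> ('k, 'x::banach) nspace" where
  "type_space s = \<lparr>vcarrier = UNIV, vadd = (+), vzero = 0, vscale = s, vnorm = norm\<rparr>"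

inductive_set vspan :: "('k::real_or_complex, 'v) nspace \<Rightarrow> 'v set \<Rightarrow> 'v set"
  for V :: "('k, 'v) nspace" and S :: "'v set" where
  vspan_zero: "vzero V \<in> vspan V S"
| vspan_step: "\<lbrakk>v \<in> S; w \<in> vspan V S\<rbrakk> \<Longrightarrow> vadd V (vscale V c v) w \<in> vspan V S"


section \<open>Operators\<close>

text \<open>Operators are \<open>undefined\<close> outside the carrier of their domain, so that HOL equality is
  equality of operators.\<close>

definition linear_ops ::
    "('k::real_or_complex, 'v) nspace \<Rightarrow> ('k, 'w) nspace \<Rightarrow> ('v \<Rightarrow> 'w) set" where
  "linear_ops V W = {U \<in> vcarrier V \<rightarrow>\<^sub>E vcarrier W.
     (\<forall>u\<in>vcarrier V. \<forall>v\<in>vcarrier V. U (vadd V u v) = vadd W (U u) (U v)) \<and>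
     (\<forall>c. \<forall>v\<in>vcarrier V. U (vscale V c v) = vscale W c (U v))}"

definition bounded_ops ::
    "('k::real_or_complex, 'v) nspace \<Rightarrow> ('k, 'w) nspace \<Rightarrow> ('v \<Rightarrow> 'w) set" where
  "bounded_ops V W = {U \<in> linear_ops V W. \<exists>C. \<forall>v\<in>vcarrier V. vnorm W (U v) \<le> C * vnorm V v}"

definition op_norm ::
    "('k::real_or_complex, 'v) nspace \<Rightarrow> ('k, 'w) nspace \<Rightarrow> ('v \<Rightarrow> 'w) \<Rightarrow> real" where
  "op_norm V W U = (SUP v\<in>{v \<in> vcarrier V. vnorm V v \<le> 1}. vnorm W (U v))"

definition op_space ::
    "('k::real_or_complex, 'v) nspace \<Rightarrow> ('k, 'w) nspace \<Rightarrow> ('k, 'v \<Rightarrow> 'w) nspace" where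
  "op_space V W = \<lparr>vcarrier = bounded_ops V W,
     vadd = (\<lambda>U U'. \<lambda>v\<in>vcarrier V. vadd W (U v) (U' v)),
     vzero = (\<lambda>v\<in>vcarrier V. vzero W),
     vscale = (\<lambda>c U. \<lambda>v\<in>vcarrier V. vscale W c (U v)),
     vnorm = op_norm V W\<rparr>"


section \<open>Dual pairs\<close>

definition banach_dual_pair ::
    "('k::real_or_complex, 'v) nspace \<Rightarrow> ('k, 'w) nspace \<Rightarrow> ('v \<Rightarrow> 'w \<Rightarrow> 'k) \<Rightarrow> bool" where
  "banach_dual_pair V W b \<longleftrightarrow> banach_space_on V \<and> banach_space_on W \<and>
     (\<forall>u\<in>vcarrier V. \<forall>v\<in>vcarrier V. \<forall>w\<in>vcarrier W. b (vadd V u v) w = b u w + b v w) \<and>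
     (\<forall>c. \<forall>v\<in>vcarrier V. \<forall>w\<in>vcarrier W. b (vscale V c v) w = c * b v w) \<and>
     (\<forall>v\<in>vcarrier V. \<forall>w\<in>vcarrier W. \<forall>z\<in>vcarrier W. b v (vadd W w z) = b v w + b v z) \<and>
     (\<forall>c. \<forall>v\<in>vcarrier V. \<forall>w\<in>vcarrier W. b v (vscale W c w) = c * b v w) \<and>
     (\<exists>C. \<forall>v\<in>vcarrier V. \<forall>w\<in>vcarrier W. norm (b v w) \<le> C * vnorm V v * vnorm W w) \<and>
     inj_on (\<lambda>v. \<lambda>w\<in>vcarrier W. b v w) (vcarrier V) \<and>
     inj_on (\<lambda>w. \<lambda>v\<in>vcarrier V. b v w) (vcarrier W)"

text \<open>\<open>weak_topology V W b\<close> is \<open>\<sigma>(V,W)\<close>, generated by the open balls of the seminorms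
  \<open>\<lambda>v. norm (b v w)\<close>.\<close>

definition weak_topology ::
    "('k::real_or_complex, 'v) nspace \<Rightarrow> ('k, 'w) nspace \<Rightarrow> ('v \<Rightarrow> 'w \<Rightarrow> 'k) \<Rightarrow> 'v topology" where
  "weak_topology V W b = topology_generated_by
     {{u \<in> vcarrier V. norm (b (vdiff V u v) w) < \<epsilon>} | v w \<epsilon>.
        v \<in> vcarrier V \<and> w \<in> vcarrier W \<and> 0 < \<epsilon>}"

text \<open>\<open>U'\<close> is the adjoint of \<open>U : X1 \<rightarrow> X2\<close> with respect to the pairs \<open>\<langle>X1,Y1\<rangle>\<close> and \<open>\<langle>X2,Y2\<rangle>\<close> with
  forms \<open>b1\<close> and \<open>b2\<close>.\<close>

definition is_adjoint ::
    "('k::real_or_complex, 'x1) nspace \<Rightarrow> ('k, 'y1) nspace \<Rightarrow> ('x1 \<Rightarrow> 'y1 \<Rightarrow> 'k) \<Rightarrow>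
     ('k, 'y2) nspace \<Rightarrow> ('x2 \<Rightarrow> 'y2 \<Rightarrow> 'k) \<Rightarrow> ('x1 \<Rightarrow> 'x2) \<Rightarrow> ('y2 \<Rightarrow> 'y1) \<Rightarrow> bool" where
  "is_adjoint X1 Y1 b1 Y2 b2 U U' \<longleftrightarrow> U' \<in> vcarrier Y2 \<rightarrow>\<^sub>E vcarrier Y1 \<and>
     (\<forall>x\<in>vcarrier X1. \<forall>y\<in>vcarrier Y2. b1 x (U' y) = b2 (U x) y)"


section \<open>Spaces of classes of measurable functions\<close>

definition semi_finite :: "'a measure \<Rightarrow> bool" where
  "semi_finite M \<longleftrightarrow> (\<forall>S\<in>sets M. 0 < emeasure M S \<longrightarrow>
     (\<exists>R\<in>sets M. R \<subseteq> S \<and> 0 < emeasure M R \<and> emeasure M R < \<infinity>))"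

definition strongly_measurable :: "'a measure \<Rightarrow> ('a \<Rightarrow> 'y::real_normed_vector) \<Rightarrow> bool" where
  "strongly_measurable M f \<longleftrightarrow> (\<exists>s. (\<forall>n. simple_function M (s n)) \<and>
     (\<forall>a\<in>space M. (\<lambda>n. s n a) \<longlonglongrightarrow> f a))"

lemma strongly_measurable_iff_borel_measurable:
  fixes f :: "'a \<Rightarrow> 'y::{real_normed_vector, second_countable_topology}"
  shows "strongly_measurable M f \<longleftrightarrow> f \<in> borel_measurable M"
proof
  assume "strongly_measurable M f"
  then obtain s where "\<And>n. simple_function M (s n)" "\<And>a. a \<in> space M \<Longrightarrow> (\<lambda>n. s n a) \<longlonglongrightarrow> f a"
    unfolding strongly_measurable_def by blast
  then show "f \<in> borel_measurable M"
    using borel_measurable_LIMSEQ_metric[of s M f] borel_measurable_simple_function by metis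
next
  assume "f \<in> borel_measurable M"
  then obtain s where "\<And>n. simple_function M (s n)" "\<And>a. a \<in> space M \<Longrightarrow> (\<lambda>n. s n a) \<longlonglongrightarrow> f a"
    using borel_measurable_implies_sequence_metric[of f M 0] by metis
  then show "strongly_measurable M f"
    unfolding strongly_measurable_def by (intro exI[of _ s]) simp
qed

text \<open>The a.e. class of a function; operations on classes are defined through representatives.\<close>

definition ae_class :: "'a measure \<Rightarrow> ('a \<Rightarrow> 'y::real_normed_vector) \<Rightarrow> ('a \<Rightarrow> 'y) set" where
  "ae_class M f = {g. strongly_measurable M g \<and> (AE a in M. g a = f a)}"

definition rep :: "('a \<Rightarrow> 'y) set \<Rightarrow> 'a \<Rightarrow> 'y" where
  "rep c = (SOME f. f \<in> c)"

definition L0 :: "'a measure \<Rightarrow> ('a \<Rightarrow> 'y::real_normed_vector) set set" where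
  "L0 M = ae_class M ` {f. strongly_measurable M f}"

definition function_space ::
    "'a measure \<Rightarrow> ('k::real_or_complex \<Rightarrow> 'y \<Rightarrow> 'y) \<Rightarrow> ('a \<Rightarrow> 'y::real_normed_vector) set set \<Rightarrow>
     (('a \<Rightarrow> 'y) set \<Rightarrow> real) \<Rightarrow> ('k, ('a \<Rightarrow> 'y) set) nspace" where
  "function_space M s C N = \<lparr>vcarrier = C,
     vadd = (\<lambda>f g. ae_class M (\<lambda>a. rep f a + rep g a)),
     vzero = ae_class M (\<lambda>a. 0),
     vscale = (\<lambda>c f. ae_class M (\<lambda>a. s c (rep f a))),
     vnorm = N\<rparr>"

definition L0_norm ::
    "'a measure \<Rightarrow> ('a \<Rightarrow> 'y::real_normed_vector) set \<Rightarrow> ('a \<Rightarrow> 'k::real_or_complex) set" where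
  "L0_norm M f = ae_class M (\<lambda>a. of_real (norm (rep f a)))"

definition L0_le ::
    "'a measure \<Rightarrow> ('a \<Rightarrow> 'k::real_or_complex) set \<Rightarrow> ('a \<Rightarrow> 'k) set \<Rightarrow> bool" where
  "L0_le M f g \<longleftrightarrow> (AE a in M. rep g a - rep f a \<in> \<real>\<^sub>\<ge>\<^sub>0)"

definition banach_function_space ::
    "'a measure \<Rightarrow> ('k::real_or_complex, ('a \<Rightarrow> 'k) set) nspace \<Rightarrow> bool" where
  "banach_function_space M E \<longleftrightarrow>
     E = function_space M (*) (vcarrier E) (vnorm E) \<and> vcarrier E \<subseteq> L0 M \<and> banach_space_on E \<and>
     (\<forall>f\<in>L0 M. \<forall>g\<in>vcarrier E. L0_le M (L0_norm M f) (L0_norm M g :: ('a \<Rightarrow> 'k) set) \<longrightarrow>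
        f \<in> vcarrier E \<and> vnorm E f \<le> vnorm E g)"

definition L1 :: "'a measure \<Rightarrow> ('k::real_or_complex, ('a \<Rightarrow> 'k) set) nspace" where
  "L1 M = function_space M (*) {f \<in> L0 M. integrable M (rep f)} (\<lambda>f. \<integral>a. norm (rep f a) \<partial>M)"

definition Linf :: "'a measure \<Rightarrow> ('k::real_or_complex, ('a \<Rightarrow> 'k) set) nspace" where
  "Linf M = function_space M (*)
     {f \<in> L0 M. \<exists>C. AE a in M. norm (rep f a) \<le> C}
     (\<lambda>f. Inf {C. 0 \<le> C \<and> (AE a in M. norm (rep f a) \<le> C)})"

text \<open>The form \<open>\<langle>d,e\<rangle> = \<integral>\<langle>d(a),e(a)\<rangle>\<close> induced by the form \<open>b\<close> on the values.\<close>

definition int_pairing ::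
    "'a measure \<Rightarrow> ('x \<Rightarrow> 'y \<Rightarrow> 'k::real_or_complex) \<Rightarrow> ('a \<Rightarrow> 'x) set \<Rightarrow> ('a \<Rightarrow> 'y) set \<Rightarrow> 'k" where
  "int_pairing M b d e = (\<integral>a. b (rep d a) (rep e a) \<partial>M)"

definition koethe_dual_pair ::
    "'a measure \<Rightarrow> ('k::real_or_complex, ('a \<Rightarrow> 'k) set) nspace \<Rightarrow>
     ('k, ('a \<Rightarrow> 'k) set) nspace \<Rightarrow> bool" where
  "koethe_dual_pair M D E \<longleftrightarrow> banach_function_space M D \<and> banach_function_space M E \<and>
     (\<forall>d\<in>vcarrier D. \<forall>e\<in>vcarrier E. integrable M (\<lambda>a. rep d a * rep e a)) \<and>
     banach_dual_pair D E (int_pairing M (*))"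


section \<open>Vector-valued function spaces and tensor products\<close>

text \<open>\<open>valued M E s\<close> is \<open>E(Y)\<close>, where \<open>'y\<close> with scalar multiplication \<open>s\<close> is \<open>Y\<close>.\<close>

definition valued ::
    "'a measure \<Rightarrow> ('k::real_or_complex, ('a \<Rightarrow> 'k) set) nspace \<Rightarrow>
     ('k \<Rightarrow> 'y \<Rightarrow> 'y) \<Rightarrow> ('k, ('a \<Rightarrow> 'y::banach) set) nspace" where
  "valued M E s = function_space M s
     {f \<in> L0 M. L0_norm M f \<in> vcarrier E} (\<lambda>f. vnorm E (L0_norm M f))"

definition elem_tensor ::
    "'a measure \<Rightarrow> ('k \<Rightarrow> 'y \<Rightarrow> 'y) \<Rightarrow> ('a \<Rightarrow> 'k::real_or_complex) set \<Rightarrow> 'y \<Rightarrow>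
     ('a \<Rightarrow> 'y::banach) set" where
  "elem_tensor M s e y = ae_class M (\<lambda>a. s (rep e a) y)"

text \<open>\<open>E \<otimes> Y\<close> as a subspace of \<open>E(Y)\<close>, and its closure in \<open>E(Y)\<close>.\<close>

definition alg_tensor ::
    "'a measure \<Rightarrow> ('k::real_or_complex, ('a \<Rightarrow> 'k) set) nspace \<Rightarrow>
     ('k \<Rightarrow> 'y \<Rightarrow> 'y) \<Rightarrow> ('k, ('a \<Rightarrow> 'y::banach) set) nspace" where
  "alg_tensor M E s = (valued M E s)
     \<lparr>vcarrier := vspan (valued M E s) {elem_tensor M s e y | e y. e \<in> vcarrier E}\<rparr>"

definition closed_tensor ::
    "'a measure \<Rightarrow> ('k::real_or_complex, ('a \<Rightarrow> 'k) set) nspace \<Rightarrow>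
     ('k \<Rightarrow> 'y \<Rightarrow> 'y) \<Rightarrow> ('k, ('a \<Rightarrow> 'y::banach) set) nspace" where
  "closed_tensor M E s = (valued M E s)
     \<lparr>vcarrier := {f \<in> vcarrier (valued M E s). \<forall>\<epsilon>>0. \<exists>g\<in>vcarrier (alg_tensor M E s).
        vnorm (valued M E s) (vdiff (valued M E s) f g) < \<epsilon>}\<rparr>"

text \<open>\<open>T \<otimes> I\<close>, for \<open>T\<close> from the function space \<open>E\<close> over \<open>M\<close> to the function space \<open>G\<close> over \<open>N\<close>; the
  choice is from a one-element set.\<close>

definition tensor_id ::
    "'a measure \<Rightarrow> 'b measure \<Rightarrow> ('k::real_or_complex, ('a \<Rightarrow> 'k) set) nspace \<Rightarrow>
     ('k, ('b \<Rightarrow> 'k) set) nspace \<Rightarrow> ('k \<Rightarrow> 'y \<Rightarrow> 'y) \<Rightarrow> (('a \<Rightarrow> 'k) set \<Rightarrow> ('b \<Rightarrow> 'k) set) \<Rightarrow>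
     ('a \<Rightarrow> 'y::banach) set \<Rightarrow> ('b \<Rightarrow> 'y) set" where
  "tensor_id M N E G s T = (SOME W. W \<in> linear_ops (alg_tensor M E s) (alg_tensor N G s) \<and>
     (\<forall>e\<in>vcarrier E. \<forall>y. W (elem_tensor M s e y) = elem_tensor N s (T e) y))"

definition extends_tensor_id ::
    "'a measure \<Rightarrow> 'b measure \<Rightarrow> ('k::real_or_complex, ('a \<Rightarrow> 'k) set) nspace \<Rightarrow>
     ('k, ('b \<Rightarrow> 'k) set) nspace \<Rightarrow> ('k \<Rightarrow> 'y \<Rightarrow> 'y) \<Rightarrow> (('a \<Rightarrow> 'k) set \<Rightarrow> ('b \<Rightarrow> 'k) set) \<Rightarrow>
     (('a \<Rightarrow> 'y::banach) set \<Rightarrow> ('b \<Rightarrow> 'y) set) \<Rightarrow> bool" where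
  "extends_tensor_id M N E G s T U \<longleftrightarrow>
     (\<forall>h\<in>vcarrier (alg_tensor M E s). U h = tensor_id M N E G s T h)"

text \<open>\<open>U\<close> is the \<open>Y\<close>-valued extension of \<open>T\<close>; \<open>b\<close> is the form \<open>\<langle>x,y\<rangle>\<close> and \<open>s\<close> the scalar
  multiplication of \<open>Y\<close>.\<close>

definition is_valued_extension ::
    "'a measure \<Rightarrow> 'b measure \<Rightarrow> ('k::real_or_complex, ('a \<Rightarrow> 'k) set) nspace \<Rightarrow>
     ('k, ('b \<Rightarrow> 'k) set) nspace \<Rightarrow> ('k \<Rightarrow> 'y \<Rightarrow> 'y) \<Rightarrow> ('x::banach \<Rightarrow> 'y::banach \<Rightarrow> 'k) \<Rightarrow>
     (('a \<Rightarrow> 'k) set \<Rightarrow> ('b \<Rightarrow> 'k) set) \<Rightarrow> (('a \<Rightarrow> 'y) set \<Rightarrow> ('b \<Rightarrow> 'y) set) \<Rightarrow> bool" where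
  "is_valued_extension M N E G s b T U \<longleftrightarrow> U \<in> bounded_ops (valued M E s) (valued N G s) \<and>
     (\<forall>e\<in>vcarrier (valued M E s). \<forall>x.
        ae_class N (\<lambda>c. b x (rep (U e) c)) = T (ae_class M (\<lambda>a. b x (rep e a))))"


section \<open>Dominated and regular operators between Banach function spaces\<close>

definition positive_ops ::
    "'a measure \<Rightarrow> 'b measure \<Rightarrow> ('k::real_or_complex, ('a \<Rightarrow> 'k) set) nspace \<Rightarrow>
     ('k, ('b \<Rightarrow> 'k) set) nspace \<Rightarrow> (('a \<Rightarrow> 'k) set \<Rightarrow> ('b \<Rightarrow> 'k) set) set" where
  "positive_ops M N E G = {R \<in> bounded_ops E G.
     \<forall>e\<in>vcarrier E. L0_le M (vzero E) e \<longrightarrow> L0_le N (vzero G) (R e)}"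

definition dominates ::
    "'a measure \<Rightarrow> 'b measure \<Rightarrow> ('k::real_or_complex, ('a \<Rightarrow> 'k) set) nspace \<Rightarrow>
     (('a \<Rightarrow> 'k) set \<Rightarrow> ('b \<Rightarrow> 'k) set) \<Rightarrow> (('a \<Rightarrow> 'k) set \<Rightarrow> ('b \<Rightarrow> 'k) set) \<Rightarrow> bool" where
  "dominates M N E R U \<longleftrightarrow> (\<forall>e\<in>vcarrier E. L0_le N (L0_norm N (U e)) (R (L0_norm M e)))"

definition dominated_ops ::
    "'a measure \<Rightarrow> 'b measure \<Rightarrow> ('k::real_or_complex, ('a \<Rightarrow> 'k) set) nspace \<Rightarrow>
     ('k, ('b \<Rightarrow> 'k) set) nspace \<Rightarrow> (('a \<Rightarrow> 'k) set \<Rightarrow> ('b \<Rightarrow> 'k) set) set" where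
  "dominated_ops M N E G = {U \<in> linear_ops E G. \<exists>R\<in>positive_ops M N E G. dominates M N E R U}"

definition dominated_norm ::
    "'a measure \<Rightarrow> 'b measure \<Rightarrow> ('k::real_or_complex, ('a \<Rightarrow> 'k) set) nspace \<Rightarrow>
     ('k, ('b \<Rightarrow> 'k) set) nspace \<Rightarrow> (('a \<Rightarrow> 'k) set \<Rightarrow> ('b \<Rightarrow> 'k) set) \<Rightarrow> real" where
  "dominated_norm M N E G U = Inf (op_norm E G ` {R \<in> positive_ops M N E G. dominates M N E R U})"

definition regular_ops ::
    "'a measure \<Rightarrow> 'b measure \<Rightarrow> ('k::real_or_complex, ('a \<Rightarrow> 'k) set) nspace \<Rightarrow>
     ('k, ('b \<Rightarrow> 'k) set) nspace \<Rightarrow> (('a \<Rightarrow> 'k) set \<Rightarrow> ('b \<Rightarrow> 'k) set) set" where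
  "regular_ops M N E G = vspan (op_space E G) (positive_ops M N E G)"

definition regular_norm ::
    "'a measure \<Rightarrow> 'b measure \<Rightarrow> ('k::real_or_complex, ('a \<Rightarrow> 'k) set) nspace \<Rightarrow>
     ('k, ('b \<Rightarrow> 'k) set) nspace \<Rightarrow> (('a \<Rightarrow> 'k) set \<Rightarrow> ('b \<Rightarrow> 'k) set) \<Rightarrow> real" where
  "regular_norm = dominated_norm"

end

theory Submission
  imports Defs
begin

text \<open>The extension is computed by series. A strongly measurable \<open>f\<close> with values in \<open>Y\<close> can be written
  pointwise as \<open>f = \<Sum>\<^sub>j \<phi>\<^sub>j y\<^sub>j\<close> with scalar functions \<open>\<phi>\<^sub>j\<close> and \<open>\<Sum>\<^sub>j \<bar>\<phi>\<^sub>j\<bar> \<parallel>y\<^sub>j\<parallel> \<le> (1 + \<epsilon>) \<parallel>f\<parallel>\<close>. If \<open>R\<close>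
  dominates \<open>T\<close>, then \<open>\<Sum>\<^sub>j \<bar>T \<phi>\<^sub>j\<bar> \<parallel>y\<^sub>j\<parallel> \<le> (1 + \<epsilon>) R \<parallel>f\<parallel>\<close>, so \<open>\<Sum>\<^sub>j (T \<phi>\<^sub>j) y\<^sub>j\<close> converges almost everywhere.
  Its sum \<open>h\<close> satisfies \<open>\<langle>x, h\<rangle> = T \<langle>x, f\<rangle>\<close> for all \<open>x\<close>: both sides have the same integrals against \<open>F\<close>,
  by dominated convergence and the adjoint relation. As countably many \<open>x\<close> separate the points of a
  separable subspace, \<open>h\<close> is determined by this identity, which makes \<open>T\<^sub>Y f = h\<close> linear and gives
  \<open>\<parallel>T\<^sub>Y f\<parallel> \<le> R \<parallel>f\<parallel>\<close>.

  The modulus of \<open>S\<close> exists in \<open>L\<^sup>1\<close> because a domination of \<open>T\<close> bounds the integrals of finite suprema, so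
  \<open>S\<close> is dominated too. The same construction then extends \<open>S\<close>, even to all of \<open>F(X)\<close>, and termwise
  integration of the series identifies this extension as the adjoint of \<open>T\<^sub>Y\<close>, whence the weak
  continuity. Both uniqueness claims follow from the density of the algebraic tensor product.\<close>


section \<open>Scalars and strongly measurable functions\<close>

text \<open>The operator \<open>R\<close> that dominates \<open>T\<close> need not be weakly
  continuous: its transpose sends \<open>F\<close> into the dual of \<open>Linf A\<close>, not into
  \<open>L1 A\<close>, and so cannot dominate \<open>S\<close>. What remains of it are the functions
  \<open>R 1_X\<close>. They depend additively on the set \<open>X\<close>, and duality gives that
  the integral of |S f| over \<open>X\<close> is at most the integral of |f| R 1_X. Splitting the
  space according to which of finitely many competitors is largest turns this into a bound for the
  integral of their maximum; finite additivity suffices for the splitting, and monotone convergence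
  in \<open>L1 A\<close> does the rest. Weak continuity of \<open>T\<close> enters through the
  adjoint relation: finite sums satisfy it, and \<open>R |f|\<close> is the majorant for the passage
  to the limit. Both \<open>T\<close> and \<open>S\<close> have an adjoint and a space of test
  functions, so one construction, over \<open>adjoint_op\<close>, serves both. The series depends on
  many choices; linearity and the factor 1 in the norm bounds are therefore read off from the
  identities that determine its sum, not from the series. For \<open>T\<close> the density behind
  uniqueness is weak and sequential: in general the algebraic tensors are not norm dense in the
  vector-valued \<open>Linf A\<close>.\<close>

definition re_part :: "'k::real_or_complex \<Rightarrow> real" where "re_part x = Re (to_complex x)"
definition im_part :: "'k::real_or_complex \<Rightarrow> real" where "im_part x = Im (to_complex x)"

lemma to_complex_1: "to_complex (1::'k::real_or_complex) = 1"
proof -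
  have "to_complex (1::'k) * to_complex (1::'k) = to_complex (1::'k)" by (simp flip: to_complex_mult)
  moreover have "to_complex (1::'k) \<noteq> 0" using norm_to_complex[of "1::'k"] by auto
  ultimately show ?thesis by simp
qed

lemma to_complex_of_real: "to_complex (of_real r :: 'k::real_or_complex) = complex_of_real r"
  using to_complex_scaleR[of r "1::'k"] by (simp add: to_complex_1 of_real_def)

lemma to_complex_minus: "to_complex (- x) = - to_complex (x::'k::real_or_complex)"
  using to_complex_scaleR[of "-1" x] by simp

lemma to_complex_diff: "to_complex (x - y) = to_complex x - to_complex (y::'k::real_or_complex)"
  using to_complex_add[of x "- y"] to_complex_minus[of y] by simp

lemma to_complex_inj: "to_complex x = to_complex y \<Longrightarrow> x = (y::'k::real_or_complex)"
  using norm_to_complex[of "x - y"] by (simp add: to_complex_diff)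

lemma part_simps:
  fixes x y :: "'k::real_or_complex"
  shows "re_part (x + y) = re_part x + re_part y" "im_part (x + y) = im_part x + im_part y"
    "re_part (x * y) = re_part x * re_part y - im_part x * im_part y"
    "im_part (x * y) = re_part x * im_part y + im_part x * re_part y"
    "re_part (of_real r :: 'k) = r" "im_part (of_real r :: 'k) = 0"
    "re_part (0 :: 'k) = 0" "im_part (0 :: 'k) = 0"
  using to_complex_of_real[of 0, where 'k='k]
  by (simp_all add: re_part_def im_part_def to_complex_add to_complex_mult to_complex_of_real)

lemma abs_re_part_le: "\<bar>re_part x\<bar> \<le> norm x" and abs_im_part_le: "\<bar>im_part x\<bar> \<le> norm x"
  using abs_Re_le_cmod[of "to_complex x"] abs_Im_le_cmod[of "to_complex x"]
  by (simp_all add: re_part_def im_part_def norm_to_complex)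

text \<open>The value 0 over the real field lets the formula x = Re x + \<open>iunit\<close> Im x,
  and all that is derived from it, cover both fields without a case distinction.\<close>

definition iunit :: "'k::real_or_complex" where
  "iunit = (if \<exists>x::'k. to_complex x = \<i> then SOME x. to_complex x = \<i> else 0)"

lemma iunit_cases:
  "(iunit::'k::real_or_complex) * iunit = -1 \<or> (iunit::'k) = 0 \<and> (\<forall>x::'k. im_part x = 0)"
  and scalar_split: "x = of_real (re_part x) + iunit * of_real (im_part (x::'k))"
proof -
  have "(iunit::'k) * iunit = -1 \<and> (\<forall>x::'k. x = of_real (re_part x) + iunit * of_real (im_part x)) \<or>
    (iunit::'k) = 0 \<and> (\<forall>x::'k. im_part x = 0 \<and> x = of_real (re_part x))"
  proof (cases "\<exists>x::'k. to_complex x = \<i>")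
    case True
    then have i: "to_complex (iunit::'k) = \<i>" unfolding iunit_def using someI_ex[OF True] by simp
    have "(iunit::'k) * iunit = -1"
      by (rule to_complex_inj) (simp add: to_complex_mult i to_complex_minus to_complex_1)
    moreover have "x = of_real (re_part x) + iunit * of_real (im_part x)" for x :: 'k
      by (rule to_complex_inj)
        (simp add: to_complex_add to_complex_mult i to_complex_of_real re_part_def im_part_def complex_eq)
    ultimately show ?thesis by blast
  next
    case False
    then have r: "range (to_complex :: 'k \<Rightarrow> _) = \<real>"
      using range_to_complex by (metis rangeE UNIV_I)
    have "im_part x = 0 \<and> x = of_real (re_part x)" for x :: 'k
    proof -
      have "to_complex x \<in> \<real>" using r by blast
      then obtain t where t: "to_complex x = complex_of_real t" by (auto elim: Reals_cases)
      show ?thesis by (auto simp: im_part_def re_part_def t to_complex_of_real intro: to_complex_inj)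
    qed
    moreover have "(iunit::'k) = 0" using False by (simp add: iunit_def)
    ultimately show ?thesis by blast
  qed
  then show "(iunit::'k::real_or_complex) * iunit = -1 \<or> (iunit::'k) = 0 \<and> (\<forall>x::'k. im_part x = 0)"
    "x = of_real (re_part x) + iunit * of_real (im_part (x::'k))" by (blast, metis add_0_right mult_zero_left)
qed

lemma norm_iunit_le: "norm (iunit::'k::real_or_complex) \<le> 1"
proof (cases "(iunit::'k) = 0")
  case False
  then have "norm (iunit * iunit :: 'k) = 1" using iunit_cases[where 'k='k] by (metis norm_minus_cancel norm_one)
  then have "(norm (iunit::'k))\<^sup>2 = 1" by (simp add: norm_mult power2_eq_square)
  then show ?thesis using norm_ge_zero[of "iunit::'k"] by (auto simp: power2_eq_1_iff)
qed simp

lemma continuous_on_parts: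
  "continuous_on UNIV (re_part :: 'k::real_or_complex \<Rightarrow> real)"
  "continuous_on UNIV (im_part :: 'k::real_or_complex \<Rightarrow> real)"
proof -
  have "bounded_linear (re_part :: 'k \<Rightarrow> real)" "bounded_linear (im_part :: 'k \<Rightarrow> real)"
    using abs_re_part_le abs_im_part_le
    by (auto intro!: bounded_linear_intro[where K=1] simp: part_simps scaleR_conv_of_real)
  then show "continuous_on UNIV (re_part :: 'k \<Rightarrow> real)" "continuous_on UNIV (im_part :: 'k \<Rightarrow> real)"
    by (auto simp: linear_continuous_on)
qed

lemma borel_measurable_parts[measurable]:
  "(re_part :: 'k::real_or_complex \<Rightarrow> real) \<in> borel_measurable borel"
  "(im_part :: 'k::real_or_complex \<Rightarrow> real) \<in> borel_measurable borel"
  by (auto intro: borel_measurable_continuous_onI continuous_on_parts)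

lemma of_real_measurable_scalar[measurable]: "(of_real :: real \<Rightarrow> 'k::real_or_complex) \<in> borel_measurable borel"
  by (intro borel_measurable_continuous_onI continuous_intros)

section \<open>Strong measurability and series of indicator functions\<close>

lemma strongly_measurable_borel:
  assumes "strongly_measurable M f" shows "f \<in> borel_measurable M"
proof -
  obtain s where "\<And>n. simple_function M (s n)" "\<And>a. a \<in> space M \<Longrightarrow> (\<lambda>n. s n a) \<longlonglongrightarrow> f a"
    using assms unfolding strongly_measurable_def by blast
  then show ?thesis
    using borel_measurable_LIMSEQ_metric[of s M f] borel_measurable_simple_function by metis
qed

lemma strongly_measurable_separable_range:
  assumes "strongly_measurable M f" shows "\<exists>D. countable D \<and> f ` space M \<subseteq> closure D"
proof -
  obtain s where s: "\<And>n. simple_function M (s n)" "\<And>a. a \<in> space M \<Longrightarrow> (\<lambda>n. s n a) \<longlonglongrightarrow> f a"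
    using assms unfolding strongly_measurable_def by blast
  have "countable (\<Union>n. s n ` space M)" using s(1) by (auto simp: simple_function_def countable_finite)
  moreover have "f a \<in> closure (\<Union>n. s n ` space M)" if "a \<in> space M" for a
    using s(2)[OF that] that unfolding closure_sequential by (intro exI[of _ "\<lambda>n. s n a"]) auto
  ultimately show ?thesis by blast
qed

text \<open>At level k the function is replaced by a point of \<open>D\<close> at distance below
  \<open>\<eta> k\<close>. The first approximation and the successive differences take countably
  many values each, hence are series of indicators times vectors, and all levels are merged into one
  sequence by \<open>prod_encode\<close>. The control of the sum of norms, not only of the sum, is
  what dominated operators can use.\<close>

lemma indicator_decomposition:
  fixes f :: "'a \<Rightarrow> 'y::banach"
  assumes f[measurable]: "f \<in> borel_measurable M" and D: "countable D" "f ` space M \<subseteq> closure D" and e: "\<epsilon> > 0"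
  obtains A :: "nat \<Rightarrow> 'a set" and y :: "nat \<Rightarrow> 'y" where "\<And>n. A n \<in> sets M"
    "\<And>a. a \<in> space M \<Longrightarrow> (\<lambda>n. indicat_real (A n) a *\<^sub>R y n) sums f a"
    "\<And>a N. a \<in> space M \<Longrightarrow> (\<Sum>n<N. indicat_real (A n) a * norm (y n)) \<le> norm (f a) + \<epsilon>"
proof (cases "space M = {}")
  case True
  then show ?thesis by (intro that[of "\<lambda>_. {}" "\<lambda>_. 0"]) auto
next
  case False
  then have Dn: "D \<noteq> {}" using D(2) by force
  define d where "d = from_nat_into D"
  have ran: "range d = D" unfolding d_def using range_from_nat_into[OF Dn D(1)] .
  \<comment> \<open>The first approximation exceeds \<open>norm (f a)\<close> by at most
    \<open>\<epsilon> / 5\<close>, and the differences are bounded by \<open>2 * \<eta> k\<close>,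
    with sum \<open>4 * \<epsilon> / 5\<close>; together this is \<open>\<epsilon>\<close>.\<close>
  define \<eta> :: "nat \<Rightarrow> real" where "\<eta> k = \<epsilon> / 5 * (1/2) ^ k" for k
  have \<eta>: "\<eta> k > 0" for k using e by (simp add: \<eta>_def)
  \<comment> \<open>Taking the least admissible index makes the choice measurable.\<close>
  define p where "p k a = (LEAST i. dist (f a) (d i) < \<eta> k)" for k a
  have p: "dist (f a) (d (p k a)) < \<eta> k" if "a \<in> space M" for a k
  proof -
    have "f a \<in> closure (range d)" using D(2) ran that by auto
    then have "\<exists>i. dist (f a) (d i) < \<eta> k" using \<eta>[of k] by (auto simp: closure_approachable dist_commute)
    then show ?thesis unfolding p_def by (rule LeastI_ex)
  qed
  have pm[measurable]: "p k \<in> measurable M (count_space UNIV)" for k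
  proof -
    have [measurable]: "(\<lambda>a. dist (f a) (d i)) \<in> borel_measurable M" for i
      using f by (rule borel_measurable_continuous_on[rotated]) (intro continuous_intros)
    show ?thesis unfolding p_def by measurable
  qed
  \<comment> \<open>A difference of two approximations is determined by a pair of indices;
    \<open>q\<close> codes the pair and \<open>w\<close> decodes it to the vector.\<close>
  define q where "q k a = (case k of 0 \<Rightarrow> p 0 a | Suc j \<Rightarrow> prod_encode (p (Suc j) a, p j a))" for k a
  define w where "w k i = (case k of 0 \<Rightarrow> d i | Suc j \<Rightarrow> d (fst (prod_decode i)) - d (snd (prod_decode i)))" for k i
  have qm[measurable]: "q k \<in> measurable M (count_space UNIV)" for k
    unfolding q_def by (cases k) (simp_all, measurable)
  \<comment> \<open>The index \<open>n\<close> codes a level and a value; at a given point exactly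
    one value occurs on each level.\<close>
  define A where "A n = {a \<in> space M. q (fst (prod_decode n)) a = snd (prod_decode n)}" for n
  define y where "y n = w (fst (prod_decode n)) (snd (prod_decode n))" for n
  define h where "h a k = w k (q k a)" for a k
  have h0: "h a 0 = d (p 0 a)" and hS: "h a (Suc k) = d (p (Suc k) a) - d (p k a)" for a k
    by (simp_all add: h_def w_def q_def)
  have hsum: "(\<Sum>k<Suc n. h a k) = d (p n a)" for a n by (induction n) (simp_all add: h0 hS)
  have hb0: "norm (h a 0) \<le> norm (f a) + \<epsilon> / 5" if a: "a \<in> space M" for a
  proof -
    have "norm (d (p 0 a)) \<le> norm (f a) + dist (f a) (d (p 0 a))"
      by (metis dist_norm norm_minus_commute norm_triangle_sub)
    then show ?thesis using p[OF a, of 0] unfolding h0 \<eta>_def by simp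
  qed
  have hbS: "norm (h a (Suc k)) \<le> 2 * \<eta> k" if a: "a \<in> space M" for a k
  proof -
    have "norm (h a (Suc k)) \<le> dist (f a) (d (p (Suc k) a)) + dist (f a) (d (p k a))"
      unfolding hS dist_norm[symmetric] by (metis dist_commute dist_triangle add.commute)
    moreover have "\<eta> (Suc k) \<le> \<eta> k" using e by (simp add: \<eta>_def)
    ultimately show ?thesis using p[OF a, of k] p[OF a, of "Suc k"] by linarith
  qed
  have \<eta>s: "(\<lambda>k. 2 * \<eta> k) sums (4 * \<epsilon> / 5)"
    using sums_mult[OF geometric_sums[of "1/2::real"], of "2 * \<epsilon> / 5"] by (simp add: \<eta>_def field_simps)
  have hs: "summable (\<lambda>k. norm (h a k))" and hle: "(\<Sum>k. norm (h a k)) \<le> norm (f a) + \<epsilon>"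
    if a: "a \<in> space M" for a
  proof -
    have s: "summable (\<lambda>k. norm (h a (Suc k)))"
      by (rule summable_comparison_test'[OF sums_summable[OF \<eta>s], of 0]) (simp add: hbS[OF a])
    then show s': "summable (\<lambda>k. norm (h a k))" by (rule summable_Suc_iff[THEN iffD1])
    have "(\<Sum>k. norm (h a k)) = (\<Sum>k. norm (h a (Suc k))) + norm (h a 0)"
      using suminf_split_head[OF s'] by simp
    also have "(\<Sum>k. norm (h a (Suc k))) \<le> (\<Sum>k. 2 * \<eta> k)"
      by (rule suminf_le[OF _ s sums_summable[OF \<eta>s]]) (simp add: hbS[OF a])
    finally show "(\<Sum>k. norm (h a k)) \<le> norm (f a) + \<epsilon>" using hb0[OF a] sums_unique[OF \<eta>s] by simp
  qed
  have hf: "h a sums f a" if a: "a \<in> space M" for a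
  proof -
    have z: "(\<lambda>n. \<eta> n) \<longlonglongrightarrow> 0" unfolding \<eta>_def by (intro tendsto_mult_right_zero LIMSEQ_power_zero) simp
    have "(\<lambda>n. dist (d (p n a)) (f a)) \<longlonglongrightarrow> 0"
    proof (rule tendsto_sandwich[OF _ _ tendsto_const z])
      show "\<forall>\<^sub>F n in sequentially. dist (d (p n a)) (f a) \<le> \<eta> n"
        by (auto intro!: always_eventually less_imp_le simp: dist_commute p[OF a])
    qed auto
    then have "(\<lambda>n. d (p n a)) \<longlonglongrightarrow> f a" using tendsto_dist_iff by blast
    then have "(\<lambda>n. \<Sum>k<Suc n. h a k) \<longlonglongrightarrow> f a" by (simp only: hsum)
    then show ?thesis unfolding sums_def by (rule filterlim_sequentially_Suc[THEN iffD1])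
  qed
  \<comment> \<open>At a fixed point the nonzero terms of the merged series lie on the range of
    \<open>\<sigma>\<close>, one for each level. Unconditional summation allows this reindexing,
    both for the vectors and for their norms.\<close>
  have transfer: "((\<lambda>n. indicat_real (A n) a *\<^sub>R F (fst (prod_decode n)) (snd (prod_decode n))) has_sum l) UNIV"
    if a: "a \<in> space M" and hs: "((\<lambda>k. F k (q k a)) has_sum l) UNIV" for a and F :: "nat \<Rightarrow> nat \<Rightarrow> 'z::banach" and l
  proof -
    define \<sigma> where "\<sigma> k = prod_encode (k, q k a)" for k
    let ?t = "\<lambda>n. indicat_real (A n) a *\<^sub>R F (fst (prod_decode n)) (snd (prod_decode n))"
    have inj: "inj_on \<sigma> UNIV" by (rule injI) (simp add: \<sigma>_def prod_encode_eq)
    have "(?t \<circ> \<sigma>) = (\<lambda>k. F k (q k a))" using a by (auto simp: \<sigma>_def A_def)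
    then have "(?t has_sum l) (range \<sigma>)" using hs has_sum_reindex[OF inj, of ?t l] by simp
    moreover have "?t n = 0" if "n \<in> UNIV - range \<sigma>" for n
    proof -
      have "n \<noteq> \<sigma> (fst (prod_decode n))" using that by blast
      then have "q (fst (prod_decode n)) a \<noteq> snd (prod_decode n)"
        unfolding \<sigma>_def by (metis prod.collapse prod_decode_inverse)
      then show ?thesis by (simp add: A_def)
    qed
    ultimately show ?thesis using has_sum_cong_neutral[of UNIV "range \<sigma>" ?t ?t l] by blast
  qed
  show ?thesis
  proof (rule that[of A y])
    show "A n \<in> sets M" for n unfolding A_def by measurable
    show "(\<lambda>n. indicat_real (A n) a *\<^sub>R y n) sums f a" if a: "a \<in> space M" for a
      using has_sum_imp_sums[OF transfer[OF a, of w "f a"]] norm_summable_imp_has_sum[OF hs[OF a] hf[OF a]]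
      by (simp add: h_def[abs_def] y_def)
    show "(\<Sum>n<N. indicat_real (A n) a * norm (y n)) \<le> norm (f a) + \<epsilon>" if a: "a \<in> space M" for a N
    proof -
      have "((\<lambda>k. norm (h a k)) has_sum (\<Sum>k. norm (h a k))) UNIV"
        using hs[OF a] by (intro norm_summable_imp_has_sum) (auto simp: summable_sums)
      then have s: "(\<lambda>n. indicat_real (A n) a * norm (y n)) sums (\<Sum>k. norm (h a k))"
        using has_sum_imp_sums[OF transfer[OF a, of "\<lambda>k i. norm (w k i)" "\<Sum>k. norm (h a k)"]]
        by (simp add: h_def y_def)
      have "(\<Sum>n<N. indicat_real (A n) a * norm (y n)) \<le> (\<Sum>k. norm (h a k))"
        using sum_le_suminf[OF sums_summable[OF s], of "{..<N}"] sums_unique[OF s] by simp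
      then show ?thesis using hle[OF a] by linarith
    qed
  qed
qed

text \<open>Pettis' criterion: the partial sums of the indicator series are simple functions. With
  it, limits of strongly measurable functions are treated without a diagonal choice of simple
  functions.\<close>

lemma strongly_measurable_iff:
  fixes f :: "'a \<Rightarrow> 'y::banach"
  shows "strongly_measurable M f \<longleftrightarrow> f \<in> borel_measurable M \<and> (\<exists>D. countable D \<and> f ` space M \<subseteq> closure D)"
proof
  assume "f \<in> borel_measurable M \<and> (\<exists>D. countable D \<and> f ` space M \<subseteq> closure D)"
  then obtain A y where A: "\<And>n. A n \<in> sets M"
    "\<And>a. a \<in> space M \<Longrightarrow> (\<lambda>n. indicat_real (A n) a *\<^sub>R y n) sums f a"
    using indicator_decomposition[of f M _ 1] by (metis zero_less_one)
  have "simple_function M (\<lambda>a. \<Sum>n<N. indicat_real (A n) a *\<^sub>R y n)" for N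
    by (intro simple_function_sum simple_function_compose1[where f="indicat_real _" and g="\<lambda>r. r *\<^sub>R _"]
        simple_function_indicator A(1))
  then show "strongly_measurable M f" using A(2) unfolding strongly_measurable_def sums_def
    by (intro exI[of _ "\<lambda>N a. \<Sum>n<N. indicat_real (A n) a *\<^sub>R y n"]) blast
qed (blast intro: strongly_measurable_borel strongly_measurable_separable_range)

lemma strongly_measurable_lim:
  fixes f :: "'a \<Rightarrow> 'y::banach"
  assumes "\<And>n. strongly_measurable M (g n)" "\<And>a. a \<in> space M \<Longrightarrow> (\<lambda>n. g n a) \<longlonglongrightarrow> f a"
  shows "strongly_measurable M f"
proof -
  have "\<forall>n. \<exists>D. countable D \<and> g n ` space M \<subseteq> closure D"
    using assms(1) strongly_measurable_separable_range by blast
  then obtain D where D: "\<And>n. countable (D n)" "\<And>n. g n ` space M \<subseteq> closure (D n)" by metis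
  have "f a \<in> closure (\<Union>n. D n)" if a: "a \<in> space M" for a
  proof -
    have "g n a \<in> closure (\<Union>n. D n)" for n
      using D(2)[of n] a closure_mono[of "D n" "\<Union>n. D n"] by blast
    then show ?thesis using assms(2)[OF a] by (rule closed_sequentially[OF closed_closure])
  qed
  moreover have "f \<in> borel_measurable M"
    using assms strongly_measurable_borel by (intro borel_measurable_LIMSEQ_metric[of g M f]) auto
  ultimately show ?thesis unfolding strongly_measurable_iff using D(1) by (intro conjI exI[of _ "\<Union>n. D n"]) auto
qed

lemma strongly_measurable_simple: "simple_function M f \<Longrightarrow> strongly_measurable M f"
  unfolding strongly_measurable_def by (intro exI[of _ "\<lambda>_. f"]) auto

lemma strongly_measurable_const: "strongly_measurable M (\<lambda>_. c)"
  by (rule strongly_measurable_simple) auto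

lemma strongly_measurable_comp:
  assumes "strongly_measurable M f" "continuous_on UNIV g"
  shows "strongly_measurable M (\<lambda>a. g (f a))"
proof -
  obtain s where s: "\<And>n. simple_function M (s n)" "\<And>a. a \<in> space M \<Longrightarrow> (\<lambda>n. s n a) \<longlonglongrightarrow> f a"
    using assms(1) unfolding strongly_measurable_def by blast
  show ?thesis unfolding strongly_measurable_def
    using s assms(2) by (intro exI[of _ "\<lambda>n a. g (s n a)"])
      (auto intro!: simple_function_compose1[where g=g] isCont_tendsto_compose[where g=g] simp: continuous_on_eq_continuous_at)
qed

lemma strongly_measurable_comp2:
  assumes "strongly_measurable M f1" "strongly_measurable M f2"
    "\<And>u v x y. u \<longlonglongrightarrow> x \<Longrightarrow> v \<longlonglongrightarrow> y \<Longrightarrow> (\<lambda>n::nat. g (u n) (v n)) \<longlonglongrightarrow> g x y"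
  shows "strongly_measurable M (\<lambda>a. g (f1 a) (f2 a))"
proof -
  obtain s where s: "\<And>n. simple_function M (s n)" "\<And>a. a \<in> space M \<Longrightarrow> (\<lambda>n. s n a) \<longlonglongrightarrow> f1 a"
    using assms(1) unfolding strongly_measurable_def by blast
  obtain t where t: "\<And>n. simple_function M (t n)" "\<And>a. a \<in> space M \<Longrightarrow> (\<lambda>n. t n a) \<longlonglongrightarrow> f2 a"
    using assms(2) unfolding strongly_measurable_def by blast
  show ?thesis unfolding strongly_measurable_def
    using s t assms(3) by (intro exI[of _ "\<lambda>n a. g (s n a) (t n a)"])
      (auto intro!: simple_function_compose2[where h=g])
qed

lemma strongly_measurable_add:
  "strongly_measurable M f \<Longrightarrow> strongly_measurable M g \<Longrightarrow> strongly_measurable M (\<lambda>a. f a + g a)"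
  by (rule strongly_measurable_comp2) (auto intro: tendsto_add)

lemma strongly_measurable_sum:
  "(\<And>i. strongly_measurable M (f i)) \<Longrightarrow> strongly_measurable M (\<lambda>a. \<Sum>i<n::nat. f i a)"
  by (induction n) (simp_all add: strongly_measurable_const strongly_measurable_add)

text \<open>Countably many of the balls around the points of a countable dense subset of the range are each
  separated from \<open>0\<close> by one functional, and together they cover the range without \<open>0\<close>.\<close>

lemma AE_zero_if_separated:
  fixes g :: "'a \<Rightarrow> 'y::banach" and b :: "'x \<Rightarrow> 'y \<Rightarrow> 'k::real_normed_vector"
  assumes g: "strongly_measurable M g" and cont: "\<And>x. continuous_on UNIV (b x)"
    and sep: "\<And>y. (\<And>x. b x y = 0) \<Longrightarrow> y = 0"
    and ae: "\<And>x. AE a in M. b x (g a) = 0"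
  shows "AE a in M. g a = 0"
proof -
  obtain D where D: "countable D" "g ` space M \<subseteq> closure D"
    using strongly_measurable_separable_range[OF g] by blast
  \<comment> \<open>The choice is meaningful only if some functional has no zero on the whole ball;
    every point with \<open>g a \<noteq> 0\<close> lies in a ball of this kind.\<close>
  define X where "X p = (SOME x. \<forall>y\<in>ball (fst p) (1 / real (Suc (snd p))). b x y \<noteq> 0)" for p :: "'y \<times> nat"
  have "AE a in M. \<forall>p\<in>D \<times> UNIV. b (X p) (g a) = 0"
    using D(1) ae by (subst AE_ball_countable) auto
  then show ?thesis
  proof (rule AE_mp, intro AE_I2 impI)
    fix a assume a: "a \<in> space M" and z: "\<forall>p\<in>D \<times> UNIV. b (X p) (g a) = 0"
    show "g a = 0"
    proof (rule ccontr)
      assume "g a \<noteq> 0"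
      then obtain x where x: "b x (g a) \<noteq> 0" using sep by blast
      have "isCont (b x) (g a)" using cont[of x] by (simp add: continuous_on_eq_continuous_at)
      then have "\<exists>e>0. \<forall>y. dist (g a) y < e \<longrightarrow> b x y \<noteq> 0" using continuous_at_avoid[of "g a" "b x" 0] x by auto
      then obtain e where e: "e > 0" "\<And>y. dist (g a) y < e \<Longrightarrow> b x y \<noteq> 0" by blast
      \<comment> \<open>Below \<open>e / 2\<close>, so that the ball of this radius around a point
        \<open>d\<close> that is equally close to \<open>g a\<close> stays within distance
        \<open>e\<close> of \<open>g a\<close>.\<close>
      obtain n where n: "1 / real (Suc n) < e / 2" using e(1) nat_approx_posE[of "e/2"] by auto
      have "g a \<in> closure D" using D(2) a by blast
      then obtain d where d: "d \<in> D" "dist d (g a) < 1 / real (Suc n)"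
        by (metis closure_approachable of_nat_0_less_iff zero_less_Suc zero_less_divide_1_iff)
      have "\<exists>x. \<forall>y\<in>ball d (1 / real (Suc n)). b x y \<noteq> 0"
      proof (intro exI ballI)
        fix y assume "y \<in> ball d (1 / real (Suc n))"
        then have "dist (g a) y < e" using d(2) n dist_triangle[of "g a" y d] by (simp add: dist_commute)
        then show "b x y \<noteq> 0" by (rule e(2))
      qed
      then have "\<forall>y\<in>ball d (1 / real (Suc n)). b (X (d, n)) y \<noteq> 0"
        unfolding X_def fst_conv snd_conv by (rule someI_ex)
      then have "b (X (d, n)) (g a) \<noteq> 0" using d(2) by simp
      then show False using z d(1) by auto
    qed
  qed
qed


section \<open>Function spaces\<close>

lemma strongly_measurable_scalar:
  "strongly_measurable M (f :: 'a \<Rightarrow> 'k::real_or_complex) \<longleftrightarrow> f \<in> borel_measurable M"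
  by (rule strongly_measurable_iff_borel_measurable)

lemma strongly_measurable_norm:
  assumes "strongly_measurable M f"
  shows "(\<lambda>a. norm (f a)) \<in> borel_measurable M"
  using strongly_measurable_comp[OF assms, of norm] by (auto intro: strongly_measurable_borel continuous_on_norm_id)

lemma ae_class_cong: "AE a in M. f a = g a \<Longrightarrow> ae_class M f = ae_class M g"
  unfolding ae_class_def by (intro Collect_cong conj_cong refl) (auto elim: AE_mp)

lemma ae_class_eqD:
  "ae_class M f = ae_class M g \<Longrightarrow> strongly_measurable M f \<Longrightarrow> AE a in M. f a = g a"
  unfolding ae_class_def by auto

lemma ae_class_L0: "strongly_measurable M f \<Longrightarrow> ae_class M f \<in> L0 M"
  unfolding L0_def by blast

lemma rep_ae_class:
  assumes "strongly_measurable M f"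
  shows "strongly_measurable M (rep (ae_class M f))" "AE a in M. rep (ae_class M f) a = f a"
proof -
  have "f \<in> ae_class M f" using assms by (simp add: ae_class_def)
  then have "rep (ae_class M f) \<in> ae_class M f" unfolding rep_def by (rule someI[of "\<lambda>g. g \<in> _"])
  then show "strongly_measurable M (rep (ae_class M f))" "AE a in M. rep (ae_class M f) a = f a"
    by (auto simp: ae_class_def)
qed

lemma L0_rep:
  assumes "c \<in> L0 M"
  shows "strongly_measurable M (rep c)" "ae_class M (rep c) = c"
proof -
  obtain f where f: "c = ae_class M f" "strongly_measurable M f" using assms by (auto simp: L0_def)
  show "strongly_measurable M (rep c)" using rep_ae_class(1)[OF f(2)] f(1) by simp
  show "ae_class M (rep c) = c" using ae_class_cong[OF rep_ae_class(2)[OF f(2)]] f(1) by simp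
qed

lemma L0_norm_ae_class:
  assumes "strongly_measurable M f"
  shows "L0_norm M (ae_class M f) = ae_class M (\<lambda>a. of_real (norm (f a)))"
  unfolding L0_norm_def using rep_ae_class(2)[OF assms] by (intro ae_class_cong) (auto elim: AE_mp)

section \<open>Scalar actions on Banach spaces and bilinear pairings\<close>

locale scaling =
  fixes s :: "'k::real_or_complex \<Rightarrow> 'y::banach \<Rightarrow> 'y"
  assumes add_right: "s c (x + y) = s c x + s c y"
    and add_left: "s (c + d) x = s c x + s d x"
    and assoc: "s c (s d x) = s (c * d) x"
    and one: "s 1 x = x"
    and norm_eq: "norm (s c x) = norm c * norm x"
begin

lemma zero_left: "s 0 x = 0" using add_left[of 0 0 x] by simp
lemma zero_right: "s c 0 = 0" using add_right[of c 0 0] by simp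
lemma minus_left: "s (- c) x = - s c x" using add_left[of c "- c" x] by (simp add: zero_left minus_unique)

text \<open>Additivity makes \<open>r \<mapsto> s (of_real r) x - r *\<^sub>R x\<close> vanish on the integers; being bounded on \<open>[0,1]\<close>, it is
  then bounded, and a bounded additive map is zero.\<close>

lemma of_real: "s (of_real r) x = r *\<^sub>R x"
proof -
  define f where "f r = s (of_real r) x - r *\<^sub>R x" for r
  have fadd: "f (r + t) = f r + f t" for r t by (simp add: f_def add_left scaleR_add_left)
  have f0: "f 0 = 0" by (simp add: f_def zero_left)
  have fm: "f (- r) = - f r" for r using fadd[of r "- r"] by (simp add: f0 minus_unique)
  have fn: "f (real n * r) = real n *\<^sub>R f r" for n r
    by (induction n) (simp_all add: f0 fadd distrib_right scaleR_add_left)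
  have f1: "f 1 = 0" by (simp add: f_def one)
  have fi: "f (of_int i) = 0" for i
  proof (cases i rule: int_cases2)
    case (nonneg n) then show ?thesis using fn[of n 1] by (simp add: f1)
  next
    case (nonpos n) then show ?thesis using fn[of n 1] fm[of "real n"] by (simp add: f1)
  qed
  have bd: "norm (f r) \<le> 2 * norm x" for r
  proof -
    have "f r = f (frac r)" using fadd[of "of_int \<lfloor>r\<rfloor>" "frac r"] by (simp add: fi frac_def)
    also have "norm \<dots> \<le> norm (s (of_real (frac r)) x) + norm (frac r *\<^sub>R x)"
      unfolding f_def by (rule norm_triangle_ineq4)
    also have "\<dots> = 2 * (frac r * norm x)" by (simp add: norm_eq)
    also have "\<dots> \<le> 2 * norm x"
      using frac_lt_1[of r] frac_ge_0[of r] by (simp add: mult_left_le_one_le)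
    finally show ?thesis .
  qed
  have "f r = 0"
  proof (rule ccontr)
    assume "f r \<noteq> 0"
    then obtain n where "2 * norm x < real n * norm (f r)"
      using reals_Archimedean3[of "norm (f r)"] by auto
    then show False using bd[of "real n * r"] by (simp add: fn)
  qed
  then show ?thesis by (simp add: f_def)
qed

lemma bounded_bilinear: "bounded_bilinear s"
proof (unfold_locales)
  show "s (r *\<^sub>R c) x = r *\<^sub>R s c x" for r c x
    using assoc[of "of_real r" c x] by (simp add: of_real scaleR_conv_of_real)
  show "s c (r *\<^sub>R x) = r *\<^sub>R s c x" for r c x
    using assoc[of "of_real r" c x] assoc[of c "of_real r" x] by (simp add: of_real mult.commute)
  show "\<exists>K. \<forall>c x. norm (s c x) \<le> norm c * norm x * K" by (intro exI[of _ 1]) (simp add: norm_eq)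
qed (simp_all add: add_right add_left)

lemma strongly_measurable:
  assumes "strongly_measurable M f" "strongly_measurable M g"
  shows "strongly_measurable M (\<lambda>a. s (f a) (g a))"
  using assms by (rule strongly_measurable_comp2) (rule bounded_bilinear.tendsto[OF bounded_bilinear])

lemma strongly_measurable_left:
  assumes "f \<in> borel_measurable M"
  shows "strongly_measurable M (\<lambda>a. s (f a) x)"
  using assms by (intro strongly_measurable strongly_measurable_const) (simp add: strongly_measurable_scalar)

lemma strongly_measurable_right:
  assumes "strongly_measurable M f"
  shows "strongly_measurable M (\<lambda>a. s c (f a))"
  using assms strongly_measurable_const by (rule strongly_measurable[rotated])

end

lemma scaling_type_space:
  assumes "normed_space_on (type_space s)" shows "scaling s"
proof -
  interpret normed_space_on "type_space s" by (rule assms)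
  show ?thesis
    using scale_add_right scale_add_left scale_scale scale_one norm_scale
    by unfold_locales (simp_all add: type_space_def)
qed

text \<open>Separation is one-sided, which allows two instances for one dual pair: \<open>T\<close>
  needs the points of Y separated by X, \<open>S\<close> the converse with the form flipped. Both
  orientations come from \<open>pairing_of_dual_pair\<close>.\<close>

locale pairing = X: scaling sX + Y: scaling sY
  for sX :: "'k::real_or_complex \<Rightarrow> 'x::banach \<Rightarrow> 'x" and sY :: "'k \<Rightarrow> 'y::banach \<Rightarrow> 'y" +
  fixes b :: "'x \<Rightarrow> 'y \<Rightarrow> 'k"
  assumes add_left: "b (x + x') y = b x y + b x' y"
    and add_right: "b x (y + y') = b x y + b x y'"
    and scale_left: "b (sX c x) y = c * b x y"
    and scale_right: "b x (sY c y) = c * b x y"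
    and bounded: "\<exists>C. \<forall>x y. norm (b x y) \<le> C * norm x * norm y"
    and separating: "(\<And>x. b x y = 0) \<Longrightarrow> y = 0"
begin

lemma bounded_bilinear: "bounded_bilinear b"
proof (unfold_locales)
  show "b (r *\<^sub>R x) y = r *\<^sub>R b x y" for r x y
    using scale_left[of "of_real r" x y] by (simp add: X.of_real scaleR_conv_of_real)
  show "b x (r *\<^sub>R y) = r *\<^sub>R b x y" for r x y
    using scale_right[of x "of_real r" y] by (simp add: Y.of_real scaleR_conv_of_real)
  show "\<exists>K. \<forall>x y. norm (b x y) \<le> norm x * norm y * K" using bounded by (metis mult.commute mult.assoc)
qed (simp_all add: add_right add_left)

lemma bound: obtains C where "C \<ge> 0" "\<And>x y. norm (b x y) \<le> C * norm x * norm y"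
proof -
  obtain C where C: "\<And>x y. norm (b x y) \<le> C * norm x * norm y" using bounded by blast
  have "norm (b x y) \<le> \<bar>C\<bar> * norm x * norm y" for x y
    using C[of x y] by (rule order_trans) (intro mult_right_mono; simp)
  then show ?thesis by (intro that[of "\<bar>C\<bar>"]) auto
qed

lemma continuous: "continuous_on UNIV (b x)"
  using bounded_bilinear by (auto intro: bounded_bilinear.continuous_on continuous_on_const continuous_on_id)

lemma measurable:
  assumes "strongly_measurable M f" "strongly_measurable M g"
  shows "(\<lambda>a. b (f a) (g a)) \<in> borel_measurable M"
  unfolding strongly_measurable_scalar[symmetric]
  using assms by (rule strongly_measurable_comp2) (rule bounded_bilinear.tendsto[OF bounded_bilinear])

lemma measurable_right:
  "strongly_measurable M g \<Longrightarrow> (\<lambda>a. b x (g a)) \<in> borel_measurable M"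
  by (intro measurable strongly_measurable_const)

end

lemma pairing_of_dual_pair:
  assumes "banach_dual_pair (type_space sX) (type_space sY) b"
  shows "pairing sX sY b" "pairing sY sX (\<lambda>y x. b x y)"
proof -
  note d = assms[unfolded banach_dual_pair_def]
  have sX: "scaling sX" and sY: "scaling sY"
    using d by (auto intro!: scaling_type_space simp: banach_space_on_def)
  have addl: "b (x + x') y = b x y + b x' y" and addr: "b x (y + y') = b x y + b x y'"
    and sl: "b (sX c x) y = c * b x y" and sr: "b x (sY c y) = c * b x y" for x x' y y' c
    using d by (auto simp: type_space_def)
  have bd: "\<exists>C. \<forall>x y. norm (b x y) \<le> C * norm x * norm y" using d by (auto simp: type_space_def)
  have [simp]: "restrict f UNIV = f" for f :: "'u \<Rightarrow> 'v" by (auto simp: restrict_def)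
  have inj1: "inj (\<lambda>x y. b x y)" and inj2: "inj (\<lambda>y x. b x y)" using d by (auto simp: type_space_def)
  have z: "b 0 y = 0" "b x 0 = 0" for x y using addl[of 0 0 y] addr[of x 0 0] by auto
  have sep2: "y = 0" if "\<And>x. b x y = 0" for y using injD[OF inj2, of y 0] that z by auto
  have sep1: "x = 0" if "\<And>y. b x y = 0" for x using injD[OF inj1, of x 0] that z by auto
  show "pairing sX sY b"
    using sX sY addl addr sl sr bd sep2 by (auto simp: pairing_def pairing_axioms_def)
  obtain C where C: "\<And>x y. norm (b x y) \<le> C * norm x * norm y" using bd by blast
  have "\<exists>C. \<forall>y x. norm (b x y) \<le> C * norm y * norm x"
  proof (intro exI allI)
    show "norm (b x y) \<le> C * norm y * norm x" for x y using C[of x y] by (simp add: ac_simps)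
  qed
  then show "pairing sY sX (\<lambda>y x. b x y)"
    using sX sY addl addr sl sr sep1 by (auto simp: pairing_def pairing_axioms_def)
qed

section \<open>Ideals of scalar functions and their norms\<close>

lemma function_space_simps [simp]:
  "vcarrier (function_space M s C N) = C" "vnorm (function_space M s C N) = N"
  "vzero (function_space M s C N) = ae_class M (\<lambda>_. 0)"
  by (simp_all add: function_space_def)

lemma function_space_ops:
  assumes "strongly_measurable M f"
  shows "strongly_measurable M g \<Longrightarrow>
      vadd (function_space M s C N) (ae_class M f) (ae_class M g) = ae_class M (\<lambda>a. f a + g a)"
    and "vscale (function_space M s C N) c (ae_class M f) = ae_class M (\<lambda>a. s c (f a))"
  unfolding function_space_def using rep_ae_class(2)[OF assms] rep_ae_class(2)[of M g]
  by (auto intro!: ae_class_cong elim: AE_mp)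

text \<open>\<open>mem\<close> and \<open>fnorm\<close> let one argue with functions instead of a.e. classes.\<close>

locale function_ideal =
  fixes M :: "'a measure" and E :: "('k::real_or_complex, ('a \<Rightarrow> 'k) set) nspace"
  assumes eq_function_space: "E = function_space M (*) (vcarrier E) (vnorm E)"
    and carrier_L0: "vcarrier E \<subseteq> L0 M"
begin

definition mem :: "('a \<Rightarrow> 'k) \<Rightarrow> bool" where
  "mem f \<longleftrightarrow> f \<in> borel_measurable M \<and> ae_class M f \<in> vcarrier E"

definition fnorm :: "('a \<Rightarrow> 'k) \<Rightarrow> real" where "fnorm f = vnorm E (ae_class M f)"

lemma mem_rep: "c \<in> vcarrier E \<Longrightarrow> mem (rep c)"
  using carrier_L0 L0_rep[of c M] by (auto simp: mem_def strongly_measurable_scalar)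

lemma ae_class_rep: "c \<in> vcarrier E \<Longrightarrow> ae_class M (rep c) = c"
  using carrier_L0 L0_rep[of c M] by auto

lemma carrier_cases:
  assumes "c \<in> vcarrier E" obtains f where "mem f" "c = ae_class M f"
  by (rule that[OF mem_rep[OF assms] ae_class_rep[OF assms, symmetric]])

lemma rep_class: "mem f \<Longrightarrow> AE a in M. rep (ae_class M f) a = f a"
  by (simp add: mem_def rep_ae_class strongly_measurable_scalar)

lemma mem_measurable: "mem f \<Longrightarrow> f \<in> borel_measurable M"
  by (simp add: mem_def)

lemma mem_carrier: "mem f \<Longrightarrow> ae_class M f \<in> vcarrier E"
  by (simp add: mem_def)

lemma vadd_class:
  "mem f \<Longrightarrow> mem g \<Longrightarrow> vadd E (ae_class M f) (ae_class M g) = ae_class M (\<lambda>a. f a + g a)"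
  by (subst eq_function_space) (simp add: function_space_ops strongly_measurable_scalar mem_measurable)

lemma vscale_class: "mem f \<Longrightarrow> vscale E c (ae_class M f) = ae_class M (\<lambda>a. c * f a)"
  by (subst eq_function_space) (simp add: function_space_ops strongly_measurable_scalar mem_measurable)

lemma vzero_class: "vzero E = ae_class M (\<lambda>_. 0)"
  by (subst eq_function_space) simp

end

text \<open>The common interface of \<open>F\<close>, \<open>G\<close>, \<open>L1 A\<close> and
  \<open>Linf A\<close>: an order ideal with a monotone seminorm, expressed for functions. It is
  what allows the same construction for \<open>T\<close> and for \<open>S\<close>.\<close>

locale function_lattice = function_ideal M E
  for M :: "'a measure" and E :: "('k::real_or_complex, ('a \<Rightarrow> 'k) set) nspace" +
  assumes mem_zero: "mem (\<lambda>_. 0)"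
    and mem_add: "mem f \<Longrightarrow> mem g \<Longrightarrow> mem (\<lambda>a. f a + g a)"
    and mem_scale: "mem f \<Longrightarrow> mem (\<lambda>a. c * f a)"
    and mem_solid: "mem g \<Longrightarrow> f \<in> borel_measurable M \<Longrightarrow> AE a in M. norm (f a) \<le> norm (g a) \<Longrightarrow> mem f"
    and fnorm_mono: "mem g \<Longrightarrow> f \<in> borel_measurable M \<Longrightarrow> AE a in M. norm (f a) \<le> norm (g a) \<Longrightarrow>
      fnorm f \<le> fnorm g"
    and fnorm_zero: "fnorm (\<lambda>_. 0) = 0"
    and fnorm_triangle: "mem f \<Longrightarrow> mem g \<Longrightarrow> fnorm (\<lambda>a. f a + g a) \<le> fnorm f + fnorm g"
    and fnorm_scale: "mem f \<Longrightarrow> fnorm (\<lambda>a. c * f a) = norm c * fnorm f"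

lemma L0_le_norm_iff:
  fixes f g :: "'a \<Rightarrow> 'k::real_or_complex"
  assumes "f \<in> borel_measurable M" "g \<in> borel_measurable M"
  shows "L0_le M (L0_norm M (ae_class M f)) (L0_norm M (ae_class M g) :: ('a \<Rightarrow> 'k) set) \<longleftrightarrow>
    (AE a in M. norm (f a) \<le> norm (g a))"
proof -
  have m: "strongly_measurable M f" "strongly_measurable M g"
    using assms by (simp_all add: strongly_measurable_scalar)
  have n: "strongly_measurable M (\<lambda>a. of_real (norm (f a)) :: 'k)" "strongly_measurable M (\<lambda>a. of_real (norm (g a)) :: 'k)"
    using assms by (simp_all add: strongly_measurable_scalar)
  have "AE a in M. (rep (ae_class M (\<lambda>a. of_real (norm (g a)))) a - rep (ae_class M (\<lambda>a. of_real (norm (f a)))) a \<in> (\<real>\<^sub>\<ge>\<^sub>0 :: 'k set))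
    \<longleftrightarrow> norm (f a) \<le> norm (g a)"
    using rep_ae_class(2)[OF n(1)] rep_ae_class(2)[OF n(2)]
  proof eventually_elim
    case (elim a)
    have "of_real (norm (g a)) - of_real (norm (f a)) = (of_real (norm (g a) - norm (f a)) :: 'k)" by simp
    then show ?case unfolding elim by (simp del: of_real_diff)
  qed
  then show ?thesis unfolding L0_le_def L0_norm_ae_class[OF m(1)] L0_norm_ae_class[OF m(2)] by (rule eventually_subst)
qed

lemma function_lattice_of_bfs:
  assumes "banach_function_space M E" shows "function_lattice M E"
proof -
  note d = assms[unfolded banach_function_space_def]
  interpret function_ideal M E using d by unfold_locales auto
  interpret B: normed_space_on E using d by (simp add: banach_space_on_def)
  have solid: "mem f \<and> fnorm f \<le> fnorm g"
    if "mem g" "f \<in> borel_measurable M" "AE a in M. norm (f a) \<le> norm (g a)" for f g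
    using d that L0_le_norm_iff[of f M g] ae_class_L0[of M f]
    by (auto simp: mem_def fnorm_def strongly_measurable_scalar)
  have z: "mem (\<lambda>_. 0)" using B.zero_closed by (simp add: mem_def vzero_class)
  show ?thesis
  proof
    show "mem (\<lambda>a. f a + g a)" if "mem f" "mem g" for f g
      using B.add_closed[of "ae_class M f" "ae_class M g"] that
      by (simp add: vadd_class mem_carrier) (simp add: mem_def borel_measurable_add)
    show "mem (\<lambda>a. c * f a)" if "mem f" for f c
      using B.scale_closed[of "ae_class M f" c] that
      by (simp add: vscale_class mem_carrier) (simp add: mem_def borel_measurable_times)
    show "fnorm (\<lambda>_. 0) = 0" using B.norm_eq_zero[OF B.zero_closed] by (simp add: fnorm_def vzero_class)
    show "fnorm (\<lambda>a. f a + g a) \<le> fnorm f + fnorm g" if "mem f" "mem g" for f g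
      using B.norm_triangle[of "ae_class M f" "ae_class M g"] that
      by (simp add: vadd_class mem_carrier fnorm_def)
    show "fnorm (\<lambda>a. c * f a) = norm c * fnorm f" if "mem f" for f c
      using B.norm_scale[of "ae_class M f" c] that
      by (simp add: vscale_class mem_carrier fnorm_def)
  qed (use z solid in auto)
qed

section \<open>The function lattices of integrable and of essentially bounded functions\<close>

lemma function_ideal_L1: "function_ideal M (L1 M)" and function_ideal_Linf: "function_ideal M (Linf M)"
  by unfold_locales (auto simp: L1_def Linf_def)

lemma L1_mem: "function_ideal.mem M (L1 M) f \<longleftrightarrow> integrable M (f :: 'a \<Rightarrow> 'k::real_or_complex)"
proof (cases "f \<in> borel_measurable M")
  case True
  then have s: "strongly_measurable M f" by (simp add: strongly_measurable_scalar)
  have "integrable M (rep (ae_class M f)) \<longleftrightarrow> integrable M f"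
    using rep_ae_class[OF s] True by (intro integrable_cong_AE) (auto simp: strongly_measurable_scalar)
  then show ?thesis using True s
    unfolding function_ideal.mem_def[OF function_ideal_L1] by (simp add: L1_def ae_class_L0)
qed (auto simp: function_ideal.mem_def[OF function_ideal_L1])

lemma L1_fnorm:
  assumes "(f :: 'a \<Rightarrow> 'k::real_or_complex) \<in> borel_measurable M"
  shows "function_ideal.fnorm M (L1 M) f = (\<integral>a. norm (f a) \<partial>M)"
  unfolding function_ideal.fnorm_def[OF function_ideal_L1] using assms rep_ae_class[of M f]
  by (simp add: L1_def) (intro integral_cong_AE, auto simp: strongly_measurable_scalar elim: AE_mp)

lemma Linf_mem:
  "function_ideal.mem M (Linf M) f \<longleftrightarrow>
    f \<in> borel_measurable M \<and> (\<exists>C. AE a in M. norm (f a :: 'k::real_or_complex) \<le> C)"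
proof (cases "f \<in> borel_measurable M")
  case True
  then have s: "strongly_measurable M f" by (simp add: strongly_measurable_scalar)
  have "(AE a in M. norm (rep (ae_class M f) a) \<le> C) \<longleftrightarrow> (AE a in M. norm (f a) \<le> C)" for C
    using rep_ae_class(2)[OF s] by (intro eventually_subst) (auto elim: AE_mp)
  then show ?thesis using True s
    unfolding function_ideal.mem_def[OF function_ideal_Linf] by (simp add: Linf_def ae_class_L0)
qed (auto simp: function_ideal.mem_def[OF function_ideal_Linf])

lemma Linf_fnorm:
  assumes "(f :: 'a \<Rightarrow> 'k::real_or_complex) \<in> borel_measurable M"
  shows "function_ideal.fnorm M (Linf M) f = Inf {C. 0 \<le> C \<and> (AE a in M. norm (f a) \<le> C)}"
proof -
  have s: "strongly_measurable M f" using assms by (simp add: strongly_measurable_scalar)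
  have "(AE a in M. norm (rep (ae_class M f) a) \<le> C) \<longleftrightarrow> (AE a in M. norm (f a) \<le> C)" for C
    using rep_ae_class(2)[OF s] by (intro eventually_subst) (auto elim: AE_mp)
  then show ?thesis unfolding function_ideal.fnorm_def[OF function_ideal_Linf] by (simp add: Linf_def)
qed

lemma function_lattice_L1: "function_lattice M (L1 M :: ('k::real_or_complex, _) nspace)"
proof -
  interpret function_ideal M "L1 M :: ('k, _) nspace" by (rule function_ideal_L1)
  show ?thesis
  proof
    fix f g :: "'a \<Rightarrow> 'k"
    assume g: "mem g" and f: "f \<in> borel_measurable M" "AE a in M. norm (f a) \<le> norm (g a)"
    show f': "mem f" using g f unfolding L1_mem by (intro Bochner_Integration.integrable_bound[of M g f])
    show "fnorm f \<le> fnorm g"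
      using g f f' by (simp add: L1_mem L1_fnorm) (intro integral_mono_AE, auto)
  next
    fix f g :: "'a \<Rightarrow> 'k" assume "mem f" "mem g"
    then have fg: "integrable M f" "integrable M g" by (simp_all add: L1_mem)
    have "fnorm (\<lambda>a. f a + g a) \<le> (\<integral>a. norm (f a) + norm (g a) \<partial>M)"
      using fg by (simp add: L1_fnorm del: Bochner_Integration.integral_add)
        (intro integral_mono, auto intro: norm_triangle_ineq)
    then show "fnorm (\<lambda>a. f a + g a) \<le> fnorm f + fnorm g" using fg by (simp add: L1_fnorm)
  qed (auto simp: L1_mem L1_fnorm norm_mult)
qed

text \<open>Each bound \<open>Inf ?S + 1 / real (Suc n)\<close> fails on a null set only, and
  countably many null sets form a null set; so the infimum is itself an essential bound.\<close>

lemma Linf_fnorm_attained: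
  fixes f :: "'a \<Rightarrow> 'k::real_or_complex"
  assumes "function_ideal.mem M (Linf M) f"
  shows "AE a in M. norm (f a) \<le> function_ideal.fnorm M (Linf M) f" "0 \<le> function_ideal.fnorm M (Linf M) f"
proof -
  let ?S = "{C. 0 \<le> C \<and> (AE a in M. norm (f a) \<le> C)}"
  have f: "f \<in> borel_measurable M" using assms by (simp add: Linf_mem)
  obtain C where "AE a in M. norm (f a) \<le> C" using assms by (auto simp: Linf_mem)
  then have "\<bar>C\<bar> \<in> ?S" by (auto elim: AE_mp)
  then have ne: "?S \<noteq> {}" by blast
  then show "0 \<le> function_ideal.fnorm M (Linf M) f" unfolding Linf_fnorm[OF f] by (intro cInf_greatest) auto
  have "AE a in M. norm (f a) \<le> Inf ?S + 1 / real (Suc n)" for n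
  proof -
    obtain c where "c \<in> ?S" "c < Inf ?S + 1 / real (Suc n)" using cInf_lessD[OF ne, of "Inf ?S + 1 / real (Suc n)"] by auto
    then show ?thesis by (auto elim: AE_mp)
  qed
  then have "AE a in M. \<forall>n. norm (f a) \<le> Inf ?S + 1 / real (Suc n)" by (simp add: AE_all_countable)
  then show "AE a in M. norm (f a) \<le> function_ideal.fnorm M (Linf M) f"
    unfolding Linf_fnorm[OF f]
  proof eventually_elim
    case (elim a)
    have "(\<lambda>n. Inf ?S + 1 / real (Suc n)) \<longlonglongrightarrow> Inf ?S + 0"
      by (intro tendsto_add tendsto_const LIMSEQ_Suc lim_1_over_n)
    then show ?case using elim by (intro LIMSEQ_le_const[where X="\<lambda>n. Inf ?S + 1 / real (Suc n)"]) auto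
  qed
qed

lemma Linf_fnorm_le:
  fixes f :: "'a \<Rightarrow> 'k::real_or_complex"
  assumes "f \<in> borel_measurable M" "AE a in M. norm (f a) \<le> C" "0 \<le> C"
  shows "function_ideal.fnorm M (Linf M) f \<le> C"
  unfolding Linf_fnorm[OF assms(1)] using assms by (intro cInf_lower) (auto intro!: bdd_belowI[of _ 0])

lemma function_lattice_Linf: "function_lattice M (Linf M :: ('k::real_or_complex, _) nspace)"
proof -
  interpret function_ideal M "Linf M :: ('k, _) nspace" by (rule function_ideal_Linf)
  have sc: "mem (\<lambda>a. c * f a)" if f: "mem f" for f c
  proof -
    obtain C where C: "AE a in M. norm (f a) \<le> C" using f by (auto simp: Linf_mem)
    have "AE a in M. norm (c * f a) \<le> norm c * C"
      using C by eventually_elim (simp add: norm_mult mult_left_mono)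
    then show ?thesis using f unfolding Linf_mem by auto
  qed
  have scle: "fnorm (\<lambda>a. c * f a) \<le> norm c * fnorm f" if f: "mem f" for f c
  proof (rule Linf_fnorm_le)
    show "AE a in M. norm (c * f a) \<le> norm c * fnorm f"
      using Linf_fnorm_attained(1)[OF f] by eventually_elim (simp add: norm_mult mult_left_mono)
  qed (use f Linf_fnorm_attained(2)[OF f] in \<open>auto simp: Linf_mem\<close>)
  show ?thesis
  proof
    fix f g :: "'a \<Rightarrow> 'k"
    assume g: "mem g" and f: "f \<in> borel_measurable M" "AE a in M. norm (f a) \<le> norm (g a)"
    have le: "AE a in M. norm (f a) \<le> fnorm g"
      using f(2) Linf_fnorm_attained(1)[OF g] by eventually_elim simp
    then show "mem f" using f by (auto simp: Linf_mem)
    show "fnorm f \<le> fnorm g" using le f Linf_fnorm_attained(2)[OF g] by (intro Linf_fnorm_le)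
  next
    fix f g :: "'a \<Rightarrow> 'k" assume fg: "mem f" "mem g"
    have le: "AE a in M. norm (f a + g a) \<le> fnorm f + fnorm g"
      using Linf_fnorm_attained(1)[OF fg(1)] Linf_fnorm_attained(1)[OF fg(2)]
      by eventually_elim (rule norm_triangle_mono)
    then show "mem (\<lambda>a. f a + g a)" using fg by (auto simp: Linf_mem)
    show "fnorm (\<lambda>a. f a + g a) \<le> fnorm f + fnorm g"
      using le fg Linf_fnorm_attained(2)[OF fg(1)] Linf_fnorm_attained(2)[OF fg(2)]
      by (intro Linf_fnorm_le) (auto simp: Linf_mem)
  next
    have "fnorm (\<lambda>_. 0) \<le> 0" by (rule Linf_fnorm_le) auto
    moreover have "0 \<le> fnorm (\<lambda>_. 0)" by (rule Linf_fnorm_attained) (auto simp: Linf_mem)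
    ultimately show "fnorm (\<lambda>_. 0) = 0" by simp
  next
    fix f :: "'a \<Rightarrow> 'k" and c assume f: "mem f"
    show "fnorm (\<lambda>a. c * f a) = norm c * fnorm f"
    proof (cases "c = 0")
      case True
      then show ?thesis using scle[OF f, of 0] Linf_fnorm_attained(2)[OF sc[OF f, of 0]] by simp
    next
      case False
      \<comment> \<open>The inequality \<open>scle\<close> for the factor \<open>inverse c\<close>,
        applied to \<open>c * f\<close>, is the reverse inequality.\<close>
      have "fnorm f \<le> norm (inverse c) * fnorm (\<lambda>a. c * f a)"
        using scle[OF sc[OF f, of c], of "inverse c"] False by (simp add: mult.assoc[symmetric])
      then show ?thesis using False scle[OF f, of c] by (intro antisym) (simp_all add: norm_inverse norm_divide field_simps)
    qed
  qed ((rule sc, assumption) | (auto simp: Linf_mem)[1])+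
qed

section \<open>Vector-valued functions whose norm lies in the lattice\<close>

context function_lattice begin

lemma mem_sum: "(\<And>i. mem (f i)) \<Longrightarrow> mem (\<lambda>a. \<Sum>i<n::nat. f i a)"
  by (induction n) (simp_all add: mem_zero mem_add)

lemma mem_norm: "mem f \<Longrightarrow> mem (\<lambda>a. of_real (norm (f a)))"
proof (rule mem_solid[of f])
  assume "mem f"
  then have [measurable]: "f \<in> borel_measurable M" by (rule mem_measurable)
  show "(\<lambda>a. of_real (norm (f a)) :: 'k) \<in> borel_measurable M" by measurable
qed auto

lemma mem_diff: "mem f \<Longrightarrow> mem g \<Longrightarrow> mem (\<lambda>a. f a - g a)"
  using mem_add[of f "\<lambda>a. - 1 * g a"] mem_scale[of g "- 1"] by simp

lemma fnorm_cong: "AE a in M. f a = g a \<Longrightarrow> fnorm f = fnorm g"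
  unfolding fnorm_def using ae_class_cong[of f g M] by simp

lemma fnorm_norm: "mem f \<Longrightarrow> fnorm (\<lambda>a. of_real (norm (f a))) = fnorm f"
  by (intro antisym fnorm_mono) (auto simp: mem_norm mem_measurable)

lemma fnorm_nonneg: "mem f \<Longrightarrow> 0 \<le> fnorm f"
  using fnorm_mono[of f "\<lambda>_. 0"] fnorm_zero by simp

text \<open>The function-level counterpart of membership in E(Y); \<open>valued_class_iff\<close>
  links it to classes.\<close>

definition vmem :: "('a \<Rightarrow> 'y::banach) \<Rightarrow> bool" where
  "vmem f \<longleftrightarrow> strongly_measurable M f \<and> mem (\<lambda>a. of_real (norm (f a)))"

lemma vmem_measurable: "vmem f \<Longrightarrow> strongly_measurable M f"
  by (simp add: vmem_def)

lemma vmem_solid: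
  assumes "mem g" "strongly_measurable M f" "AE a in M. norm (f a) \<le> norm (g a)" shows "vmem f"
  unfolding vmem_def using assms strongly_measurable_norm[OF assms(2)] by (auto intro!: mem_solid[of g])

lemma valued_class_iff:
  assumes "strongly_measurable M f" shows "ae_class M f \<in> vcarrier (valued M E s) \<longleftrightarrow> vmem f"
  unfolding valued_def vmem_def using assms strongly_measurable_norm[OF assms]
  by (auto simp: L0_norm_ae_class ae_class_L0 mem_def)

lemma vmem_carrier: "vmem f \<Longrightarrow> ae_class M f \<in> vcarrier (valued M E s)"
  using valued_class_iff vmem_measurable by blast

lemma valued_L0: "c \<in> vcarrier (valued M E s) \<Longrightarrow> c \<in> L0 M"
  by (simp add: valued_def)

lemma vmem_rep: "c \<in> vcarrier (valued M E s) \<Longrightarrow> vmem (rep c)"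
  using valued_class_iff[of "rep c" s] L0_rep[of c M] valued_L0[of c s] by simp

lemma valued_class_rep: "c \<in> vcarrier (valued M E s) \<Longrightarrow> ae_class M (rep c) = c"
  using L0_rep[of c M] valued_L0[of c s] by simp

lemma valued_cases:
  assumes "c \<in> vcarrier (valued M E s)" obtains f where "vmem f" "c = ae_class M f"
  using vmem_rep[OF assms] valued_class_rep[OF assms] by metis

lemma valued_rep_class: "vmem f \<Longrightarrow> AE a in M. rep (ae_class M f) a = f a"
  by (rule rep_ae_class) (rule vmem_measurable)

lemma valued_norm: "vmem f \<Longrightarrow> vnorm (valued M E s) (ae_class M f) = fnorm (\<lambda>a. of_real (norm (f a)))"
  by (simp add: valued_def fnorm_def L0_norm_ae_class vmem_measurable)

lemma valued_vadd:
  "vmem f \<Longrightarrow> vmem g \<Longrightarrow> vadd (valued M E s) (ae_class M f) (ae_class M g) = ae_class M (\<lambda>a. f a + g a)"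
  unfolding valued_def by (simp add: function_space_ops vmem_measurable)

lemma valued_vscale: "vmem f \<Longrightarrow> vscale (valued M E s) c (ae_class M f) = ae_class M (\<lambda>a. s c (f a))"
  unfolding valued_def by (simp add: function_space_ops vmem_measurable)

lemma valued_vzero: "vzero (valued M E s) = ae_class M (\<lambda>_. 0)"
  by (simp add: valued_def)

lemma vmem_zero: "vmem (\<lambda>_. 0)"
  by (simp add: vmem_def mem_zero strongly_measurable_const)

lemma vmem_add:
  assumes "vmem f" "vmem g" shows "vmem (\<lambda>a. f a + g a)"
proof (rule vmem_solid)
  show "mem (\<lambda>a. of_real (norm (f a)) + of_real (norm (g a)))"
    using assms by (simp add: vmem_def mem_add)
  show "AE a in M. norm (f a + g a) \<le> norm (of_real (norm (f a)) + of_real (norm (g a)) :: 'k)"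
    by (simp flip: of_real_add add: norm_triangle_ineq)
qed (use assms in \<open>simp add: vmem_def strongly_measurable_add\<close>)

lemma vmem_scale:
  fixes s :: "'k \<Rightarrow> 'y::banach \<Rightarrow> 'y"
  assumes "scaling s" "vmem f" shows "vmem (\<lambda>a. s c (f a))"
proof (rule vmem_solid)
  show "mem (\<lambda>a. c * of_real (norm (f a)))" using assms by (simp add: vmem_def mem_scale)
  show "AE a in M. norm (s c (f a)) \<le> norm (c * of_real (norm (f a)) :: 'k)"
    by (simp add: norm_mult scaling.norm_eq[OF assms(1)])
qed (use assms in \<open>simp add: vmem_def scaling.strongly_measurable_right\<close>)

lemma vmem_tensor:
  assumes "scaling s" "mem f" shows "vmem (\<lambda>a. s (f a) y)"
proof (rule vmem_solid)
  show "mem (\<lambda>a. of_real (norm y) * f a)" using assms by (simp add: mem_scale)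
  show "AE a in M. norm (s (f a) y) \<le> norm (of_real (norm y) * f a :: 'k)"
    by (simp add: norm_mult scaling.norm_eq[OF assms(1)])
qed (use assms in \<open>simp add: scaling.strongly_measurable_left mem_measurable\<close>)

lemma mem_pairing:
  assumes "pairing sX sY b" "vmem f" shows "mem (\<lambda>a. b x (f a))"
proof -
  obtain C where C: "C \<ge> 0" "\<And>x y. norm (b x y) \<le> C * norm x * norm y" by (rule pairing.bound[OF assms(1)]) blast
  show ?thesis
  proof (rule mem_solid)
    show "mem (\<lambda>a. of_real (C * norm x) * of_real (norm (f a)))" using assms(2) unfolding vmem_def by (intro mem_scale) simp
    show "(\<lambda>a. b x (f a)) \<in> borel_measurable M"
      using assms by (simp add: pairing.measurable_right vmem_def)
    show "AE a in M. norm (b x (f a)) \<le> norm (of_real (C * norm x) * of_real (norm (f a)) :: 'k)"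
      using C by (simp add: norm_mult)
  qed
qed

text \<open>Decomposing \<open>f / norm f\<close> instead of \<open>f\<close> makes the error relative, so that all the
  coefficient functions are dominated by \<open>norm f\<close>.\<close>

lemma tensor_decomposition:
  fixes f :: "'a \<Rightarrow> 'y::banach"
  assumes s: "scaling s" and f: "vmem f" and e: "\<epsilon> > 0"
  obtains \<phi> :: "nat \<Rightarrow> 'a \<Rightarrow> 'k" and y :: "nat \<Rightarrow> 'y" where "\<And>j. mem (\<phi> j)"
    "\<And>a n. a \<in> space M \<Longrightarrow> (\<Sum>j<n. norm (\<phi> j a) * norm (y j)) \<le> (1 + \<epsilon>) * norm (f a)"
    "\<And>a. a \<in> space M \<Longrightarrow> (\<lambda>j. s (\<phi> j a) (y j)) sums f a"
proof -
  interpret s: scaling s by (rule s)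
  \<comment> \<open>Where \<open>f\<close> vanishes the quotient is 0, hence \<open>u\<close> is 0
    too, and \<open>norm (f a) *\<^sub>R u a = f a\<close> holds at every point.\<close>
  define u where "u a = s (of_real (1 / norm (f a))) (f a)" for a
  have fm[measurable]: "(\<lambda>a. norm (f a)) \<in> borel_measurable M"
    using f by (simp add: vmem_def strongly_measurable_norm)
  have "strongly_measurable M u" unfolding u_def
    using f by (intro s.strongly_measurable) (simp_all add: strongly_measurable_scalar vmem_def)
  then obtain D where D: "u \<in> borel_measurable M" "countable D" "u ` space M \<subseteq> closure D"
    unfolding strongly_measurable_iff by blast
  obtain A y where A: "\<And>n. A n \<in> sets M"
    "\<And>a. a \<in> space M \<Longrightarrow> (\<lambda>n. indicat_real (A n) a *\<^sub>R y n) sums u a"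
    "\<And>a N. a \<in> space M \<Longrightarrow> (\<Sum>n<N. indicat_real (A n) a * norm (y n)) \<le> norm (u a) + \<epsilon>"
    by (rule indicator_decomposition[OF D e]) blast
  define \<phi> where "\<phi> n a = (of_real (indicat_real (A n) a * norm (f a)) :: 'k)" for n a
  have nu: "norm (u a) \<le> 1" for a by (simp add: u_def s.norm_eq norm_divide)
  have fu: "norm (f a) *\<^sub>R u a = f a" for a unfolding u_def s.of_real by simp
  show ?thesis
  proof (rule that[of \<phi> y])
    show "mem (\<phi> j)" for j
    proof (rule mem_solid)
      show "mem (\<lambda>a. of_real (norm (f a)))" using f by (simp add: vmem_def)
      show "\<phi> j \<in> borel_measurable M" unfolding \<phi>_def using A(1)[of j] by measurable
    qed (auto simp: \<phi>_def indicator_def)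
    show "(\<lambda>j. s (\<phi> j a) (y j)) sums f a" if "a \<in> space M" for a
      using sums_scaleR_right[OF A(2)[OF that], of "norm (f a)"]
      by (simp add: \<phi>_def s.of_real fu mult.commute del: of_real_mult)
    show "(\<Sum>j<n. norm (\<phi> j a) * norm (y j)) \<le> (1 + \<epsilon>) * norm (f a)" if "a \<in> space M" for a n
    proof -
      have "(\<Sum>j<n. norm (\<phi> j a) * norm (y j)) = norm (f a) * (\<Sum>j<n. indicat_real (A j) a * norm (y j))"
        unfolding sum_distrib_left by (intro sum.cong refl) (simp add: \<phi>_def abs_mult del: of_real_mult)
      also have "\<dots> \<le> norm (f a) * (1 + \<epsilon>)"
        using A(3)[OF that, of n] nu[of a] by (intro mult_left_mono) auto
      finally show ?thesis by (simp add: mult.commute)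
    qed
  qed
qed

end

section \<open>Operators between function lattices, acting on functions\<close>

locale lattice_op = D: function_lattice M E + R: function_lattice N H
  for M :: "'a measure" and E :: "('k::real_or_complex, ('a \<Rightarrow> 'k) set) nspace"
    and N :: "'b measure" and H :: "('k, ('b \<Rightarrow> 'k) set) nspace" +
  fixes U :: "('a \<Rightarrow> 'k) set \<Rightarrow> ('b \<Rightarrow> 'k) set"
  assumes linear: "U \<in> linear_ops E H"
begin

text \<open>The result depends on the class of \<open>f\<close> alone, so \<open>app_cong\<close> is
  an equality of functions, whereas linearity holds only almost everywhere.\<close>

definition app :: "('a \<Rightarrow> 'k) \<Rightarrow> 'b \<Rightarrow> 'k" where "app f = rep (U (ae_class M f))"

lemma U_carrier: "c \<in> vcarrier E \<Longrightarrow> U c \<in> vcarrier H"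
  using linear by (auto simp: linear_ops_def)

lemma app_mem: "D.mem f \<Longrightarrow> R.mem (app f)"
  unfolding app_def by (intro R.mem_rep U_carrier D.mem_carrier)

lemma U_class: "D.mem f \<Longrightarrow> U (ae_class M f) = ae_class N (app f)"
  unfolding app_def by (intro R.ae_class_rep[symmetric] U_carrier D.mem_carrier)

lemma app_cong: "AE a in M. f a = g a \<Longrightarrow> app f = app g"
  unfolding app_def using ae_class_cong[of f g M] by simp

lemma app_add:
  assumes "D.mem f" "D.mem g" shows "AE c in N. app (\<lambda>a. f a + g a) c = app f c + app g c"
proof -
  have "U (ae_class M (\<lambda>a. f a + g a)) = vadd H (U (ae_class M f)) (U (ae_class M g))"
    using linear D.mem_carrier assms unfolding D.vadd_class[OF assms, symmetric] by (auto simp: linear_ops_def)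
  also have "\<dots> = ae_class N (\<lambda>c. app f c + app g c)"
    using assms by (simp add: U_class R.vadd_class app_mem)
  finally show ?thesis
    using R.rep_class[OF R.mem_add[OF app_mem[OF assms(1)] app_mem[OF assms(2)]]] by (simp add: app_def)
qed

lemma app_scale:
  assumes "D.mem f" shows "AE c in N. app (\<lambda>a. k * f a) c = k * app f c"
proof -
  have "U (ae_class M (\<lambda>a. k * f a)) = vscale H k (U (ae_class M f))"
    using linear D.mem_carrier assms unfolding D.vscale_class[OF assms, symmetric] by (auto simp: linear_ops_def)
  also have "\<dots> = ae_class N (\<lambda>c. k * app f c)"
    using assms by (simp add: U_class R.vscale_class app_mem)
  finally show ?thesis using R.rep_class[OF R.mem_scale[OF app_mem[OF assms]]] by (simp add: app_def)
qed

lemma app_zero: "AE c in N. app (\<lambda>_. 0) c = 0"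
  using app_scale[OF D.mem_zero, of 0] by simp

lemma app_sum: "(\<And>i. D.mem (f i)) \<Longrightarrow> AE c in N. app (\<lambda>a. \<Sum>i<n::nat. f i a) c = (\<Sum>i<n. app (f i) c)"
proof (induction n)
  case (Suc n)
  show ?case using Suc.IH[OF Suc.prems] app_add[OF D.mem_sum[of f n, OF Suc.prems] Suc.prems[of n]]
    by eventually_elim simp
qed (simp add: app_zero)

lemma app_sum_scale:
  assumes "\<And>i. D.mem (f i)"
  shows "AE c in N. app (\<lambda>a. \<Sum>i<n::nat. k i * f i a) c = (\<Sum>i<n. k i * app (f i) c)"
proof -
  have "AE c in N. \<forall>i. app (\<lambda>a. k i * f i a) c = k i * app (f i) c"
    using app_scale[OF assms] by (simp add: AE_all_countable)
  then show ?thesis using app_sum[of "\<lambda>i a. k i * f i a" n, OF D.mem_scale[OF assms]]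
    by eventually_elim simp
qed

end

lemma nonneg_Reals_of_real: "x \<in> \<real>\<^sub>\<ge>\<^sub>0 \<Longrightarrow> x = of_real (norm (x::'k::real_or_complex))"
  by (auto elim!: nonneg_Reals_cases)

locale positive_op = lattice_op M E N H U
  for M :: "'a measure" and E :: "('k::real_or_complex, ('a \<Rightarrow> 'k) set) nspace"
    and N :: "'b measure" and H :: "('k, ('b \<Rightarrow> 'k) set) nspace"
    and U :: "('a \<Rightarrow> 'k) set \<Rightarrow> ('b \<Rightarrow> 'k) set" +
  assumes positive: "U \<in> positive_ops M N E H"
begin

lemma app_nonneg:
  assumes f: "D.mem f" "AE a in M. f a \<in> \<real>\<^sub>\<ge>\<^sub>0" shows "AE c in N. app f c \<in> \<real>\<^sub>\<ge>\<^sub>0"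
proof -
  have "L0_le M (vzero E) (ae_class M f)"
    unfolding L0_le_def D.vzero_class using D.rep_class[OF f(1)] D.rep_class[OF D.mem_zero] f(2)
    by eventually_elim simp
  then have "L0_le N (vzero H) (U (ae_class M f))"
    using positive D.mem_carrier[OF f(1)] by (auto simp: positive_ops_def)
  then show ?thesis unfolding L0_le_def R.vzero_class app_def[symmetric]
    using R.rep_class[OF R.mem_zero] by eventually_elim simp
qed

lemma app_mono:
  assumes "D.mem (\<lambda>a. of_real (f a))" "D.mem (\<lambda>a. of_real (g a))" "AE a in M. 0 \<le> f a" "AE a in M. f a \<le> g a"
  shows "AE c in N. norm (app (\<lambda>a. of_real (f a)) c) \<le> norm (app (\<lambda>a. of_real (g a)) c)"
proof -
  have d: "D.mem (\<lambda>a. of_real (g a) - of_real (f a))" by (intro D.mem_diff assms)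
  have 1: "AE c in N. app (\<lambda>a. of_real (g a) - of_real (f a)) c \<in> \<real>\<^sub>\<ge>\<^sub>0"
    using assms(4) by (intro app_nonneg d) (auto simp flip: of_real_diff)
  have 2: "AE c in N. app (\<lambda>a. of_real (f a)) c \<in> \<real>\<^sub>\<ge>\<^sub>0"
    using assms(3) by (intro app_nonneg assms) auto
  have 3: "AE c in N. app (\<lambda>a. of_real (g a)) c = app (\<lambda>a. of_real (g a) - of_real (f a)) c + app (\<lambda>a. of_real (f a)) c"
    using app_add[OF d assms(1)] by simp
  show ?thesis using 1 2 3
  proof eventually_elim
    case (elim c)
    then obtain r t where "app (\<lambda>a. of_real (g a) - of_real (f a)) c = of_real r" "r \<ge> 0"
      "app (\<lambda>a. of_real (f a)) c = of_real t" "t \<ge> 0" by (auto elim!: nonneg_Reals_cases)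
    then show ?case using elim(3) by (simp flip: of_real_add)
  qed
qed

end

lemma dominates_iff:
  assumes "lattice_op M E N H U" "lattice_op M E N H Q"
  shows "dominates M N E Q U \<longleftrightarrow> (\<forall>f. function_ideal.mem M E f \<longrightarrow>
    (AE c in N. lattice_op.app M Q (\<lambda>a. of_real (norm (f a))) c - of_real (norm (lattice_op.app M U f c)) \<in> \<real>\<^sub>\<ge>\<^sub>0))"
proof -
  interpret U: lattice_op M E N H U by (rule assms)
  interpret Q: lattice_op M E N H Q by (rule assms)
  have *: "L0_le N (L0_norm N (U (ae_class M f))) (Q (L0_norm M (ae_class M f))) \<longleftrightarrow>
    (AE c in N. Q.app (\<lambda>a. of_real (norm (f a))) c - of_real (norm (U.app f c)) \<in> \<real>\<^sub>\<ge>\<^sub>0)" if f: "U.D.mem f" for f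
  proof -
    have m: "strongly_measurable M f" using f by (simp add: U.D.mem_def strongly_measurable_scalar)
    have "AE c in N. rep (L0_norm N (U (ae_class M f))) c = (of_real (norm (U.app f c)) :: 'b)"
      unfolding L0_norm_def U.app_def[symmetric]
      by (intro U.R.rep_class U.R.mem_norm U.app_mem f)
    then show ?thesis unfolding L0_le_def L0_norm_ae_class[OF m] Q.app_def[symmetric]
      by (intro eventually_subst) (auto elim: AE_mp)
  qed
  show ?thesis unfolding dominates_def
  proof safe
    fix f assume "\<forall>e\<in>vcarrier E. L0_le N (L0_norm N (U e)) (Q (L0_norm M e))" "U.D.mem f"
    then show "AE c in N. Q.app (\<lambda>a. of_real (norm (f a))) c - of_real (norm (U.app f c)) \<in> \<real>\<^sub>\<ge>\<^sub>0"
      using *[of f] U.D.mem_carrier by blast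
  next
    fix e assume h: "\<forall>f. U.D.mem f \<longrightarrow> (AE c in N. Q.app (\<lambda>a. of_real (norm (f a))) c - of_real (norm (U.app f c)) \<in> \<real>\<^sub>\<ge>\<^sub>0)"
      and e: "e \<in> vcarrier E"
    then show "L0_le N (L0_norm N (U e)) (Q (L0_norm M e))"
      using *[of "rep e"] U.D.mem_rep[OF e] U.D.ae_class_rep[OF e] by simp
  qed
qed


section \<open>Extension of dominated operators to vector-valued functions\<close>

lemma positive_op_intro:
  assumes "lattice_op M E N H U" "Q \<in> positive_ops M N E H" shows "positive_op M E N H Q"
proof -
  interpret lattice_op M E N H U by (rule assms)
  show ?thesis using assms(2) by unfold_locales (auto simp: positive_ops_def bounded_ops_def)
qed

context lattice_op begin

text \<open>The order of \<open>L0_le\<close> makes \<open>Q |f|\<close> a norm plus a nonnegative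
  real, hence real and equal to its own norm. Later estimates can therefore be written with norms,
  for either scalar field.\<close>

lemma dominated_AE:
  assumes Q: "Q \<in> positive_ops M N E H" "dominates M N E Q U" and f: "D.mem f"
  shows "AE c in N. lattice_op.app M Q (\<lambda>a. of_real (norm (f a))) c
      = of_real (norm (lattice_op.app M Q (\<lambda>a. of_real (norm (f a))) c)) \<and>
    norm (app f c) \<le> norm (lattice_op.app M Q (\<lambda>a. of_real (norm (f a))) c)"
proof -
  interpret Q: positive_op M E N H Q by (rule positive_op_intro[OF lattice_op_axioms Q(1)])
  have "AE c in N. Q.app (\<lambda>a. of_real (norm (f a))) c - of_real (norm (app f c)) \<in> \<real>\<^sub>\<ge>\<^sub>0"
    using Q(2) f unfolding dominates_iff[OF lattice_op_axioms Q.lattice_op_axioms] by blast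
  then show ?thesis
  proof eventually_elim
    case (elim c)
    then obtain r where r: "Q.app (\<lambda>a. of_real (norm (f a))) c - of_real (norm (app f c)) = of_real r" "r \<ge> 0"
      by (auto elim!: nonneg_Reals_cases)
    then have "Q.app (\<lambda>a. of_real (norm (f a))) c = of_real (r + norm (app f c))"
      by (metis add.commute diff_eq_eq of_real_add add.left_commute)
    then show ?case using r(2) by (simp del: of_real_add)
  qed
qed

text \<open>For each n, \<Sum> |U \<phi>_j| t_j \<le> \<Sum> t_j Q |\<phi>_j| = Q (\<Sum> t_j
  |\<phi>_j|) \<le> Q e. The right-hand side does not depend on n, so a single null set serves all
  partial sums.\<close>

lemma dominated_sum:
  fixes \<phi> :: "nat \<Rightarrow> 'a \<Rightarrow> 'k"
  assumes Q: "Q \<in> positive_ops M N E H" "dominates M N E Q U"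
    and \<phi>: "\<And>j. D.mem (\<phi> j)" and t: "\<And>j. t j \<ge> 0" and e: "D.mem (\<lambda>a. of_real (e a))"
    and le: "\<And>n. AE a in M. (\<Sum>j<n. norm (\<phi> j a) * t j) \<le> e a"
  shows "AE c in N. \<forall>n. (\<Sum>j<n. norm (app (\<phi> j) c) * t j) \<le> norm (lattice_op.app M Q (\<lambda>a. of_real (e a)) c)"
  unfolding AE_all_countable
proof
  fix n :: nat
  interpret Q: positive_op M E N H Q by (rule positive_op_intro[OF lattice_op_axioms Q(1)])
  let ?g = "\<lambda>j a. of_real (norm (\<phi> j a)) :: 'k"
  have g: "D.mem (?g j)" for j by (rule D.mem_norm[OF \<phi>])
  have eq: "(\<lambda>a. \<Sum>j<n. of_real (t j) * ?g j a) = (\<lambda>a. of_real (\<Sum>j<n. norm (\<phi> j a) * t j))"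
    by (simp add: mult.commute)
  have mem: "D.mem (\<lambda>a. of_real (\<Sum>j<n. norm (\<phi> j a) * t j))"
    unfolding eq[symmetric] by (intro D.mem_sum D.mem_scale g)
  have 1: "AE c in N. Q.app (\<lambda>a. of_real (\<Sum>j<n. norm (\<phi> j a) * t j)) c = (\<Sum>j<n. of_real (t j) * Q.app (?g j) c)"
    using Q.app_sum_scale[of ?g "\<lambda>j. of_real (t j)" n, OF g] unfolding eq .
  have 2: "AE c in N. \<forall>j. Q.app (?g j) c = of_real (norm (Q.app (?g j) c)) \<and> norm (app (\<phi> j) c) \<le> norm (Q.app (?g j) c)"
    unfolding AE_all_countable using dominated_AE[OF Q \<phi>] by blast
  have 3: "AE c in N. norm (Q.app (\<lambda>a. of_real (\<Sum>j<n. norm (\<phi> j a) * t j)) c) \<le> norm (Q.app (\<lambda>a. of_real (e a)) c)"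
    by (rule Q.app_mono[OF mem e _ le]) (intro AE_I2 sum_nonneg mult_nonneg_nonneg t norm_ge_zero)
  show "AE c in N. (\<Sum>j<n. norm (app (\<phi> j) c) * t j) \<le> norm (Q.app (\<lambda>a. of_real (e a)) c)"
    using 1 2 3
  proof eventually_elim
    case (elim c)
    have "(\<Sum>j<n. norm (app (\<phi> j) c) * t j) \<le> (\<Sum>j<n. norm (Q.app (?g j) c) * t j)"
      using elim(2) by (intro sum_mono mult_right_mono t) auto
    also have "\<dots> = norm (of_real (\<Sum>j<n. t j * norm (Q.app (?g j) c)) :: 'k)"
      unfolding norm_of_real using t by (simp add: abs_of_nonneg sum_nonneg mult.commute)
    also have "(of_real (\<Sum>j<n. t j * norm (Q.app (?g j) c)) :: 'k) = (\<Sum>j<n. of_real (t j) * Q.app (?g j) c)"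
      unfolding of_real_sum of_real_mult using elim(2) by simp
    finally show ?case using elim(1,3) by simp
  qed
qed

end

text \<open>Weak continuity in usable form: \<open>test\<close> singles out the functions against
  which values of \<open>U\<close> are integrated, and \<open>adj\<close> moves \<open>U\<close>
  onto them. For \<open>T\<close> these are \<open>F\<close> and \<open>S\<close>; for
  \<open>S\<close> they are the essentially bounded functions and \<open>T\<close>.\<close>

locale adjoint_op = lattice_op M E N H U
  for M :: "'a measure" and E :: "('k::real_or_complex, ('a \<Rightarrow> 'k) set) nspace"
    and N :: "'b measure" and H :: "('k, ('b \<Rightarrow> 'k) set) nspace"
    and U :: "('a \<Rightarrow> 'k) set \<Rightarrow> ('b \<Rightarrow> 'k) set" +
  fixes test :: "('b \<Rightarrow> 'k) \<Rightarrow> bool" and adj :: "('b \<Rightarrow> 'k) \<Rightarrow> 'a \<Rightarrow> 'k"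
  assumes test_measurable: "test g \<Longrightarrow> g \<in> borel_measurable N"
    and adj_measurable: "test g \<Longrightarrow> adj g \<in> borel_measurable M"
    and test_integrable: "test g \<Longrightarrow> R.mem h \<Longrightarrow> integrable N (\<lambda>c. g c * h c)"
    and adj_integrable: "test g \<Longrightarrow> D.mem f \<Longrightarrow> integrable M (\<lambda>a. adj g a * f a)"
    and adjoint: "test g \<Longrightarrow> D.mem f \<Longrightarrow> (\<integral>a. adj g a * f a \<partial>M) = (\<integral>c. g c * app f c \<partial>N)"
    and test_separating: "R.mem h \<Longrightarrow> (\<And>g. test g \<Longrightarrow> (\<integral>c. g c * h c \<partial>N) = 0) \<Longrightarrow> AE c in N. h c = 0"
begin

text \<open>The dominating operator need not be order continuous; it only provides the integrable bound
  under which the series may be integrated against the test functions.\<close>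

lemma app_sums:
  assumes Q: "Q \<in> positive_ops M N E H" "dominates M N E Q U"
    and \<phi>: "\<And>j. D.mem (\<phi> j)" and e: "D.mem (\<lambda>a. of_real (e a))"
    and le: "\<And>n. AE a in M. (\<Sum>j<n. norm (\<phi> j a) * norm (k j)) \<le> e a"
    and f: "D.mem f" and sums: "AE a in M. (\<lambda>j. \<phi> j a * k j) sums f a"
  shows "AE c in N. (\<lambda>j. app (\<phi> j) c * k j) sums app f c"
proof -
  interpret Q: positive_op M E N H Q by (rule positive_op_intro[OF lattice_op_axioms Q(1)])
  define K where "K = Q.app (\<lambda>a. of_real (e a))"
  have K: "R.mem K" unfolding K_def by (rule Q.app_mem[OF e])
  have bound: "AE c in N. \<forall>n. (\<Sum>j<n. norm (app (\<phi> j) c * k j)) \<le> norm (K c)"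
    unfolding K_def norm_mult by (rule dominated_sum[OF Q \<phi> norm_ge_zero e le])
  have summ: "AE c in N. summable (\<lambda>j. norm (app (\<phi> j) c * k j))"
    using bound by eventually_elim (rule bounded_imp_summable, auto simp: lessThan_Suc_atMost[symmetric] simp del: sum.lessThan_Suc)
  define h where "h c = (\<Sum>j. app (\<phi> j) c * k j)" for c
  have sh: "AE c in N. (\<lambda>j. app (\<phi> j) c * k j) sums h c"
    using summ by eventually_elim (simp add: h_def summable_norm_cancel summable_sums)
  have am[measurable]: "app (\<phi> j) \<in> borel_measurable N" for j by (rule R.mem_measurable[OF app_mem[OF \<phi>]])
  have hm[measurable]: "h \<in> borel_measurable N" unfolding h_def by measurable
  have part: "AE c in N. norm (\<Sum>j<n. app (\<phi> j) c * k j) \<le> norm (K c)" for n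
    using bound
  proof eventually_elim
    case (elim c)
    show ?case by (rule order_trans[OF norm_sum elim[rule_format]])
  qed
  have hK: "AE c in N. norm (h c) \<le> norm (K c)"
    using sh bound
  proof eventually_elim
    case (elim c)
    have "(\<lambda>n. norm (\<Sum>j<n. app (\<phi> j) c * k j)) \<longlonglongrightarrow> norm (h c)"
      using elim(1) unfolding sums_def by (rule tendsto_norm)
    then show ?case
      by (rule LIMSEQ_le_const2) (auto intro: order_trans[OF norm_sum elim(2)[rule_format]])
  qed
  have hmem: "R.mem h" by (rule R.mem_solid[OF K hm hK])
  have "AE c in N. h c - app f c = 0"
  \<comment> \<open>The adjoint identity is available for finite sums. Both of its sides converge by
    domination, with majorants \<open>g * K\<close> and \<open>adj g * e\<close>, and this
    identifies the sum of the image series with the image of the sum.\<close>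
  proof (rule test_separating[OF R.mem_diff[OF hmem app_mem[OF f]]])
    fix g assume g: "test g"
    have [measurable]: "g \<in> borel_measurable N" "adj g \<in> borel_measurable M"
      by (rule test_measurable[OF g], rule adj_measurable[OF g])
    have [measurable]: "\<phi> j \<in> borel_measurable M" "f \<in> borel_measurable M" for j
      by (rule D.mem_measurable[OF \<phi>], rule D.mem_measurable[OF f])
    have lim1: "(\<lambda>n. \<integral>c. g c * (\<Sum>j<n. app (\<phi> j) c * k j) \<partial>N) \<longlonglongrightarrow> (\<integral>c. g c * h c \<partial>N)"
    proof (rule integral_dominated_convergence)
      show "integrable N (\<lambda>c. norm (g c * K c))" by (intro integrable_norm test_integrable g K)
      show "AE c in N. (\<lambda>n. g c * (\<Sum>j<n. app (\<phi> j) c * k j)) \<longlonglongrightarrow> g c * h c"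
        using sh unfolding sums_def by eventually_elim (rule tendsto_mult_left)
      show "AE c in N. norm (g c * (\<Sum>j<n. app (\<phi> j) c * k j)) \<le> norm (g c * K c)" for n
        using part[of n] by eventually_elim (simp add: norm_mult mult_left_mono)
    qed measurable
    have lim2: "(\<lambda>n. \<integral>a. adj g a * (\<Sum>j<n. \<phi> j a * k j) \<partial>M) \<longlonglongrightarrow> (\<integral>a. adj g a * f a \<partial>M)"
    proof (rule integral_dominated_convergence)
      show "integrable M (\<lambda>a. norm (adj g a * of_real (e a)))" by (intro integrable_norm adj_integrable g e)
      show "AE a in M. (\<lambda>n. adj g a * (\<Sum>j<n. \<phi> j a * k j)) \<longlonglongrightarrow> adj g a * f a"
        using sums unfolding sums_def by eventually_elim (rule tendsto_mult_left)
      show "AE a in M. norm (adj g a * (\<Sum>j<n. \<phi> j a * k j)) \<le> norm (adj g a * of_real (e a))" for n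
        using le[of n]
      proof eventually_elim
        case (elim a)
        have "norm (\<Sum>j<n. \<phi> j a * k j) \<le> (\<Sum>j<n. norm (\<phi> j a) * norm (k j))"
          by (rule order_trans[OF norm_sum]) (simp add: norm_mult)
        then have "norm (\<Sum>j<n. \<phi> j a * k j) \<le> norm (of_real (e a) :: 'k)" using elim by simp
        then show ?case by (simp add: norm_mult mult_left_mono del: norm_of_real)
      qed
    qed measurable
    have "(\<integral>a. adj g a * (\<Sum>j<n. \<phi> j a * k j) \<partial>M) = (\<integral>c. g c * (\<Sum>j<n. app (\<phi> j) c * k j) \<partial>N)" for n
    proof -
      have "D.mem (\<lambda>a. \<Sum>j<n. k j * \<phi> j a)" by (intro D.mem_sum D.mem_scale \<phi>)
      then have m: "D.mem (\<lambda>a. \<Sum>j<n. \<phi> j a * k j)" by (simp add: mult.commute)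
      have "AE c in N. app (\<lambda>a. \<Sum>j<n. \<phi> j a * k j) c = (\<Sum>j<n. app (\<phi> j) c * k j)"
        using app_sum_scale[of \<phi> k n, OF \<phi>] by (simp add: mult.commute)
      then have "(\<integral>c. g c * app (\<lambda>a. \<Sum>j<n. \<phi> j a * k j) c \<partial>N) = (\<integral>c. g c * (\<Sum>j<n. app (\<phi> j) c * k j) \<partial>N)"
        using R.mem_measurable[OF app_mem[OF m]] by (intro integral_cong_AE) (auto elim: AE_mp)
      then show ?thesis using adjoint[OF g m] by simp
    qed
    then have "(\<integral>a. adj g a * f a \<partial>M) = (\<integral>c. g c * h c \<partial>N)"
      using LIMSEQ_unique[OF lim1] lim2 by simp
    then have "(\<integral>c. g c * h c \<partial>N) = (\<integral>c. g c * app f c \<partial>N)" using adjoint[OF g f] by simp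
    then show "(\<integral>c. g c * (h c - app f c) \<partial>N) = 0"
      using test_integrable[OF g hmem] test_integrable[OF g app_mem[OF f]]
      by (simp add: right_diff_distrib)
  qed
  then show ?thesis using sh by eventually_elim simp
qed

text \<open>\<open>dominated_sum\<close> bounds the sums of norms, so the vector series of the
  images converges absolutely almost everywhere. Every functional \<open>b x\<close> turns it into a
  scalar series of the kind treated in \<open>app_sums\<close>, which evaluates
  \<open>b x (h c)\<close>.\<close>

lemma extension_of_decomposition:
  fixes f :: "'a \<Rightarrow> 'y::banach"
  assumes Q: "Q \<in> positive_ops M N E H" "dominates M N E Q U"
    and b: "pairing sX sY b" and f: "D.vmem f" and C: "0 \<le> C"
    and \<phi>: "\<And>j. D.mem (\<phi> j)"
    and le: "\<And>a n. a \<in> space M \<Longrightarrow> (\<Sum>j<n. norm (\<phi> j a) * norm (y j)) \<le> C * norm (f a)"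
    and sums: "\<And>a. a \<in> space M \<Longrightarrow> (\<lambda>j. sY (\<phi> j a) (y j)) sums f a"
  obtains h where "R.vmem h" "\<And>x. AE c in N. b x (h c) = app (\<lambda>a. b x (f a)) c"
    "AE c in N. (\<lambda>j. sY (app (\<phi> j) c) (y j)) sums h c"
    "AE c in N. \<forall>n. (\<Sum>j<n. norm (app (\<phi> j) c) * norm (y j)) \<le> C * norm (lattice_op.app M Q (\<lambda>a. of_real (norm (f a))) c)"
    "AE c in N. norm (h c) \<le> C * norm (lattice_op.app M Q (\<lambda>a. of_real (norm (f a))) c)"
proof -
  interpret Q: positive_op M E N H Q by (rule positive_op_intro[OF lattice_op_axioms Q(1)])
  interpret b: pairing sX sY b by (rule b)
  have fE: "D.mem (\<lambda>a. of_real (norm (f a)))" using f by (simp add: D.vmem_def)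
  have CfE: "D.mem (\<lambda>a. of_real (c * norm (f a)))" for c using D.mem_scale[OF fE, of "of_real c"] by simp
  define K where "K = Q.app (\<lambda>a. of_real (norm (f a)))"
  have K: "R.mem K" unfolding K_def by (rule Q.app_mem[OF fE])
  have QC: "AE c in N. norm (Q.app (\<lambda>a. of_real (C * norm (f a))) c) = C * norm (K c)"
    using Q.app_scale[OF fE, of "of_real C"] by eventually_elim (simp add: K_def norm_mult C)
  have le': "AE a in M. (\<Sum>j<n. norm (\<phi> j a) * norm (y j)) \<le> C * norm (f a)" for n
    by (rule AE_I2) (rule le)
  have bound: "AE c in N. \<forall>n. (\<Sum>j<n. norm (app (\<phi> j) c) * norm (y j)) \<le> C * norm (K c)"
    using dominated_sum[where t="\<lambda>j. norm (y j)", OF Q \<phi> norm_ge_zero CfE le'] QC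
    by eventually_elim simp
  obtain Z where Z: "\<And>c. c \<in> space N - Z \<Longrightarrow> \<forall>n. (\<Sum>j<n. norm (app (\<phi> j) c) * norm (y j)) \<le> C * norm (K c)"
    "Z \<in> null_sets N" using AE_E3[OF bound] by metis
  have aeZ: "AE c in N. c \<notin> Z" using Z(2) by (rule AE_not_in)
  \<comment> \<open>Annulling the coefficients on the null set \<open>Z\<close> makes the series
    converge at every point, so that \<open>h\<close> is an everywhere limit of strongly measurable
    functions.\<close>
  define \<psi> where "\<psi> j c = of_real (indicat_real (space N - Z) c) * app (\<phi> j) c" for j c
  have am[measurable]: "app (\<phi> j) \<in> borel_measurable N" for j by (rule R.mem_measurable[OF app_mem[OF \<phi>]])
  have [measurable]: "space N - Z \<in> sets N" using Z(2) by blast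
  have \<psi>m[measurable]: "\<psi> j \<in> borel_measurable N" for j unfolding \<psi>_def by measurable
  have \<psi>b: "(\<Sum>j<n. norm (\<psi> j c) * norm (y j)) \<le> C * norm (K c)" if c: "c \<in> space N" for n c
  proof (cases "c \<in> Z")
    case False then show ?thesis using Z(1)[of c] c by (simp add: \<psi>_def)
  next
    case True then show ?thesis using C by (simp add: \<psi>_def)
  qed
  have \<psi>s: "summable (\<lambda>j. norm (sY (\<psi> j c) (y j)))" if c: "c \<in> space N" for c
    unfolding b.Y.norm_eq using \<psi>b[OF c]
    by (intro bounded_imp_summable[where B="C * norm (K c)"])
      (auto simp: lessThan_Suc_atMost[symmetric] simp del: sum.lessThan_Suc)
  define h where "h c = (\<Sum>j. sY (\<psi> j c) (y j))" for c
  have hs: "(\<lambda>j. sY (\<psi> j c) (y j)) sums h c" if "c \<in> space N" for c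
    using \<psi>s[OF that] by (simp add: h_def summable_norm_cancel summable_sums)
  have \<psi>eq: "AE c in N. \<forall>j. \<psi> j c = app (\<phi> j) c"
    using aeZ AE_space by eventually_elim (simp add: \<psi>_def)
  have hsm: "strongly_measurable N h"
    by (rule strongly_measurable_lim[where g="\<lambda>n c. \<Sum>j<n. sY (\<psi> j c) (y j)"])
      (use hs in \<open>auto simp: sums_def intro!: strongly_measurable_sum b.Y.strongly_measurable_left \<psi>m\<close>)
  have hle: "norm (h c) \<le> C * norm (K c)" if c: "c \<in> space N" for c
  proof -
    have "norm (h c) \<le> (\<Sum>j. norm (sY (\<psi> j c) (y j)))" unfolding h_def by (rule summable_norm[OF \<psi>s[OF c]])
    also have "\<dots> \<le> C * norm (K c)" using \<psi>b[OF c] by (intro suminf_le_const[OF \<psi>s[OF c]]) (simp add: b.Y.norm_eq)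
    finally show ?thesis .
  qed
  have hmem: "R.vmem h"
    by (rule R.vmem_solid[OF R.mem_scale[OF K, of "of_real C"] hsm]) (use hle C in \<open>simp add: norm_mult\<close>)
  have hsAE: "AE c in N. (\<lambda>j. sY (app (\<phi> j) c) (y j)) sums h c"
    using \<psi>eq AE_space
  proof eventually_elim
    case (elim c)
    then show ?case using hs[of c] by simp
  qed
  show ?thesis
  proof (rule that[OF hmem _ hsAE])
    fix x
    obtain B where B: "B \<ge> 0" "\<And>x y. norm (b x y) \<le> B * norm x * norm y" by (rule b.bound) blast
    have lin: "bounded_linear (b x)" using b.bounded_bilinear by (rule bounded_bilinear.bounded_linear_right)
    have "AE c in N. (\<lambda>j. app (\<phi> j) c * b x (y j)) sums app (\<lambda>a. b x (f a)) c"
    proof (rule app_sums[OF Q \<phi>])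
      \<comment> \<open>With \<open>B\<close> the bound of the form, each
        \<open>norm (b x (y j))\<close> is at most \<open>B * norm x * norm (y j)\<close>, and the
        weighted norms sum to at most \<open>C * norm (f a)\<close>.\<close>
      show "D.mem (\<lambda>a. of_real (B * norm x * C * norm (f a)))" by (rule CfE)
      show "D.mem (\<lambda>a. b x (f a))" by (rule D.mem_pairing[OF b f])
      show "AE a in M. (\<Sum>j<n. norm (\<phi> j a) * norm (b x (y j))) \<le> B * norm x * C * norm (f a)" for n
      proof (rule AE_I2)
        fix a assume a: "a \<in> space M"
        have "(\<Sum>j<n. norm (\<phi> j a) * norm (b x (y j))) \<le> (\<Sum>j<n. norm (\<phi> j a) * (B * norm x * norm (y j)))"
          using B(2) by (intro sum_mono mult_left_mono) auto
        also have "\<dots> = B * norm x * (\<Sum>j<n. norm (\<phi> j a) * norm (y j))"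
          by (simp add: sum_distrib_left mult_ac)
        also have "\<dots> \<le> B * norm x * (C * norm (f a))" using B(1) by (intro mult_left_mono le a) simp
        finally show "(\<Sum>j<n. norm (\<phi> j a) * norm (b x (y j))) \<le> B * norm x * C * norm (f a)" by (simp add: mult.assoc)
      qed
      show "AE a in M. (\<lambda>j. \<phi> j a * b x (y j)) sums b x (f a)"
        using bounded_linear.sums[OF lin sums] by (auto simp: b.scale_right)
    qed
    then show "AE c in N. b x (h c) = app (\<lambda>a. b x (f a)) c"
      using hsAE
    proof eventually_elim
      case (elim c)
      have "(\<lambda>j. app (\<phi> j) c * b x (y j)) sums b x (h c)"
        using bounded_linear.sums[OF lin elim(2)] by (simp add: b.scale_right)
      then show ?case using elim(1) by (rule sums_unique2)
    qed
  qed (use bound hle in \<open>auto simp: K_def\<close>)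
qed

end

section \<open>Norms of vector-valued functions; algebraic and closed tensor products\<close>

context function_lattice begin

definition vfnorm :: "('a \<Rightarrow> 'y::banach) \<Rightarrow> real" where "vfnorm f = fnorm (\<lambda>a. of_real (norm (f a)))"

lemma vfnorm_le:
  assumes "vmem f" "mem g" "AE a in M. norm (f a) \<le> norm (g a)" shows "vfnorm f \<le> fnorm g"
  unfolding vfnorm_def using assms by (intro fnorm_mono) (auto simp: vmem_def mem_measurable)

lemma vmem_norm: "vmem f \<Longrightarrow> mem (\<lambda>a. of_real (norm (f a)))" by (simp add: vmem_def)

lemma vfnorm_nonneg: "vmem f \<Longrightarrow> 0 \<le> vfnorm f"
  unfolding vfnorm_def by (intro fnorm_nonneg vmem_norm)

lemma vfnorm_triangle:
  assumes "vmem f" "vmem g" shows "vfnorm (\<lambda>a. f a + g a) \<le> vfnorm f + vfnorm g"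
proof -
  have "vfnorm (\<lambda>a. f a + g a) \<le> fnorm (\<lambda>a. of_real (norm (f a)) + of_real (norm (g a)))"
    using assms by (intro vfnorm_le vmem_add mem_add vmem_norm) (simp_all flip: of_real_add add: norm_triangle_ineq)
  also have "\<dots> \<le> vfnorm f + vfnorm g" unfolding vfnorm_def using assms by (intro fnorm_triangle vmem_norm)
  finally show ?thesis .
qed

lemma vfnorm_scale:
  fixes s :: "'k \<Rightarrow> 'y::banach \<Rightarrow> 'y"
  assumes "scaling s" "vmem f" shows "vfnorm (\<lambda>a. s c (f a)) = norm c * vfnorm f"
  using fnorm_scale[OF vmem_norm[OF assms(2)], of "of_real (norm c)"]
  by (simp add: vfnorm_def scaling.norm_eq[OF assms(1)])

lemma vmem_minus: "vmem f \<Longrightarrow> vmem (\<lambda>a. - f a)"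
  using strongly_measurable_comp[of M f uminus] by (simp add: vmem_def continuous_on_minus)

lemma vmem_diff: "vmem f \<Longrightarrow> vmem g \<Longrightarrow> vmem (\<lambda>a. f a - g a)"
  using vmem_add[of f "\<lambda>a. - g a"] vmem_minus[of g] by simp

lemma valued_vdiff:
  fixes s :: "'k \<Rightarrow> 'y::banach \<Rightarrow> 'y"
  assumes "scaling s" "vmem f" "vmem g"
  shows "vdiff (valued M E s) (ae_class M f) (ae_class M g) = ae_class M (\<lambda>a. f a - g a)"
  using assms by (simp add: vdiff_def valued_vscale valued_vadd vmem_minus scaling.minus_left scaling.one)

lemma valued_vfnorm: "vmem f \<Longrightarrow> vnorm (valued M E s) (ae_class M f) = vfnorm f"
  by (simp add: valued_norm vfnorm_def)

lemma valued_vadd_closed: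
  assumes "u \<in> vcarrier (valued M E s)" "v \<in> vcarrier (valued M E s)"
  shows "vadd (valued M E s) u v \<in> vcarrier (valued M E s)"
  using assms by (elim valued_cases) (simp add: valued_vadd vmem_carrier vmem_add)

lemma valued_vscale_closed:
  fixes s :: "'k \<Rightarrow> 'y::banach \<Rightarrow> 'y"
  assumes "scaling s" "u \<in> vcarrier (valued M E s)"
  shows "vscale (valued M E s) c u \<in> vcarrier (valued M E s)"
  using assms by (elim valued_cases) (simp add: valued_vscale vmem_carrier vmem_scale)

lemma elem_tensor_class:
  assumes "mem f" shows "elem_tensor M s (ae_class M f) y = ae_class M (\<lambda>a. s (f a) y)"
  unfolding elem_tensor_def using rep_class[OF assms] by (intro ae_class_cong) (auto elim: AE_mp)

lemma alg_tensor_simps [simp]: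
  "vadd (alg_tensor M E s) = vadd (valued M E s)" "vscale (alg_tensor M E s) = vscale (valued M E s)"
  "vnorm (alg_tensor M E s) = vnorm (valued M E s)" "vzero (alg_tensor M E s) = vzero (valued M E s)"
  "vcarrier (alg_tensor M E s) = vspan (valued M E s) {elem_tensor M s e y | e y. e \<in> vcarrier E}"
  by (simp_all add: alg_tensor_def)

lemma closed_tensor_simps [simp]:
  "vadd (closed_tensor M E s) = vadd (valued M E s)" "vscale (closed_tensor M E s) = vscale (valued M E s)"
  "vnorm (closed_tensor M E s) = vnorm (valued M E s)" "vzero (closed_tensor M E s) = vzero (valued M E s)"
  by (simp_all add: closed_tensor_def)

context
  fixes s :: "'k \<Rightarrow> 'y::banach \<Rightarrow> 'y"
  assumes s: "scaling s"
begin

lemma elem_tensor_valued: "e \<in> vcarrier E \<Longrightarrow> elem_tensor M s e y \<in> vcarrier (valued M E s)"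
  using elem_tensor_class[OF mem_rep, of e s y] vmem_carrier[OF vmem_tensor[OF s mem_rep], of e y s]
  by (simp add: ae_class_rep)

lemma alg_tensor_valued: "c \<in> vcarrier (alg_tensor M E s) \<Longrightarrow> c \<in> vcarrier (valued M E s)"
  unfolding alg_tensor_simps
proof (induction rule: vspan.induct)
  case vspan_zero
  then show ?case by (simp add: valued_vzero vmem_carrier vmem_zero)
next
  case (vspan_step v w k)
  then show ?case by (auto intro!: valued_vadd_closed valued_vscale_closed s elem_tensor_valued)
qed

lemma alg_tensor_add:
  "u \<in> vcarrier (alg_tensor M E s) \<Longrightarrow> v \<in> vcarrier (alg_tensor M E s) \<Longrightarrow>
    vadd (valued M E s) u v \<in> vcarrier (alg_tensor M E s)"
  unfolding alg_tensor_simps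
proof (induction rule: vspan.induct)
  case vspan_zero
  then have "v \<in> vcarrier (valued M E s)" using alg_tensor_valued by simp
  then have "vadd (valued M E s) (vzero (valued M E s)) v = v"
    by (elim valued_cases) (simp add: valued_vzero valued_vadd vmem_zero)
  then show ?case using vspan_zero by simp
next
  case (vspan_step u w k)
  have m: "u \<in> vcarrier (valued M E s)" "w \<in> vcarrier (valued M E s)" "v \<in> vcarrier (valued M E s)"
    using vspan_step elem_tensor_valued alg_tensor_valued by auto
  have "vadd (valued M E s) (vadd (valued M E s) (vscale (valued M E s) k u) w) v
      = vadd (valued M E s) (vscale (valued M E s) k u) (vadd (valued M E s) w v)"
    using m by (elim valued_cases) (simp add: valued_vadd valued_vscale vmem_scale[OF s] vmem_add add.assoc)
  then show ?case using vspan.vspan_step[OF vspan_step(1) vspan_step.IH[OF vspan_step.prems]] by simp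
qed

lemma alg_tensor_scale:
  "u \<in> vcarrier (alg_tensor M E s) \<Longrightarrow> vscale (valued M E s) c u \<in> vcarrier (alg_tensor M E s)"
  unfolding alg_tensor_simps
proof (induction rule: vspan.induct)
  case vspan_zero
  have "vscale (valued M E s) c (vzero (valued M E s)) = vzero (valued M E s)"
    by (simp add: valued_vzero valued_vscale vmem_zero scaling.zero_right[OF s])
  then show ?case by (simp add: vspan.vspan_zero)
next
  case (vspan_step u w k)
  have m: "u \<in> vcarrier (valued M E s)" "w \<in> vcarrier (valued M E s)"
    using vspan_step elem_tensor_valued alg_tensor_valued by auto
  have "vscale (valued M E s) c (vadd (valued M E s) (vscale (valued M E s) k u) w)
      = vadd (valued M E s) (vscale (valued M E s) (c * k) u) (vscale (valued M E s) c w)"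
    using m by (elim valued_cases)
      (simp add: valued_vadd valued_vscale vmem_scale[OF s] vmem_add scaling.add_right[OF s] scaling.assoc[OF s])
  then show ?case using vspan.vspan_step[OF vspan_step(1) vspan_step.IH] by simp
qed

lemma elem_tensor_alg:
  assumes e: "e \<in> vcarrier E" shows "elem_tensor M s e y \<in> vcarrier (alg_tensor M E s)"
proof -
  have "vadd (valued M E s) (vscale (valued M E s) 1 (elem_tensor M s e y)) (vzero (valued M E s)) = elem_tensor M s e y"
    using elem_tensor_valued[OF e, of y]
    by (elim valued_cases) (simp add: valued_vscale valued_vzero valued_vadd vmem_zero vmem_scale[OF s] scaling.one[OF s])
  then show ?thesis using vspan.vspan_step[OF _ vspan.vspan_zero, of "elem_tensor M s e y"
      "{elem_tensor M s e y | e y. e \<in> vcarrier E}" "valued M E s" 1] e by auto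
qed

lemma tensor_sum_alg:
  assumes "\<And>j. mem (\<phi> j)"
  shows "vmem (\<lambda>a. \<Sum>j<n::nat. s (\<phi> j a) (y j))"
    and "ae_class M (\<lambda>a. \<Sum>j<n::nat. s (\<phi> j a) (y j)) \<in> vcarrier (alg_tensor M E s)"
proof (induction n)
  case 0
  show "vmem (\<lambda>a. \<Sum>j<0::nat. s (\<phi> j a) (y j))" by (simp add: vmem_zero)
  show "ae_class M (\<lambda>a. \<Sum>j<0::nat. s (\<phi> j a) (y j)) \<in> vcarrier (alg_tensor M E s)"
    using vspan.vspan_zero[of "valued M E s"] by (simp add: valued_vzero)
next
  case (Suc n)
  show v: "vmem (\<lambda>a. \<Sum>j<Suc n. s (\<phi> j a) (y j))" using Suc(1) by (simp add: vmem_add vmem_tensor[OF s] assms)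
  have "ae_class M (\<lambda>a. \<Sum>j<Suc n. s (\<phi> j a) (y j))
      = vadd (valued M E s) (ae_class M (\<lambda>a. \<Sum>j<n. s (\<phi> j a) (y j))) (elem_tensor M s (ae_class M (\<phi> n)) (y n))"
    using Suc(1) assms by (simp add: valued_vadd vmem_tensor[OF s] elem_tensor_class)
  then show "ae_class M (\<lambda>a. \<Sum>j<Suc n. s (\<phi> j a) (y j)) \<in> vcarrier (alg_tensor M E s)"
    using alg_tensor_add[OF Suc(2) elem_tensor_alg[OF mem_carrier[OF assms]]] by simp
qed

lemma closed_tensor_iff:
  assumes "vmem f"
  shows "ae_class M f \<in> vcarrier (closed_tensor M E s) \<longleftrightarrow>
    (\<forall>\<epsilon>>0. \<exists>g. vmem g \<and> ae_class M g \<in> vcarrier (alg_tensor M E s) \<and> vfnorm (\<lambda>a. f a - g a) < \<epsilon>)"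
proof -
  have "(\<exists>g\<in>vcarrier (alg_tensor M E s). vnorm (valued M E s) (vdiff (valued M E s) (ae_class M f) g) < \<epsilon>) \<longleftrightarrow>
    (\<exists>g. vmem g \<and> ae_class M g \<in> vcarrier (alg_tensor M E s) \<and> vfnorm (\<lambda>a. f a - g a) < \<epsilon>)" for \<epsilon>
  proof
    assume "\<exists>g\<in>vcarrier (alg_tensor M E s). vnorm (valued M E s) (vdiff (valued M E s) (ae_class M f) g) < \<epsilon>"
    then obtain c where c: "c \<in> vcarrier (alg_tensor M E s)"
      "vnorm (valued M E s) (vdiff (valued M E s) (ae_class M f) c) < \<epsilon>" by blast
    obtain g where "vmem g" "c = ae_class M g" using valued_cases[OF alg_tensor_valued[OF c(1)]] by blast
    then show "\<exists>g. vmem g \<and> ae_class M g \<in> vcarrier (alg_tensor M E s) \<and> vfnorm (\<lambda>a. f a - g a) < \<epsilon>"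
      using c assms by (intro exI[of _ g]) (simp add: valued_vdiff[OF s] valued_vfnorm vmem_diff)
  next
    assume "\<exists>g. vmem g \<and> ae_class M g \<in> vcarrier (alg_tensor M E s) \<and> vfnorm (\<lambda>a. f a - g a) < \<epsilon>"
    then show "\<exists>g\<in>vcarrier (alg_tensor M E s). vnorm (valued M E s) (vdiff (valued M E s) (ae_class M f) g) < \<epsilon>"
      using assms by (auto simp: valued_vdiff[OF s] valued_vfnorm vmem_diff intro!: bexI)
  qed
  then show ?thesis using vmem_carrier[OF assms, of s] by (simp add: closed_tensor_def del: alg_tensor_simps)
qed

lemma closed_tensor_valued: "c \<in> vcarrier (closed_tensor M E s) \<Longrightarrow> c \<in> vcarrier (valued M E s)"
  by (simp add: closed_tensor_def)

lemma closed_tensor_cases: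
  assumes "c \<in> vcarrier (closed_tensor M E s)" obtains f where "vmem f" "c = ae_class M f"
  using valued_cases[OF closed_tensor_valued[OF assms]] by blast

lemma alg_tensor_closed: "c \<in> vcarrier (alg_tensor M E s) \<Longrightarrow> c \<in> vcarrier (closed_tensor M E s)"
proof -
  assume c: "c \<in> vcarrier (alg_tensor M E s)"
  obtain f where f: "vmem f" "c = ae_class M f" using valued_cases[OF alg_tensor_valued[OF c]] by blast
  have "vfnorm (\<lambda>a. f a - f a) = 0" by (simp add: vfnorm_def fnorm_zero)
  then show ?thesis using c f unfolding f(2) closed_tensor_iff[OF f(1)] by auto
qed

lemma closed_tensor_add:
  assumes "u \<in> vcarrier (closed_tensor M E s)" "v \<in> vcarrier (closed_tensor M E s)"
  shows "vadd (valued M E s) u v \<in> vcarrier (closed_tensor M E s)"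
proof -
  obtain f where f: "vmem f" "u = ae_class M f" using closed_tensor_cases[OF assms(1)] by blast
  obtain g where g: "vmem g" "v = ae_class M g" using closed_tensor_cases[OF assms(2)] by blast
  have "\<exists>k. vmem k \<and> ae_class M k \<in> vcarrier (alg_tensor M E s) \<and> vfnorm (\<lambda>a. (f a + g a) - k a) < \<epsilon>" if "\<epsilon> > 0" for \<epsilon>
  proof -
    have e: "\<epsilon> / 2 > 0" using that by simp
    obtain f' where f': "vmem f'" "ae_class M f' \<in> vcarrier (alg_tensor M E s)" "vfnorm (\<lambda>a. f a - f' a) < \<epsilon> / 2"
      using assms(1) e unfolding f(2) closed_tensor_iff[OF f(1)] by blast
    obtain g' where g': "vmem g'" "ae_class M g' \<in> vcarrier (alg_tensor M E s)" "vfnorm (\<lambda>a. g a - g' a) < \<epsilon> / 2"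
      using assms(2) e unfolding g(2) closed_tensor_iff[OF g(1)] by blast
    have "(\<lambda>a. (f a + g a) - (f' a + g' a)) = (\<lambda>a. (f a - f' a) + (g a - g' a))" by auto
    then have "vfnorm (\<lambda>a. (f a + g a) - (f' a + g' a)) < \<epsilon>"
      using vfnorm_triangle[OF vmem_diff[OF f(1) f'(1)] vmem_diff[OF g(1) g'(1)]] f'(3) g'(3) by simp
    then show ?thesis using alg_tensor_add[OF f'(2) g'(2)] f'(1) g'(1)
      by (intro exI[of _ "\<lambda>a. f' a + g' a"]) (simp add: valued_vadd vmem_add del: alg_tensor_simps)
  qed
  then show ?thesis unfolding f(2) g(2) valued_vadd[OF f(1) g(1)] closed_tensor_iff[OF vmem_add[OF f(1) g(1)]] by blast
qed

lemma closed_tensor_scale: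
  assumes "u \<in> vcarrier (closed_tensor M E s)"
  shows "vscale (valued M E s) c u \<in> vcarrier (closed_tensor M E s)"
proof -
  obtain f where f: "vmem f" "u = ae_class M f" using closed_tensor_cases[OF assms(1)] by blast
  have "\<exists>k. vmem k \<and> ae_class M k \<in> vcarrier (alg_tensor M E s) \<and> vfnorm (\<lambda>a. s c (f a) - k a) < \<epsilon>" if "\<epsilon> > 0" for \<epsilon>
  proof -
    \<comment> \<open>The added 1 covers the case \<open>c = 0\<close>.\<close>
    have e: "\<epsilon> / (norm c + 1) > 0" using that by (simp add: add_nonneg_pos)
    obtain f' where f': "vmem f'" "ae_class M f' \<in> vcarrier (alg_tensor M E s)" "vfnorm (\<lambda>a. f a - f' a) < \<epsilon> / (norm c + 1)"
      using assms(1) e unfolding f(2) closed_tensor_iff[OF f(1)] by blast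
    have d: "vmem (\<lambda>a. f a - f' a)" by (rule vmem_diff[OF f(1) f'(1)])
    have "(\<lambda>a. s c (f a) - s c (f' a)) = (\<lambda>a. s c (f a - f' a))"
      using bounded_bilinear.diff_right[OF scaling.bounded_bilinear[OF s]] by auto
    then have "vfnorm (\<lambda>a. s c (f a) - s c (f' a)) = norm c * vfnorm (\<lambda>a. f a - f' a)"
      by (simp add: vfnorm_scale[OF s d])
    also have "\<dots> \<le> (norm c + 1) * vfnorm (\<lambda>a. f a - f' a)"
      by (intro mult_right_mono vfnorm_nonneg d) simp
    also have "\<dots> < \<epsilon>" using f'(3) by (simp add: pos_less_divide_eq add_nonneg_pos mult.commute)
    finally show ?thesis using alg_tensor_scale[OF f'(2), of c] f'(1)
      by (intro exI[of _ "\<lambda>a. s c (f' a)"]) (simp add: valued_vscale vmem_scale[OF s] del: alg_tensor_simps)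
  qed
  then show ?thesis unfolding f(2) valued_vscale[OF f(1)] closed_tensor_iff[OF vmem_scale[OF s f(1)]] by blast
qed

end

end

text \<open>An operator \<open>W\<close> on all of E(Y) with the right values on elementary tensors
  provides the existence behind the choice in \<open>tensor_id\<close>; uniqueness is an induction
  over the span. This avoids a direct proof that U \<otimes> I is well defined on representations of
  tensors.\<close>

lemma (in lattice_op) tensor_id_eq:
  fixes s :: "'k \<Rightarrow> 'y::banach \<Rightarrow> 'y"
  assumes s: "scaling s" and W: "W \<in> linear_ops (valued M E s) (valued N H s)"
    and Wt: "\<And>e y. e \<in> vcarrier E \<Longrightarrow> W (elem_tensor M s e y) = elem_tensor N s (U e) y"
    and h: "h \<in> vcarrier (alg_tensor M E s)"
  shows "tensor_id M N E H s U h = W h"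
proof -
  let ?P = "\<lambda>W. W \<in> linear_ops (alg_tensor M E s) (alg_tensor N H s) \<and>
     (\<forall>e\<in>vcarrier E. \<forall>y. W (elem_tensor M s e y) = elem_tensor N s (U e) y)"
  note [simp del] = D.alg_tensor_simps(5) R.alg_tensor_simps(5)
  have add: "W (vadd (valued M E s) u v) = vadd (valued N H s) (W u) (W v)"
    if "u \<in> vcarrier (alg_tensor M E s)" "v \<in> vcarrier (alg_tensor M E s)" for u v
    using W that D.alg_tensor_valued[OF s] by (simp add: linear_ops_def)
  have scale: "W (vscale (valued M E s) c v) = vscale (valued N H s) c (W v)"
    if "v \<in> vcarrier (alg_tensor M E s)" for c v
    using W that D.alg_tensor_valued[OF s] by (simp add: linear_ops_def)
  have z: "vzero (valued M E s) \<in> vcarrier (alg_tensor M E s)"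
    unfolding D.alg_tensor_simps(5) by (rule vspan.vspan_zero)
  have zero: "V (vzero (valued M E s)) = vzero (valued N H s)"
    if V: "V (vscale (valued M E s) 0 (vzero (valued M E s))) = vscale (valued N H s) 0 (V (vzero (valued M E s)))"
      "V (vzero (valued M E s)) \<in> vcarrier (valued N H s)" for V
  proof -
    have "V (vzero (valued M E s)) = vscale (valued N H s) 0 (V (vzero (valued M E s)))"
      using V(1) by (simp add: D.valued_vzero D.valued_vscale D.vmem_zero scaling.zero_left[OF s])
    also have "\<dots> = vzero (valued N H s)"
      using V(2) by (elim R.valued_cases) (simp add: R.valued_vscale R.valued_vzero scaling.zero_left[OF s])
    finally show ?thesis .
  qed
  have ran: "W v \<in> vcarrier (alg_tensor N H s)" if "v \<in> vcarrier (alg_tensor M E s)" for v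
    using that unfolding D.alg_tensor_simps(5)
  proof (induction rule: vspan.induct)
    case vspan_zero
    have "W (vzero (valued M E s)) \<in> vcarrier (valued N H s)"
      using W D.alg_tensor_valued[OF s z] by (auto simp: linear_ops_def)
    then have "W (vzero (valued M E s)) = vzero (valued N H s)" using scale[OF z] by (intro zero) simp
    then show ?case unfolding R.alg_tensor_simps(5) by (simp only: vspan.vspan_zero)
  next
    case (vspan_step v w k)
    obtain e y where v: "v = elem_tensor M s e y" "e \<in> vcarrier E" using vspan_step(1) by blast
    have m: "v \<in> vcarrier (alg_tensor M E s)" "w \<in> vcarrier (alg_tensor M E s)"
      using D.elem_tensor_alg[OF s v(2)] v(1) vspan_step(2) by (simp_all add: D.alg_tensor_simps(5))
    have "W (vadd (valued M E s) (vscale (valued M E s) k v) w)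
        = vadd (valued N H s) (vscale (valued N H s) k (elem_tensor N s (U e) y)) (W w)"
      using add[OF D.alg_tensor_scale[OF s m(1)] m(2)] scale[OF m(1)] Wt[OF v(2)] v(1) by simp
    then show ?case
      using vspan_step.IH by (simp add: R.alg_tensor_add R.alg_tensor_scale R.elem_tensor_alg s U_carrier v(2))
  qed
  \<comment> \<open>This restriction is the witness for the choice in
    \<open>tensor_id\<close>.\<close>
  have "?P (restrict W (vcarrier (alg_tensor M E s)))"
    using ran add scale Wt
    by (auto simp: linear_ops_def D.alg_tensor_add D.alg_tensor_scale D.elem_tensor_alg s)
  then have P: "?P (tensor_id M N E H s U)" unfolding tensor_id_def by (rule someI[of ?P])
  define X where "X = tensor_id M N E H s U"
  have X: "X u \<in> vcarrier (alg_tensor N H s)" "X (vscale (valued M E s) c u) = vscale (valued N H s) c (X u)"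
    "v \<in> vcarrier (alg_tensor M E s) \<Longrightarrow> X (vadd (valued M E s) u v) = vadd (valued N H s) (X u) (X v)"
    if "u \<in> vcarrier (alg_tensor M E s)" for u v c
    using P that unfolding X_def[symmetric] by (auto simp: linear_ops_def)
  have Xt: "X (elem_tensor M s e y) = elem_tensor N s (U e) y" if "e \<in> vcarrier E" for e y
    using P that unfolding X_def[symmetric] by blast
  have "X h = W h" using h unfolding D.alg_tensor_simps(5)
  proof (induction rule: vspan.induct)
    case vspan_zero
    have "X (vzero (valued M E s)) = vzero (valued N H s)"
      by (rule zero[OF X(2)[OF z] R.alg_tensor_valued[OF s X(1)[OF z]]])
    then show ?case using zero[OF scale[OF z] R.alg_tensor_valued[OF s ran[OF z]]] by simp
  next
    case (vspan_step v w k)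
    obtain e y where v: "v = elem_tensor M s e y" "e \<in> vcarrier E" using vspan_step(1) by blast
    have m: "v \<in> vcarrier (alg_tensor M E s)" "w \<in> vcarrier (alg_tensor M E s)"
      using D.elem_tensor_alg[OF s v(2)] v(1) vspan_step(2) by (simp_all add: D.alg_tensor_simps(5))
    show ?case
      using add[OF D.alg_tensor_scale[OF s m(1)] m(2)] X(3)[OF D.alg_tensor_scale[OF s m(1)] m(2)]
        scale[OF m(1)] X(2)[OF m(1)] Wt[OF v(2)] Xt[OF v(2)] v(1) vspan_step.IH by simp
  qed
  then show ?thesis by (simp add: X_def)
qed

lemma op_norm_bounds:
  assumes "V \<in> bounded_ops E H" "v \<in> vcarrier E" "vnorm E v \<le> 1" "\<And>u. u \<in> vcarrier E \<Longrightarrow> 0 \<le> vnorm E u"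
  shows "vnorm H (V v) \<le> op_norm E H V"
proof -
  obtain C where C: "\<And>v. v \<in> vcarrier E \<Longrightarrow> vnorm H (V v) \<le> C * vnorm E v"
    using assms(1) by (auto simp: bounded_ops_def)
  have "vnorm H (V u) \<le> \<bar>C\<bar>" if "u \<in> vcarrier E" "vnorm E u \<le> 1" for u
  proof -
    have "C * vnorm E u \<le> \<bar>C\<bar> * 1" using that assms(4)[of u] by (intro mult_mono) auto
    then show ?thesis using C[OF that(1)] by simp
  qed
  then have "bdd_above ((\<lambda>v. vnorm H (V v)) ` {v \<in> vcarrier E. vnorm E v \<le> 1})" by (intro bdd_aboveI2) auto
  then show ?thesis unfolding op_norm_def using assms by (intro cSUP_upper) auto
qed

section \<open>The vector-valued extension as an operator on classes\<close>

context adjoint_op begin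

text \<open>The exceptional null set may depend on \<open>x\<close>. By \<open>is_ext_unique\<close>
  the identities still determine \<open>h\<close> almost everywhere, which makes the choice in
  \<open>valued_ext\<close> harmless.\<close>

definition is_ext :: "('x::banach \<Rightarrow> 'y::banach \<Rightarrow> 'k) \<Rightarrow> ('a \<Rightarrow> 'y) \<Rightarrow> ('b \<Rightarrow> 'y) \<Rightarrow> bool" where
  "is_ext b f h \<longleftrightarrow> R.vmem h \<and> (\<forall>x. AE c in N. b x (h c) = app (\<lambda>a. b x (f a)) c)"

definition valued_ext :: "('k \<Rightarrow> 'y \<Rightarrow> 'y) \<Rightarrow> ('x::banach \<Rightarrow> 'y::banach \<Rightarrow> 'k) \<Rightarrow> ('a \<Rightarrow> 'y) set \<Rightarrow> ('b \<Rightarrow> 'y) set" where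
  "valued_ext s b = (\<lambda>e\<in>vcarrier (valued M E s). ae_class N (SOME h. is_ext b (rep e) h))"

end

locale dominated_adjoint_op = adjoint_op M E N H U test adj + pairing sX sY b
  for M :: "'a measure" and E :: "('k::real_or_complex, ('a \<Rightarrow> 'k) set) nspace"
    and N :: "'b measure" and H :: "('k, ('b \<Rightarrow> 'k) set) nspace"
    and U :: "('a \<Rightarrow> 'k) set \<Rightarrow> ('b \<Rightarrow> 'k) set"
    and test adj and sX :: "'k \<Rightarrow> 'x::banach \<Rightarrow> 'x" and sY :: "'k \<Rightarrow> 'y::banach \<Rightarrow> 'y"
    and b :: "'x \<Rightarrow> 'y \<Rightarrow> 'k" +
  assumes dominated: "U \<in> dominated_ops M N E H"
begin

lemma is_ext_unique:
  assumes "is_ext b f h" "is_ext b f h'" shows "AE c in N. h c = h' c"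
proof -
  have "AE c in N. h c - h' c = 0"
  proof (rule AE_zero_if_separated[where b=b])
    show "strongly_measurable N (\<lambda>c. h c - h' c)"
      using assms R.vmem_diff[of h h'] by (simp add: is_ext_def R.vmem_def)
    show "AE c in N. b x (h c - h' c) = 0" for x
    proof -
      have "AE c in N. b x (h c) = app (\<lambda>a. b x (f a)) c" "AE c in N. b x (h' c) = app (\<lambda>a. b x (f a)) c"
        using assms by (auto simp: is_ext_def)
      then show ?thesis by eventually_elim (simp add: bounded_bilinear.diff_right[OF bounded_bilinear])
    qed
  qed (rule continuous, rule separating, blast)
  then show ?thesis by simp
qed

lemma is_ext_cong: "AE a in M. f a = g a \<Longrightarrow> is_ext b f h \<longleftrightarrow> is_ext b g h"
proof -
  assume "AE a in M. f a = g a"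
  then have "app (\<lambda>a. b x (f a)) = app (\<lambda>a. b x (g a))" for x by (intro app_cong) (auto elim: AE_mp)
  then show ?thesis by (simp add: is_ext_def)
qed

text \<open>The parameter \<open>\<epsilon>\<close> stays free for two uses: the value 1 suffices
  for existence, and small values yield the sharp bound of \<open>is_ext_dominated\<close>.\<close>

lemma ext_series:
  assumes f: "D.vmem f" and Q: "Q \<in> positive_ops M N E H" "dominates M N E Q U" and \<epsilon>: "0 < \<epsilon>"
  obtains \<phi> :: "nat \<Rightarrow> 'a \<Rightarrow> 'k" and y :: "nat \<Rightarrow> 'y" and h
  where "\<And>j. D.mem (\<phi> j)"
    "\<And>a n. a \<in> space M \<Longrightarrow> (\<Sum>j<n. norm (\<phi> j a) * norm (y j)) \<le> (1 + \<epsilon>) * norm (f a)"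
    "\<And>a. a \<in> space M \<Longrightarrow> (\<lambda>j. sY (\<phi> j a) (y j)) sums f a" "is_ext b f h"
    "AE c in N. (\<lambda>j. sY (app (\<phi> j) c) (y j)) sums h c"
    "AE c in N. \<forall>n. (\<Sum>j<n. norm (app (\<phi> j) c) * norm (y j)) \<le>
      (1 + \<epsilon>) * norm (lattice_op.app M Q (\<lambda>a. of_real (norm (f a))) c)"
    "AE c in N. norm (h c) \<le> (1 + \<epsilon>) * norm (lattice_op.app M Q (\<lambda>a. of_real (norm (f a))) c)"
proof -
  obtain \<phi> and y where d: "\<And>j. D.mem (\<phi> j)"
    "\<And>a n. a \<in> space M \<Longrightarrow> (\<Sum>j<n. norm (\<phi> j a) * norm (y j)) \<le> (1 + \<epsilon>) * norm (f a)"
    "\<And>a. a \<in> space M \<Longrightarrow> (\<lambda>j. sY (\<phi> j a) (y j)) sums f a"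
    by (rule D.tensor_decomposition[OF Y.scaling_axioms f \<epsilon>]) blast
  have C: "0 \<le> 1 + \<epsilon>" using \<epsilon> by simp
  obtain h where h: "R.vmem h" "\<And>x. AE c in N. b x (h c) = app (\<lambda>a. b x (f a)) c"
    "AE c in N. (\<lambda>j. sY (app (\<phi> j) c) (y j)) sums h c"
    "AE c in N. \<forall>n. (\<Sum>j<n. norm (app (\<phi> j) c) * norm (y j)) \<le>
      (1 + \<epsilon>) * norm (lattice_op.app M Q (\<lambda>a. of_real (norm (f a))) c)"
    "AE c in N. norm (h c) \<le> (1 + \<epsilon>) * norm (lattice_op.app M Q (\<lambda>a. of_real (norm (f a))) c)"
    by (rule extension_of_decomposition[OF Q pairing_axioms f C d]) auto
  have e: "is_ext b f h" using h(1,2) by (simp add: is_ext_def)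
  show ?thesis by (rule that[of \<phi> y h]) (fact d h e)+
qed

lemma is_ext_exists:
  assumes f: "D.vmem f" shows "\<exists>h. is_ext b f h"
proof -
  obtain Q where Q: "Q \<in> positive_ops M N E H" "dominates M N E Q U"
    using dominated by (auto simp: dominated_ops_def)
  show ?thesis by (rule ext_series[OF f Q zero_less_one]) blast
qed

text \<open>Here \<open>h\<close> is prescribed: a series for some extension is formed, and
  uniqueness moves its sum to \<open>h\<close>. The integrable majorant \<open>K\<close> is twice
  the dominating operator at \<open>norm f\<close>.\<close>

lemma ext_decomposition:
  assumes f: "D.vmem f" and h: "is_ext b f h"
  obtains \<phi> :: "nat \<Rightarrow> 'a \<Rightarrow> 'k" and y :: "nat \<Rightarrow> 'y" and K :: "'b \<Rightarrow> 'k"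
  where "\<And>j. D.mem (\<phi> j)" "R.mem K"
    "\<And>a n. a \<in> space M \<Longrightarrow> (\<Sum>j<n. norm (\<phi> j a) * norm (y j)) \<le> 2 * norm (f a)"
    "\<And>a. a \<in> space M \<Longrightarrow> (\<lambda>j. sY (\<phi> j a) (y j)) sums f a"
    "AE c in N. (\<lambda>j. sY (app (\<phi> j) c) (y j)) sums h c"
    "AE c in N. \<forall>n. (\<Sum>j<n. norm (app (\<phi> j) c) * norm (y j)) \<le> norm (K c)"
proof -
  obtain Q where Q: "Q \<in> positive_ops M N E H" "dominates M N E Q U"
    using dominated by (auto simp: dominated_ops_def)
  interpret Q: positive_op M E N H Q by (rule positive_op_intro[OF lattice_op_axioms Q(1)])
  obtain \<phi> y h' where d: "\<And>j. D.mem (\<phi> j)"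
    "\<And>a n. a \<in> space M \<Longrightarrow> (\<Sum>j<n. norm (\<phi> j a) * norm (y j)) \<le> (1 + 1) * norm (f a)"
    "\<And>a. a \<in> space M \<Longrightarrow> (\<lambda>j. sY (\<phi> j a) (y j)) sums f a" "is_ext b f h'"
    "AE c in N. (\<lambda>j. sY (app (\<phi> j) c) (y j)) sums h' c"
    "AE c in N. \<forall>n. (\<Sum>j<n. norm (app (\<phi> j) c) * norm (y j)) \<le> (1 + 1) * norm (Q.app (\<lambda>a. of_real (norm (f a))) c)"
    by (rule ext_series[OF f Q zero_less_one]) blast
  have "AE c in N. (\<lambda>j. sY (app (\<phi> j) c) (y j)) sums h c"
    using d(5) is_ext_unique[OF d(4) h] by eventually_elim simp
  moreover have "R.mem (\<lambda>c. 2 * Q.app (\<lambda>a. of_real (norm (f a))) c)"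
    using f by (intro R.mem_scale Q.app_mem) (simp add: D.vmem_def)
  ultimately show ?thesis using d by (intro that[of \<phi> _ y]) (auto simp: norm_mult)
qed

text \<open>Smaller errors need other series and produce other sums, but all these agree almost
  everywhere with \<open>h\<close>. So \<open>h\<close> satisfies the bounds with factor 1 + 1/(m+1)
  for all m at once.\<close>

lemma is_ext_dominated:
  assumes f: "D.vmem f" and h: "is_ext b f h" and Q: "Q \<in> positive_ops M N E H" "dominates M N E Q U"
  shows "AE c in N. norm (h c) \<le> norm (lattice_op.app M Q (\<lambda>a. of_real (norm (f a))) c)"
proof -
  let ?K = "\<lambda>c. norm (lattice_op.app M Q (\<lambda>a. of_real (norm (f a))) c)"
  have "AE c in N. norm (h c) \<le> (1 + 1 / real (Suc m)) * ?K c" for m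
  proof -
    have "0 < 1 / real (Suc m)" by simp
    then obtain h' where h': "is_ext b f h'" "AE c in N. norm (h' c) \<le> (1 + 1 / real (Suc m)) * ?K c"
      by (rule ext_series[OF f Q]) blast
    then show ?thesis using is_ext_unique[OF h'(1) h] by (auto elim!: AE_mp)
  qed
  then have "AE c in N. \<forall>m. norm (h c) \<le> (1 + 1 / real (Suc m)) * ?K c" by (simp add: AE_all_countable)
  then show ?thesis
  proof eventually_elim
    case (elim c)
    have "(\<lambda>m. (1 + 1 / real (Suc m)) * ?K c) \<longlonglongrightarrow> (1 + 0) * ?K c"
      by (intro tendsto_mult tendsto_add tendsto_const LIMSEQ_Suc lim_1_over_n)
    then show ?case using elim by (intro LIMSEQ_le_const[where X="\<lambda>m. (1 + 1 / real (Suc m)) * ?K c"]) auto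
  qed
qed

abbreviation W where "W \<equiv> valued_ext sY b"

lemma W_class:
  assumes f: "D.vmem f" and h: "is_ext b f h" shows "W (ae_class M f) = ae_class N h"
proof -
  have "is_ext b (rep (ae_class M f)) h" using h is_ext_cong[OF D.valued_rep_class[OF f]] by blast
  then have "is_ext b (rep (ae_class M f)) (SOME h. is_ext b (rep (ae_class M f)) h)"
    by (rule someI[of "is_ext b (rep (ae_class M f))"])
  then have "is_ext b f (SOME h. is_ext b (rep (ae_class M f)) h)"
    using is_ext_cong[OF D.valued_rep_class[OF f]] by blast
  then show ?thesis unfolding valued_ext_def
    using D.vmem_carrier[OF f] is_ext_unique[OF _ h] by (simp add: ae_class_cong)
qed

lemma W_cases:
  assumes "e \<in> vcarrier (valued M E sY)"
  obtains f h where "D.vmem f" "e = ae_class M f" "is_ext b f h" "R.vmem h" "W e = ae_class N h"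
proof -
  obtain f where f: "D.vmem f" "e = ae_class M f" using D.valued_cases[OF assms] by blast
  obtain h where h: "is_ext b f h" using is_ext_exists[OF f(1)] by blast
  show ?thesis using h W_class[OF f(1) h] f by (intro that[of f h]) (auto simp: is_ext_def)
qed

text \<open>The series is no help here, since its terms are chosen anew for every function. The
  identities in \<open>is_ext\<close> are linear in the pair of \<open>f\<close> and
  \<open>h\<close>, and they determine \<open>h\<close>.\<close>

lemma W_linear: "W \<in> linear_ops (valued M E sY) (valued N H sY)"
proof -
  have ran: "W u \<in> vcarrier (valued N H sY)" if u: "u \<in> vcarrier (valued M E sY)" for u
  proof -
    obtain h where "R.vmem h" "W u = ae_class N h" by (rule W_cases[OF u])
    then show ?thesis by (simp only: R.vmem_carrier)
  qed
  have scale: "W (vscale (valued M E sY) c u) = vscale (valued N H sY) c (W u)"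
    if u: "u \<in> vcarrier (valued M E sY)" for c u
  proof -
    obtain f h where f: "D.vmem f" "u = ae_class M f" "is_ext b f h" "R.vmem h" "W u = ae_class N h"
      by (rule W_cases[OF u])
    have mb: "D.mem (\<lambda>a. b x (f a))" for x by (rule D.mem_pairing[OF pairing_axioms f(1)])
    have "is_ext b (\<lambda>a. sY c (f a)) (\<lambda>b. sY c (h b))"
      unfolding is_ext_def
    proof (intro conjI allI R.vmem_scale[OF Y.scaling_axioms f(4)])
      fix x
      have "AE d in N. b x (h d) = app (\<lambda>a. b x (f a)) d" using f(3) by (simp add: is_ext_def)
      then show "AE d in N. b x (sY c (h d)) = app (\<lambda>a. b x (sY c (f a))) d"
        using app_scale[OF mb, of c x] unfolding scale_right by eventually_elim simp
    qed
    then have "W (ae_class M (\<lambda>a. sY c (f a))) = ae_class N (\<lambda>d. sY c (h d))"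
      by (rule W_class[OF D.vmem_scale[OF Y.scaling_axioms f(1)]])
    then show ?thesis unfolding f(5) R.valued_vscale[OF f(4)] unfolding f(2) D.valued_vscale[OF f(1)] .
  qed
  have add: "W (vadd (valued M E sY) u v) = vadd (valued N H sY) (W u) (W v)"
    if u: "u \<in> vcarrier (valued M E sY)" and v: "v \<in> vcarrier (valued M E sY)" for u v
  proof -
    obtain f h where f: "D.vmem f" "u = ae_class M f" "is_ext b f h" "R.vmem h" "W u = ae_class N h"
      by (rule W_cases[OF u])
    have mb: "D.mem (\<lambda>a. b x (f a))" for x by (rule D.mem_pairing[OF pairing_axioms f(1)])
    obtain g k where g: "D.vmem g" "v = ae_class M g" "is_ext b g k" "R.vmem k" "W v = ae_class N k"
      by (rule W_cases[OF v])
    have mg: "D.mem (\<lambda>a. b x (g a))" for x by (rule D.mem_pairing[OF pairing_axioms g(1)])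
    have "is_ext b (\<lambda>a. f a + g a) (\<lambda>c. h c + k c)"
      unfolding is_ext_def
    proof (intro conjI allI R.vmem_add f(4) g(4))
      fix x
      have "AE c in N. b x (h c) = app (\<lambda>a. b x (f a)) c" "AE c in N. b x (k c) = app (\<lambda>a. b x (g a)) c"
        using f(3) g(3) by (simp_all add: is_ext_def)
      then show "AE c in N. b x (h c + k c) = app (\<lambda>a. b x (f a + g a)) c"
        using app_add[OF mb mg, of x x] unfolding add_right by eventually_elim simp
    qed
    then have "W (ae_class M (\<lambda>a. f a + g a)) = ae_class N (\<lambda>c. h c + k c)"
      by (rule W_class[OF D.vmem_add[OF f(1) g(1)]])
    then show "W (vadd (valued M E sY) u v) = vadd (valued N H sY) (W u) (W v)"
      unfolding f(5) g(5) R.valued_vadd[OF f(4) g(4)] unfolding f(2) g(2) D.valued_vadd[OF f(1) g(1)] .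
  qed
  have "W \<in> extensional (vcarrier (valued M E sY))" by (simp add: valued_ext_def)
  then show ?thesis using ran scale add by (simp add: linear_ops_def PiE_def)
qed

lemma W_tensor:
  assumes e: "e \<in> vcarrier E" shows "W (elem_tensor M sY e y) = elem_tensor N sY (U e) y"
proof -
  obtain f where f: "D.mem f" "e = ae_class M f" by (rule D.carrier_cases[OF e])
  have "is_ext b (\<lambda>a. sY (f a) y) (\<lambda>c. sY (app f c) y)"
    unfolding is_ext_def
  proof (intro conjI allI R.vmem_tensor[OF Y.scaling_axioms app_mem[OF f(1)]])
    show "AE c in N. b x (sY (app f c) y) = app (\<lambda>a. b x (sY (f a) y)) c" for x
      unfolding scale_right using app_scale[OF f(1), of "b x y"] by eventually_elim (simp add: mult.commute)
  qed
  then have "W (ae_class M (\<lambda>a. sY (f a) y)) = ae_class N (\<lambda>c. sY (app f c) y)"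
    by (rule W_class[OF D.vmem_tensor[OF Y.scaling_axioms f(1)]])
  then show ?thesis
    using f by (simp add: D.elem_tensor_class R.elem_tensor_class U_class app_mem)
qed

lemma W_norm_le:
  assumes Q: "Q \<in> positive_ops M N E H" "dominates M N E Q U" and e: "e \<in> vcarrier (valued M E sY)"
  shows "vnorm (valued N H sY) (W e) \<le> vnorm H (Q (L0_norm M e))"
    and "L0_norm M e \<in> vcarrier E" "vnorm E (L0_norm M e) = vnorm (valued M E sY) e"
proof -
  interpret Q: positive_op M E N H Q by (rule positive_op_intro[OF lattice_op_axioms Q(1)])
  obtain f h where f: "D.vmem f" "e = ae_class M f" "is_ext b f h" "R.vmem h" "W e = ae_class N h"
    by (rule W_cases[OF e])
  have n: "L0_norm M e = ae_class M (\<lambda>a. of_real (norm (f a)))"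
    using f(1) by (simp add: f(2) L0_norm_ae_class D.vmem_measurable)
  have m: "D.mem (\<lambda>a. of_real (norm (f a)))" by (rule D.vmem_norm[OF f(1)])
  have "vnorm (valued N H sY) (W e) = R.vfnorm h" by (simp add: f(5) R.valued_vfnorm f(4))
  also have "\<dots> \<le> R.fnorm (Q.app (\<lambda>a. of_real (norm (f a))))"
    by (rule R.vfnorm_le[OF f(4) Q.app_mem[OF m] is_ext_dominated[OF f(1,3) Q]])
  also have "\<dots> = vnorm H (Q (L0_norm M e))" unfolding n Q.U_class[OF m] R.fnorm_def ..
  finally show "vnorm (valued N H sY) (W e) \<le> vnorm H (Q (L0_norm M e))" .
  show "L0_norm M e \<in> vcarrier E" unfolding n by (rule D.mem_carrier[OF m])
  show "vnorm E (L0_norm M e) = vnorm (valued M E sY) e"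
    unfolding n using D.valued_norm[OF f(1), of sY] by (simp add: f(2) D.fnorm_def)
qed

lemma W_bounded: "W \<in> bounded_ops (valued M E sY) (valued N H sY)"
proof -
  obtain Q where Q: "Q \<in> positive_ops M N E H" "dominates M N E Q U"
    using dominated by (auto simp: dominated_ops_def)
  obtain C where C: "\<And>v. v \<in> vcarrier E \<Longrightarrow> vnorm H (Q v) \<le> C * vnorm E v"
    using Q(1) by (auto simp: positive_ops_def bounded_ops_def)
  have "vnorm (valued N H sY) (W e) \<le> C * vnorm (valued M E sY) e" if "e \<in> vcarrier (valued M E sY)" for e
    using W_norm_le[OF Q that] C[of "L0_norm M e"] by simp
  then show ?thesis using W_linear by (auto simp: bounded_ops_def)
qed

text \<open>The subspace \<open>V\<close> makes the bound applicable both to the extension of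
  \<open>T\<close>, on the whole space of vector-valued functions, and to that of \<open>S\<close>,
  on a closed tensor product. The bound holds for each dominating operator, hence for the infimum of
  their norms.\<close>

lemma W_op_norm_le:
  assumes V: "vcarrier V \<subseteq> vcarrier (valued M E sY)" "vnorm V = vnorm (valued M E sY)"
      "ae_class M (\<lambda>_. 0) \<in> vcarrier V" "\<And>e. e \<in> vcarrier V \<Longrightarrow> W' e = W e"
  shows "op_norm V (valued N H sY) W' \<le> dominated_norm M N E H U"
proof -
  have zero: "ae_class M (\<lambda>_. 0) \<in> {v \<in> vcarrier V. vnorm V v \<le> 1}"
    using V(3) D.valued_vfnorm[OF D.vmem_zero, of sY] D.fnorm_zero by (simp add: V(2) D.vfnorm_def)
  obtain Q0 where Q0: "Q0 \<in> positive_ops M N E H" "dominates M N E Q0 U"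
    using dominated by (auto simp: dominated_ops_def)
  have "op_norm V (valued N H sY) W' \<le> op_norm E H Q"
    if Q: "Q \<in> positive_ops M N E H" "dominates M N E Q U" for Q
    unfolding op_norm_def[of V]
  proof (rule cSUP_least)
    show "{v \<in> vcarrier V. vnorm V v \<le> 1} \<noteq> {}" using zero by blast
    fix v assume v: "v \<in> {v \<in> vcarrier V. vnorm V v \<le> 1}"
    then have vE: "v \<in> vcarrier (valued M E sY)" using V(1) by blast
    have "vnorm (valued N H sY) (W' v) \<le> vnorm H (Q (L0_norm M v))"
      using W_norm_le(1)[OF Q vE] V(4) v by simp
    also have "\<dots> \<le> op_norm E H Q"
    proof (rule op_norm_bounds)
      show "Q \<in> bounded_ops E H" using Q(1) by (simp add: positive_ops_def)
      show "vnorm E (L0_norm M v) \<le> 1" using W_norm_le(3)[OF Q vE] v V(2) by simp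
      show "0 \<le> vnorm E u" if "u \<in> vcarrier E" for u
        using D.fnorm_nonneg[OF D.mem_rep[OF that]] D.ae_class_rep[OF that] by (simp add: D.fnorm_def)
    qed (rule W_norm_le(2)[OF Q vE])
    finally show "vnorm (valued N H sY) (W' v) \<le> op_norm E H Q" .
  qed
  then show ?thesis unfolding dominated_norm_def using Q0 by (intro cInf_greatest) auto
qed

lemma W_extends: "extends_tensor_id M N E H sY U W"
  unfolding extends_tensor_id_def using tensor_id_eq[OF Y.scaling_axioms W_linear W_tensor] by auto

lemma W_valued_extension: "is_valued_extension M N E H sY b U W"
  unfolding is_valued_extension_def
proof (intro conjI W_bounded ballI allI)
  fix e and x assume e: "e \<in> vcarrier (valued M E sY)"
  obtain f h where f: "D.vmem f" "e = ae_class M f" "is_ext b f h" "R.vmem h" "W e = ae_class N h"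
    by (rule W_cases[OF e])
  have "ae_class N (\<lambda>c. b x (rep (W e) c)) = ae_class N (\<lambda>c. b x (h c))"
    unfolding f(5) using R.valued_rep_class[OF f(4)] by (intro ae_class_cong) (auto elim: AE_mp)
  also have "\<dots> = ae_class N (app (\<lambda>a. b x (f a)))" using f(3) by (intro ae_class_cong) (simp add: is_ext_def)
  also have "\<dots> = U (ae_class M (\<lambda>a. b x (f a)))" by (rule U_class[symmetric, OF D.mem_pairing[OF pairing_axioms f(1)]])
  also have "ae_class M (\<lambda>a. b x (f a)) = ae_class M (\<lambda>a. b x (rep e a))"
    unfolding f(2) using D.valued_rep_class[OF f(1)] by (intro ae_class_cong) (auto elim: AE_mp)
  finally show "ae_class N (\<lambda>c. b x (rep (W e) c)) = U (ae_class M (\<lambda>a. b x (rep e a)))" .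
qed

end


section \<open>Regular operators\<close>

locale lattice_pair = D: function_lattice M E + R: function_lattice N H
  for M :: "'a measure" and E :: "('k::real_or_complex, ('a \<Rightarrow> 'k) set) nspace"
    and N :: "'b measure" and H :: "('k, ('b \<Rightarrow> 'k) set) nspace"
begin

text \<open>The map \<open>p\<close> is evaluated at the chosen representative; the last clause of
  \<open>linear_on_functions\<close> makes any other representative do, see
  \<open>lift_op_class\<close>.\<close>

definition lift_op :: "(('a \<Rightarrow> 'k) \<Rightarrow> 'b \<Rightarrow> 'k) \<Rightarrow> ('a \<Rightarrow> 'k) set \<Rightarrow> ('b \<Rightarrow> 'k) set" where
  "lift_op p = (\<lambda>c\<in>vcarrier E. ae_class N (p (rep c)))"

definition linear_on_functions :: "(('a \<Rightarrow> 'k) \<Rightarrow> 'b \<Rightarrow> 'k) \<Rightarrow> bool" where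
  "linear_on_functions p \<longleftrightarrow> (\<forall>f. D.mem f \<longrightarrow> R.mem (p f)) \<and>
    (\<forall>f g. D.mem f \<longrightarrow> D.mem g \<longrightarrow> (AE c in N. p (\<lambda>a. f a + g a) c = p f c + p g c)) \<and>
    (\<forall>f k. D.mem f \<longrightarrow> (AE c in N. p (\<lambda>a. k * f a) c = k * p f c)) \<and>
    (\<forall>f g. D.mem f \<longrightarrow> D.mem g \<longrightarrow> (AE a in M. f a = g a) \<longrightarrow> (AE c in N. p f c = p g c))"

lemma lift_op_class:
  assumes p: "linear_on_functions p" and f: "D.mem f"
  shows "lift_op p (ae_class M f) = ae_class N (p f)"
proof -
  have "AE c in N. p (rep (ae_class M f)) c = p f c"
    using p D.mem_rep[OF D.mem_carrier[OF f]] f D.rep_class[OF f] by (simp add: linear_on_functions_def)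
  then show ?thesis using D.mem_carrier[OF f] by (simp add: lift_op_def ae_class_cong)
qed

lemma lift_op_lattice_op:
  assumes p: "linear_on_functions p" shows "lattice_op M E N H (lift_op p)"
proof
  have mem: "R.mem (p f)" if "D.mem f" for f using p that by (simp add: linear_on_functions_def)
  have add: "lift_op p (vadd E u v) = vadd H (lift_op p u) (lift_op p v)" if uv: "u \<in> vcarrier E" "v \<in> vcarrier E" for u v
  proof -
    obtain f where f: "D.mem f" "u = ae_class M f" by (rule D.carrier_cases[OF uv(1)])
    obtain g where g: "D.mem g" "v = ae_class M g" by (rule D.carrier_cases[OF uv(2)])
    have "AE c in N. p (\<lambda>a. f a + g a) c = p f c + p g c" using p f g by (simp add: linear_on_functions_def)
    then show ?thesis using f g
      by (simp add: D.vadd_class lift_op_class[OF p] D.mem_add R.vadd_class mem ae_class_cong)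
  qed
  have scale: "lift_op p (vscale E k u) = vscale H k (lift_op p u)" if u: "u \<in> vcarrier E" for u k
  proof -
    obtain f where f: "D.mem f" "u = ae_class M f" by (rule D.carrier_cases[OF u])
    have "AE c in N. p (\<lambda>a. k * f a) c = k * p f c" using p f by (simp add: linear_on_functions_def)
    then show ?thesis using f
      by (simp add: D.vscale_class lift_op_class[OF p] D.mem_scale R.vscale_class mem ae_class_cong)
  qed
  have "lift_op p \<in> vcarrier E \<rightarrow>\<^sub>E vcarrier H"
    using mem D.mem_rep R.mem_carrier by (auto simp: lift_op_def)
  then show "lift_op p \<in> linear_ops E H" using add scale by (simp add: linear_ops_def)
qed

lemma lift_op_app:
  assumes p: "linear_on_functions p" and f: "D.mem f"
  shows "AE c in N. lattice_op.app M (lift_op p) f c = p f c"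
proof -
  interpret V: lattice_op M E N H "lift_op p" by (rule lift_op_lattice_op[OF p])
  have "R.mem (p f)" using p f by (simp add: linear_on_functions_def)
  then show ?thesis unfolding V.app_def lift_op_class[OF assms] by (rule R.rep_class)
qed

lemma bounded_opsI:
  assumes "lattice_op M E N H U" "\<And>f. D.mem f \<Longrightarrow> R.fnorm (lattice_op.app M U f) \<le> C * D.fnorm f"
  shows "U \<in> bounded_ops E H"
proof -
  interpret U: lattice_op M E N H U by (rule assms)
  have "vnorm H (U u) \<le> C * vnorm E u" if u: "u \<in> vcarrier E" for u
  proof -
    obtain f where f: "D.mem f" "u = ae_class M f" by (rule D.carrier_cases[OF u])
    show ?thesis using assms(2)[OF f(1)] by (simp add: f(2) U.U_class f(1) D.fnorm_def R.fnorm_def)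
  qed
  then show ?thesis using U.linear by (auto simp: bounded_ops_def)
qed

lemma bounded_opsD:
  assumes "U \<in> bounded_ops E H"
  obtains C where "C \<ge> 0" "\<And>f. D.mem f \<Longrightarrow> R.fnorm (lattice_op.app M U f) \<le> C * D.fnorm f"
proof -
  interpret U: lattice_op M E N H U using assms by unfold_locales (simp add: bounded_ops_def)
  obtain C where C: "\<And>v. v \<in> vcarrier E \<Longrightarrow> vnorm H (U v) \<le> C * vnorm E v"
    using assms by (auto simp: bounded_ops_def)
  have "R.fnorm (U.app f) \<le> \<bar>C\<bar> * D.fnorm f" if f: "D.mem f" for f
  proof -
    have "R.fnorm (U.app f) \<le> C * D.fnorm f"
      using C[OF D.mem_carrier[OF f]] by (simp add: U.U_class f D.fnorm_def R.fnorm_def)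
    also have "\<dots> \<le> \<bar>C\<bar> * D.fnorm f" by (intro mult_right_mono D.fnorm_nonneg f) simp
    finally show ?thesis .
  qed
  then show ?thesis by (intro that[of "\<bar>C\<bar>"]) auto
qed

lemma positive_opI:
  assumes "U \<in> bounded_ops E H"
    and pos: "\<And>f. D.mem f \<Longrightarrow> AE a in M. f a \<in> \<real>\<^sub>\<ge>\<^sub>0 \<Longrightarrow> AE c in N. lattice_op.app M U f c \<in> \<real>\<^sub>\<ge>\<^sub>0"
  shows "positive_op M E N H U"
proof -
  interpret U: lattice_op M E N H U using assms(1) by unfold_locales (simp add: bounded_ops_def)
  have "L0_le N (vzero H) (U e)" if e: "e \<in> vcarrier E" and le: "L0_le M (vzero E) e" for e
  proof -
    obtain f where f: "D.mem f" "e = ae_class M f" by (rule D.carrier_cases[OF e])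
    have "AE a in M. f a \<in> \<real>\<^sub>\<ge>\<^sub>0"
      using le D.rep_class[OF f(1)] D.rep_class[OF D.mem_zero]
      unfolding L0_le_def f(2) D.vzero_class by eventually_elim simp
    then show ?thesis using pos[OF f(1)] R.rep_class[OF R.mem_zero]
      unfolding L0_le_def f(2) R.vzero_class U.app_def[symmetric] by (auto elim: AE_mp)
  qed
  then show ?thesis using assms(1) by unfold_locales (auto simp: positive_ops_def)
qed

lemma dominatesI:
  assumes "lattice_op M E N H U" "positive_op M E N H Q"
    and "\<And>f. D.mem f \<Longrightarrow> AE c in N. norm (lattice_op.app M U f c) \<le> norm (lattice_op.app M Q (\<lambda>a. of_real (norm (f a))) c)"
  shows "dominates M N E Q U"
proof -
  interpret Q: positive_op M E N H Q by (rule assms(2))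
  show ?thesis unfolding dominates_iff[OF assms(1) Q.lattice_op_axioms]
  proof (intro allI impI)
    fix f assume f: "D.mem f"
    have "AE c in N. Q.app (\<lambda>a. of_real (norm (f a))) c \<in> \<real>\<^sub>\<ge>\<^sub>0"
      by (rule Q.app_nonneg[OF D.mem_norm[OF f]]) simp
    then show "AE c in N. Q.app (\<lambda>a. of_real (norm (f a))) c - of_real (norm (lattice_op.app M U f c)) \<in> \<real>\<^sub>\<ge>\<^sub>0"
      using assms(3)[OF f]
    proof eventually_elim
      case (elim c)
      have "Q.app (\<lambda>a. of_real (norm (f a))) c - of_real (norm (lattice_op.app M U f c))
          = of_real (norm (Q.app (\<lambda>a. of_real (norm (f a))) c) - norm (lattice_op.app M U f c))"
        using nonneg_Reals_of_real[OF elim(1)] by simp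
      then show ?case using elim(2) by (simp del: of_real_diff)
    qed
  qed
qed

text \<open>This is exactly the form of a step of \<open>vspan\<close>, so inductions over
  \<open>regular_ops\<close> produce it directly.\<close>

abbreviation comb where
  "comb k V V' \<equiv> vadd (op_space E H) (vscale (op_space E H) k V) V'"

lemma comb_eq:
  assumes "lattice_op M E N H V" "lattice_op M E N H V'"
  shows "comb k V V' = lift_op (\<lambda>f c. k * lattice_op.app M V f c + lattice_op.app M V' f c)"
    and "linear_on_functions (\<lambda>f c. k * lattice_op.app M V f c + lattice_op.app M V' f c)"
proof -
  interpret V: lattice_op M E N H V by (rule assms(1))
  interpret V': lattice_op M E N H V' by (rule assms(2))
  show "comb k V V' = lift_op (\<lambda>f c. k * V.app f c + V'.app f c)"
  proof
    fix u
    show "comb k V V' u = lift_op (\<lambda>f c. k * V.app f c + V'.app f c) u"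
    proof (cases "u \<in> vcarrier E")
      case True
      obtain f where f: "D.mem f" "u = ae_class M f" by (rule D.carrier_cases[OF True])
      have "comb k V V' u = ae_class N (\<lambda>c. k * V.app f c + V'.app f c)"
        using True f by (simp add: op_space_def V.U_class V'.U_class R.vscale_class R.vadd_class V.app_mem V'.app_mem R.mem_scale)
      also have "\<dots> = lift_op (\<lambda>f c. k * V.app f c + V'.app f c) u"
        using True D.mem_carrier[OF f(1)] V.app_cong[OF D.rep_class[OF f(1)]] V'.app_cong[OF D.rep_class[OF f(1)]]
        by (simp add: lift_op_def f(2))
      finally show ?thesis .
    qed (simp add: op_space_def lift_op_def)
  qed
  show "linear_on_functions (\<lambda>f c. k * V.app f c + V'.app f c)"
    unfolding linear_on_functions_def
  proof (intro conjI allI impI)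
    fix f g assume f: "D.mem f" and g: "D.mem g"
    show "AE c in N. k * V.app (\<lambda>a. f a + g a) c + V'.app (\<lambda>a. f a + g a) c
        = (k * V.app f c + V'.app f c) + (k * V.app g c + V'.app g c)"
      using V.app_add[OF f g] V'.app_add[OF f g] by eventually_elim (simp add: algebra_simps)
    assume "AE a in M. f a = g a"
    then show "AE c in N. k * V.app f c + V'.app f c = k * V.app g c + V'.app g c"
      using V.app_cong[of f g] V'.app_cong[of f g] by simp
  next
    fix f j assume f: "D.mem f"
    show "AE c in N. k * V.app (\<lambda>a. j * f a) c + V'.app (\<lambda>a. j * f a) c = j * (k * V.app f c + V'.app f c)"
      using V.app_scale[OF f, of j] V'.app_scale[OF f, of j] by eventually_elim (simp add: algebra_simps)
  qed (intro R.mem_add R.mem_scale V.app_mem V'.app_mem)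
qed

lemma comb_lattice_op:
  assumes "lattice_op M E N H V" "lattice_op M E N H V'" shows "lattice_op M E N H (comb k V V')"
  unfolding comb_eq(1)[OF assms] by (rule lift_op_lattice_op[OF comb_eq(2)[OF assms]])

lemma comb_app:
  assumes "lattice_op M E N H V" "lattice_op M E N H V'" "D.mem f"
  shows "AE c in N. lattice_op.app M (comb k V V') f c = k * lattice_op.app M V f c + lattice_op.app M V' f c"
  unfolding comb_eq(1)[OF assms(1,2)] by (rule lift_op_app[OF comb_eq(2)[OF assms(1,2)] assms(3)])

lemma comb_bounded:
  assumes "V \<in> bounded_ops E H" "V' \<in> bounded_ops E H" shows "comb k V V' \<in> bounded_ops E H"
proof -
  have l: "lattice_op M E N H V" "lattice_op M E N H V'"
    using assms by (unfold_locales, auto simp: bounded_ops_def)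
  interpret V: lattice_op M E N H V by (rule l)
  interpret V': lattice_op M E N H V' by (rule l)
  obtain C where C: "\<And>f. D.mem f \<Longrightarrow> R.fnorm (V.app f) \<le> C * D.fnorm f" by (rule bounded_opsD[OF assms(1)]) blast
  obtain C' where C': "\<And>f. D.mem f \<Longrightarrow> R.fnorm (V'.app f) \<le> C' * D.fnorm f" by (rule bounded_opsD[OF assms(2)]) blast
  show ?thesis
  proof (rule bounded_opsI[OF comb_lattice_op[OF l], where C="norm k * C + C'"])
    fix f assume f: "D.mem f"
    have "R.fnorm (lattice_op.app M (comb k V V') f) = R.fnorm (\<lambda>c. k * V.app f c + V'.app f c)"
      by (rule R.fnorm_cong[OF comb_app[OF l f]])
    also have "\<dots> \<le> norm k * R.fnorm (V.app f) + R.fnorm (V'.app f)"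
      using R.fnorm_triangle[OF R.mem_scale[OF V.app_mem[OF f]] V'.app_mem[OF f]] R.fnorm_scale[OF V.app_mem[OF f]] by simp
    also have "\<dots> \<le> norm k * (C * D.fnorm f) + C' * D.fnorm f"
      by (intro add_mono mult_left_mono C C' f) simp
    finally show "R.fnorm (lattice_op.app M (comb k V V') f) \<le> (norm k * C + C') * D.fnorm f"
      by (simp add: algebra_simps)
  qed
qed

definition zero_op where "zero_op = (\<lambda>v\<in>vcarrier E. vzero H)"

lemma zero_op_lattice_op: "lattice_op M E N H zero_op"
  and zero_op_app: "D.mem f \<Longrightarrow> AE c in N. lattice_op.app M zero_op f c = 0"
proof -
  have e: "zero_op = lift_op (\<lambda>f c. 0)" by (simp add: zero_op_def lift_op_def R.vzero_class)
  have p: "linear_on_functions (\<lambda>f c. 0)" by (simp add: linear_on_functions_def R.mem_zero)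
  show "lattice_op M E N H zero_op" unfolding e by (rule lift_op_lattice_op[OF p])
  show "AE c in N. lattice_op.app M zero_op f c = 0" if "D.mem f" unfolding e by (rule lift_op_app[OF p that])
qed

lemma positive_comb:
  assumes "positive_op M E N H V" "positive_op M E N H V'" "r \<ge> 0"
  shows "positive_op M E N H (comb (of_real r) V V')"
proof -
  interpret V: positive_op M E N H V by (rule assms)
  interpret V': positive_op M E N H V' by (rule assms)
  show ?thesis
  proof (rule positive_opI[OF comb_bounded])
    show "V \<in> bounded_ops E H" "V' \<in> bounded_ops E H" using V.positive V'.positive by (auto simp: positive_ops_def)
    fix f assume f: "D.mem f" "AE a in M. f a \<in> \<real>\<^sub>\<ge>\<^sub>0"
    show "AE c in N. lattice_op.app M (comb (of_real r) V V') f c \<in> \<real>\<^sub>\<ge>\<^sub>0"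
      using comb_app[OF V.lattice_op_axioms V'.lattice_op_axioms f(1), of "of_real r"] V.app_nonneg[OF f] V'.app_nonneg[OF f]
      by eventually_elim (auto simp: assms(3) intro!: nonneg_Reals_add_I nonneg_Reals_mult_I)
  qed
qed

lemma positive_zero: "positive_op M E N H zero_op"
proof (rule positive_opI)
  have "R.fnorm (lattice_op.app M zero_op f) \<le> 0 * D.fnorm f" if f: "D.mem f" for f
    using R.fnorm_cong[OF zero_op_app[OF f]] R.fnorm_zero by simp
  then show "zero_op \<in> bounded_ops E H" by (rule bounded_opsI[OF zero_op_lattice_op])
  fix f assume f: "D.mem f"
  show "AE c in N. lattice_op.app M zero_op f c \<in> \<real>\<^sub>\<ge>\<^sub>0" using zero_op_app[OF f] by eventually_elim simp
qed

end

section \<open>Positive parts and extension from the positive cone\<close>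

definition pos :: "('a \<Rightarrow> real) \<Rightarrow> 'a \<Rightarrow> real" where "pos u a = max (u a) 0"

context function_lattice begin

abbreviation rmem where "rmem u \<equiv> mem (\<lambda>a. of_real (u a))"

lemma rmem_measurable: "rmem u \<Longrightarrow> u \<in> borel_measurable M"
  using measurable_compose[OF mem_measurable borel_measurable_parts(1), of "\<lambda>a. of_real (u a)"] by (simp add: part_simps)

lemma rmem_add: "rmem u \<Longrightarrow> rmem v \<Longrightarrow> rmem (\<lambda>a. u a + v a)"
  using mem_add[of "\<lambda>a. of_real (u a)" "\<lambda>a. of_real (v a)"] by simp

lemma rmem_scale: "rmem u \<Longrightarrow> rmem (\<lambda>a. r * u a)"
  using mem_scale[of "\<lambda>a. of_real (u a)" "of_real r"] by simp

lemma rmem_minus: "rmem u \<Longrightarrow> rmem (\<lambda>a. - u a)"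
  using rmem_scale[of u "-1"] by simp

lemma rmem_solid:
  assumes "mem g" "u \<in> borel_measurable M" "\<And>a. a \<in> space M \<Longrightarrow> \<bar>u a\<bar> \<le> norm (g a)" shows "rmem u"
  by (rule mem_solid[OF assms(1) measurable_compose[OF assms(2) of_real_measurable_scalar]]) (use assms(3) in auto)

lemma fnorm_solid:
  assumes "mem g" "u \<in> borel_measurable M" "\<And>a. a \<in> space M \<Longrightarrow> \<bar>u a\<bar> \<le> norm (g a)"
  shows "fnorm (\<lambda>a. of_real (u a)) \<le> fnorm g"
  by (rule fnorm_mono[OF assms(1) measurable_compose[OF assms(2) of_real_measurable_scalar]]) (use assms(3) in auto)

lemma rmem_parts: "mem f \<Longrightarrow> rmem (\<lambda>a. re_part (f a))" "mem f \<Longrightarrow> rmem (\<lambda>a. im_part (f a))"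
  by (rule rmem_solid, assumption, rule measurable_compose[OF mem_measurable], assumption,
      simp, rule abs_re_part_le abs_im_part_le)+

lemma rmem_pos: "rmem u \<Longrightarrow> rmem (pos u)"
proof (rule rmem_solid)
  assume "rmem u"
  then have [measurable]: "u \<in> borel_measurable M" by (rule rmem_measurable)
  show "pos u \<in> borel_measurable M" unfolding pos_def[abs_def] by measurable
qed (auto simp: pos_def)

end

context lattice_op begin

text \<open>Reduces statements about an operator to nonnegative real functions: operators that agree
  on these agree everywhere. Over the real field \<open>iunit\<close> removes the second
  line.\<close>

lemma app_split:
  assumes f: "D.mem f"
  shows "AE c in N. app f c =
    (app (\<lambda>a. of_real (pos (\<lambda>a. re_part (f a)) a)) c - app (\<lambda>a. of_real (pos (\<lambda>a. - re_part (f a)) a)) c) +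
    iunit * (app (\<lambda>a. of_real (pos (\<lambda>a. im_part (f a)) a)) c - app (\<lambda>a. of_real (pos (\<lambda>a. - im_part (f a)) a)) c)"
proof -
  let ?f1 = "\<lambda>a. of_real (pos (\<lambda>a. re_part (f a)) a) :: 'k" and ?f2 = "\<lambda>a. of_real (pos (\<lambda>a. - re_part (f a)) a) :: 'k"
    and ?f3 = "\<lambda>a. of_real (pos (\<lambda>a. im_part (f a)) a) :: 'k" and ?f4 = "\<lambda>a. of_real (pos (\<lambda>a. - im_part (f a)) a) :: 'k"
  have neg: "D.rmem (\<lambda>a. - re_part (f a))" "D.rmem (\<lambda>a. - im_part (f a))"
    by (intro D.rmem_minus D.rmem_parts f)+
  note m = D.rmem_pos[OF D.rmem_parts(1)[OF f]] D.rmem_pos[OF neg(1)] D.rmem_pos[OF D.rmem_parts(2)[OF f]] D.rmem_pos[OF neg(2)]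
  have eq: "f = (\<lambda>a. (?f1 a + (-1) * ?f2 a) + (iunit * ?f3 a + (- iunit) * ?f4 a))"
  proof
    fix a
    have "max r 0 - max (- r) 0 = r" for r :: real by (simp add: max_def)
    then have "of_real (re_part (f a)) = ?f1 a - ?f2 a" "of_real (im_part (f a)) = ?f3 a - ?f4 a"
      unfolding pos_def of_real_diff[symmetric] by simp_all
    then have "f a = (?f1 a - ?f2 a) + iunit * (?f3 a - ?f4 a)"
      using scalar_split[of "f a"] by metis
    also have "\<dots> = (?f1 a + (-1) * ?f2 a) + (iunit * ?f3 a + (- iunit) * ?f4 a)" by (simp add: algebra_simps)
    finally show "f a = (?f1 a + (-1) * ?f2 a) + (iunit * ?f3 a + (- iunit) * ?f4 a)" .
  qed
  have "AE c in N. app (\<lambda>a. (?f1 a + (-1) * ?f2 a) + (iunit * ?f3 a + (- iunit) * ?f4 a)) c =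
    (app ?f1 c - app ?f2 c) + iunit * (app ?f3 c - app ?f4 c)"
    using app_add[OF D.mem_add[OF m(1) D.mem_scale[OF m(2), of "-1"]] D.mem_add[OF D.mem_scale[OF m(3), of iunit] D.mem_scale[OF m(4), of "- iunit"]]]
      app_add[OF m(1) D.mem_scale[OF m(2), of "-1"]] app_add[OF D.mem_scale[OF m(3), of iunit] D.mem_scale[OF m(4), of "- iunit"]]
      app_scale[OF m(2), of "-1"] app_scale[OF m(3), of iunit] app_scale[OF m(4), of "- iunit"]
    by eventually_elim (simp add: algebra_simps)
  then show ?thesis using eq by metis
qed

end

text \<open>The constant 4 counts the positive parts in \<open>app_split\<close>, each of which lies
  below the norm of \<open>f\<close>. The bound serves the question whether a dominating operator
  exists, where its size does not matter.\<close>

lemma (in positive_op) self_dominated: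
  assumes f: "D.mem f"
  shows "AE c in N. norm (app f c) \<le> 4 * norm (app (\<lambda>a. of_real (norm (f a))) c)"
proof -
  note [measurable] = D.mem_measurable[OF f]
  have le: "AE c in N. norm (app (\<lambda>a. of_real (pos u a)) c) \<le> norm (app (\<lambda>a. of_real (norm (f a))) c)"
    if [measurable]: "u \<in> borel_measurable M" and u: "\<And>a. \<bar>u a\<bar> \<le> norm (f a)" for u
  proof (rule app_mono)
    show "D.rmem (pos u)" using u by (intro D.rmem_pos D.rmem_solid[OF f]) auto
    show "D.rmem (\<lambda>a. norm (f a))" by (rule D.mem_norm[OF f])
    show "AE a in M. pos u a \<le> norm (f a)" using u by (intro AE_I2) (simp add: pos_def abs_le_iff)
  qed (simp add: pos_def)
  have t: "norm (x1 - x2 + iunit * (x3 - x4)) \<le> norm x1 + norm x2 + norm x3 + norm x4" for x1 x2 x3 x4 :: 'k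
  proof -
    have "norm (x1 - x2 + iunit * (x3 - x4)) \<le> norm (x1 - x2) + norm (iunit :: 'k) * norm (x3 - x4)"
      by (metis norm_mult norm_triangle_ineq)
    also have "\<dots> \<le> (norm x1 + norm x2) + 1 * (norm x3 + norm x4)"
      using norm_iunit_le by (intro add_mono mult_mono norm_triangle_ineq4) auto
    finally show ?thesis by simp
  qed
  have m: "(\<lambda>a. re_part (f a)) \<in> borel_measurable M" "(\<lambda>a. - re_part (f a)) \<in> borel_measurable M"
    "(\<lambda>a. im_part (f a)) \<in> borel_measurable M" "(\<lambda>a. - im_part (f a)) \<in> borel_measurable M"
    by measurable
  show ?thesis
    using app_split[OF f] le[OF m(1) abs_re_part_le] le[OF m(2), unfolded abs_minus_cancel, OF abs_re_part_le]
      le[OF m(3) abs_im_part_le] le[OF m(4), unfolded abs_minus_cancel, OF abs_im_part_le]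
  proof eventually_elim
    case (elim c)
    show ?case unfolding elim(1) using elim(2-) by (intro order_trans[OF t]) linarith
  qed
qed

context lattice_pair begin

text \<open>Kantorovich's extension theorem, followed by complexification: \<open>K\<close> extends
  to real functions as the difference of its values at the positive and the negative part, and then
  to \<open>'k\<close> through \<open>re_part\<close> and \<open>im_part\<close>. Since
  \<open>K\<close> may involve choices, all its rules are assumed almost everywhere only.\<close>

lemma cone_extension:
  assumes mem: "\<And>u. D.rmem u \<Longrightarrow> (\<And>a. 0 \<le> u a) \<Longrightarrow> R.rmem (K u)"
    and nonneg: "\<And>u. D.rmem u \<Longrightarrow> (\<And>a. 0 \<le> u a) \<Longrightarrow> AE c in N. 0 \<le> K u c"
    and add: "\<And>u v. D.rmem u \<Longrightarrow> D.rmem v \<Longrightarrow> (\<And>a. 0 \<le> u a) \<Longrightarrow> (\<And>a. 0 \<le> v a) \<Longrightarrow>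
      AE c in N. K (\<lambda>a. u a + v a) c = K u c + K v c"
    and scale: "\<And>u r. D.rmem u \<Longrightarrow> (\<And>a. 0 \<le> u a) \<Longrightarrow> 0 < r \<Longrightarrow> AE c in N. K (\<lambda>a. r * u a) c = r * K u c"
    and cong: "\<And>u v. D.rmem u \<Longrightarrow> D.rmem v \<Longrightarrow> (\<And>a. 0 \<le> u a) \<Longrightarrow> (\<And>a. 0 \<le> v a) \<Longrightarrow>
      AE a in M. u a = v a \<Longrightarrow> AE c in N. K u c = K v c"
    and bound: "\<And>u. D.rmem u \<Longrightarrow> (\<And>a. 0 \<le> u a) \<Longrightarrow>
      R.fnorm (\<lambda>c. of_real (K u c)) \<le> C * D.fnorm (\<lambda>a. of_real (u a))"
  obtains P where "positive_op M E N H P"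
    "\<And>u. D.rmem u \<Longrightarrow> (\<And>a. 0 \<le> u a) \<Longrightarrow> AE c in N. lattice_op.app M P (\<lambda>a. of_real (u a)) c = of_real (K u c)"
proof -
  define L where "L u c = K (pos u) c - K (pos (\<lambda>a. - u a)) c" for u c
  have pn: "0 \<le> pos u a" for u :: "'a \<Rightarrow> real" and a by (simp add: pos_def)
  note neg = D.rmem_minus
  have K0: "AE c in N. K (\<lambda>_. 0) c = 0"
    using add[of "\<lambda>_. 0" "\<lambda>_. 0"] D.mem_zero by (auto elim: AE_mp)
  have Lpos: "AE c in N. L u c = K u c" if u: "D.rmem u" "\<And>a. 0 \<le> u a" for u
  proof -
    have "pos u = u" "pos (\<lambda>a. - u a) = (\<lambda>_. 0)" using u(2) by (auto simp: pos_def max_def intro!: ext antisym)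
    then show ?thesis using K0 unfolding L_def by (auto elim: AE_mp)
  qed
  have Lmem: "R.rmem (L u)" if u: "D.rmem u" for u
    using R.mem_diff[OF mem[OF D.rmem_pos[OF u] pn] mem[OF D.rmem_pos[OF neg[OF u]] pn]] by (simp add: L_def)
  have Lcong: "AE c in N. L u c = L v c" if u: "D.rmem u" and v: "D.rmem v" and uv: "AE a in M. u a = v a" for u v
  proof -
    have "AE c in N. K (pos u) c = K (pos v) c" "AE c in N. K (pos (\<lambda>a. - u a)) c = K (pos (\<lambda>a. - v a)) c"
      using uv by (intro cong pn D.rmem_pos neg u v; auto simp: pos_def elim: AE_mp)+
    then show ?thesis unfolding L_def by eventually_elim simp
  qed
  have Ladd: "AE c in N. L (\<lambda>a. u a + v a) c = L u c + L v c" if u: "D.rmem u" and v: "D.rmem v" for u v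
  proof -
    have uv: "D.rmem (\<lambda>a. u a + v a)" by (rule D.rmem_add[OF u v])
    \<comment> \<open>The lattice identity (u+v)^+ + u^- + v^- = (u+v)^- + u^+ + v^+ has nonnegative
      terms only, so additivity on the cone applies to both sides.\<close>
    have eq: "(\<lambda>a. (pos (\<lambda>a. u a + v a) a + pos (\<lambda>a. - u a) a) + pos (\<lambda>a. - v a) a)
        = (\<lambda>a. (pos (\<lambda>a. - (u a + v a)) a + pos u a) + pos v a)"
      by (rule ext) (simp add: pos_def max_def)
    note m = D.rmem_pos[OF uv] D.rmem_pos[OF neg[OF u]] D.rmem_pos[OF neg[OF v]]
      D.rmem_pos[OF neg[OF uv]] D.rmem_pos[OF u] D.rmem_pos[OF v]
    have 1: "AE c in N. K (\<lambda>a. (pos (\<lambda>a. u a + v a) a + pos (\<lambda>a. - u a) a) + pos (\<lambda>a. - v a) a) c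
        = K (pos (\<lambda>a. u a + v a)) c + K (pos (\<lambda>a. - u a)) c + K (pos (\<lambda>a. - v a)) c"
      using add[OF D.rmem_add[OF m(1,2)] m(3) add_nonneg_nonneg[OF pn pn] pn] add[OF m(1,2) pn pn]
      by eventually_elim simp
    have 2: "AE c in N. K (\<lambda>a. (pos (\<lambda>a. - (u a + v a)) a + pos u a) + pos v a) c
        = K (pos (\<lambda>a. - (u a + v a))) c + K (pos u) c + K (pos v) c"
      using add[OF D.rmem_add[OF m(4,5)] m(6) add_nonneg_nonneg[OF pn pn] pn] add[OF m(4,5) pn pn]
      by eventually_elim simp
    show ?thesis using 1 2 unfolding L_def eq by eventually_elim linarith
  qed
  have Lscale: "AE c in N. L (\<lambda>a. r * u a) c = r * L u c" if u: "D.rmem u" for u r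
  proof -
    consider "r = 0" | "r > 0" | "r < 0" by linarith
    then show ?thesis
    proof cases
      case 1
      then show ?thesis using Lpos[OF D.rmem_scale[OF u, of 0]] K0 by (auto elim: AE_mp)
    next
      case 2
      have "pos (\<lambda>a. r * u a) = (\<lambda>a. r * pos u a)" "pos (\<lambda>a. - (r * u a)) = (\<lambda>a. r * pos (\<lambda>a. - u a) a)"
        using 2 by (auto simp: pos_def max_def mult_le_0_iff zero_le_mult_iff)
      then show ?thesis
        using scale[OF D.rmem_pos[OF u] pn 2] scale[OF D.rmem_pos[OF neg[OF u]] pn 2] unfolding L_def
        by (auto simp: algebra_simps elim: AE_mp)
    next
      case 3
      have "pos (\<lambda>a. r * u a) = (\<lambda>a. (- r) * pos (\<lambda>a. - u a) a)" "pos (\<lambda>a. - (r * u a)) = (\<lambda>a. (- r) * pos u a)"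
        using 3 by (auto simp: pos_def max_def mult_le_0_iff zero_le_mult_iff)
      moreover have r: "- r > 0" using 3 by simp
      ultimately show ?thesis
        using scale[OF D.rmem_pos[OF u] pn r] scale[OF D.rmem_pos[OF neg[OF u]] pn r] unfolding L_def
        by (auto simp: algebra_simps elim: AE_mp)
    qed
  qed
  define p where "p f c = (of_real (L (\<lambda>a. re_part (f a)) c) + iunit * of_real (L (\<lambda>a. im_part (f a)) c) :: 'k)" for f :: "'a \<Rightarrow> 'k" and c
  note parts = D.rmem_parts
  have p: "linear_on_functions p"
    unfolding linear_on_functions_def
  proof (intro conjI allI impI)
    fix f assume f: "D.mem f"
    show "R.mem (p f)" unfolding p_def by (intro R.mem_add R.mem_scale Lmem parts f)
    fix k
    show "AE c in N. p (\<lambda>a. k * f a) c = k * p f c"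
    proof -
      let ?re = "\<lambda>a. re_part (f a)" and ?im = "\<lambda>a. im_part (f a)"
      have 1: "AE c in N. L (\<lambda>a. re_part k * ?re a + - im_part k * ?im a) c = re_part k * L ?re c - im_part k * L ?im c"
        using Ladd[OF D.rmem_scale[OF parts(1)[OF f], of "re_part k"] D.rmem_scale[OF parts(2)[OF f], of "- im_part k"]]
          Lscale[OF parts(1)[OF f], of "re_part k"] Lscale[OF parts(2)[OF f], of "- im_part k"]
        by eventually_elim simp
      have 2: "AE c in N. L (\<lambda>a. re_part k * ?im a + im_part k * ?re a) c = re_part k * L ?im c + im_part k * L ?re c"
        using Ladd[OF D.rmem_scale[OF parts(2)[OF f], of "re_part k"] D.rmem_scale[OF parts(1)[OF f], of "im_part k"]]
          Lscale[OF parts(2)[OF f], of "re_part k"] Lscale[OF parts(1)[OF f], of "im_part k"]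
        by eventually_elim simp
      \<comment> \<open>Over the real field both sides vanish, because \<open>iunit\<close> and
        \<open>im_part k\<close> are 0.\<close>
      have i: "iunit * (iunit * of_real (im_part k)) = (- of_real (im_part k) :: 'k)"
        using iunit_cases[where 'k='k] by (auto simp: mult.assoc[symmetric])
      have "of_real (re_part k * x - im_part k * y) + iunit * of_real (re_part k * y + im_part k * x)
          = (of_real (re_part k) + iunit * of_real (im_part k)) * (of_real x + iunit * of_real y :: 'k)" for x y
      proof -
        have "(of_real (re_part k) + iunit * of_real (im_part k)) * (of_real x + iunit * of_real y :: 'k)
          = of_real (re_part k) * of_real x + iunit * (of_real (re_part k) * of_real y + of_real (im_part k) * of_real x)
            + (iunit * (iunit * of_real (im_part k))) * of_real y" by (simp add: algebra_simps)
        then show ?thesis unfolding i by (simp add: algebra_simps)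
      qed
      then have alg: "of_real (re_part k * x - im_part k * y) + iunit * of_real (re_part k * y + im_part k * x)
          = k * (of_real x + iunit * of_real y :: 'k)" for x y using scalar_split[of k] by simp
      show ?thesis using 1 2 unfolding p_def part_simps
      proof eventually_elim
        case (elim c)
        then show ?case using alg[of "L ?re c" "L ?im c"] by simp
      qed
    qed
    fix g assume g: "D.mem g"
    show "AE c in N. p (\<lambda>a. f a + g a) c = p f c + p g c"
      using Ladd[OF parts(1)[OF f] parts(1)[OF g]] Ladd[OF parts(2)[OF f] parts(2)[OF g]]
      unfolding p_def part_simps by eventually_elim (simp add: algebra_simps)
    assume fg: "AE a in M. f a = g a"
    have "AE c in N. L (\<lambda>a. re_part (f a)) c = L (\<lambda>a. re_part (g a)) c"
      "AE c in N. L (\<lambda>a. im_part (f a)) c = L (\<lambda>a. im_part (g a)) c"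
      using fg by (intro Lcong parts f g; auto elim: AE_mp)+
    then show "AE c in N. p f c = p g c" unfolding p_def by eventually_elim simp
  qed
  have Lbound: "R.fnorm (\<lambda>c. of_real (L u c)) \<le> 2 * \<bar>C\<bar> * D.fnorm f"
    if f: "D.mem f" and u: "D.rmem u" "\<And>a. \<bar>u a\<bar> \<le> norm (f a)" for f u
  proof -
    have b: "R.fnorm (\<lambda>c. of_real (K (pos w) c)) \<le> \<bar>C\<bar> * D.fnorm f"
      if w: "D.rmem w" "\<And>a. \<bar>w a\<bar> \<le> norm (f a)" for w
    proof -
      have m: "D.fnorm (\<lambda>a. of_real (pos w a)) \<le> D.fnorm f"
        by (rule D.fnorm_solid[OF f D.rmem_measurable[OF D.rmem_pos[OF w(1)]]]) (use w(2) in \<open>auto simp: pos_def abs_le_iff\<close>)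
      have "R.fnorm (\<lambda>c. of_real (K (pos w) c)) \<le> C * D.fnorm (\<lambda>a. of_real (pos w a))"
        by (rule bound[OF D.rmem_pos[OF w(1)] pn])
      also have "\<dots> \<le> \<bar>C\<bar> * D.fnorm (\<lambda>a. of_real (pos w a))"
        by (intro mult_right_mono D.fnorm_nonneg D.rmem_pos w) simp
      also have "\<dots> \<le> \<bar>C\<bar> * D.fnorm f" using m by (intro mult_left_mono) auto
      finally show ?thesis .
    qed
    have 1: "R.rmem (K (pos u))" "R.rmem (K (pos (\<lambda>a. - u a)))"
      by (rule mem[OF D.rmem_pos[OF u(1)] pn], rule mem[OF D.rmem_pos[OF neg[OF u(1)]] pn])
    have "R.fnorm (\<lambda>c. of_real (L u c)) \<le> R.fnorm (\<lambda>c. of_real (K (pos u) c)) + R.fnorm (\<lambda>c. of_real (K (pos (\<lambda>a. - u a)) c))"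
      using R.fnorm_triangle[OF 1(1) R.mem_scale[OF 1(2), of "-1"]] R.fnorm_scale[OF 1(2), of "-1"] by (simp add: L_def)
    then show ?thesis using b[OF u] b[OF neg[OF u(1)]] u(2) by simp
  qed
  interpret P: lattice_op M E N H "lift_op p" by (rule lift_op_lattice_op[OF p])
  \<comment> \<open>\<open>Lbound\<close> contributes a factor 2 for the positive and negative part;
    the real and the imaginary part double it.\<close>
  have bd: "lift_op p \<in> bounded_ops E H"
  proof (rule bounded_opsI[OF P.lattice_op_axioms, where C="4 * \<bar>C\<bar>"])
    fix f assume f: "D.mem f"
    note l = Lmem[OF parts(1)[OF f]] Lmem[OF parts(2)[OF f]]
    have "R.fnorm (P.app f) = R.fnorm (p f)" by (rule R.fnorm_cong[OF lift_op_app[OF p f]])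
    also have "\<dots> \<le> R.fnorm (\<lambda>c. of_real (L (\<lambda>a. re_part (f a)) c)) + norm (iunit :: 'k) * R.fnorm (\<lambda>c. of_real (L (\<lambda>a. im_part (f a)) c))"
      using R.fnorm_triangle[OF l(1) R.mem_scale[OF l(2), of iunit]] R.fnorm_scale[OF l(2), of iunit]
      by (simp add: p_def[abs_def])
    also have "\<dots> \<le> 2 * \<bar>C\<bar> * D.fnorm f + 1 * (2 * \<bar>C\<bar> * D.fnorm f)"
      using R.fnorm_nonneg[OF l(2)]
      by (intro add_mono mult_mono Lbound f parts abs_re_part_le abs_im_part_le norm_iunit_le) auto
    finally show "R.fnorm (P.app f) \<le> 4 * \<bar>C\<bar> * D.fnorm f" by simp
  qed
  have cone: "AE c in N. P.app (\<lambda>a. of_real (u a)) c = of_real (K u c)" if u: "D.rmem u" "\<And>a. 0 \<le> u a" for u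
  proof -
    have z: "D.rmem (\<lambda>_. 0)" using D.mem_zero by simp
    show ?thesis using lift_op_app[OF p u(1)] Lpos[OF u] Lpos[OF z order_refl] K0
      unfolding p_def part_simps by eventually_elim simp
  qed
  have "positive_op M E N H (lift_op p)"
  proof (rule positive_opI[OF bd])
    fix f assume f: "D.mem f" "AE a in M. f a \<in> \<real>\<^sub>\<ge>\<^sub>0"
    have m: "D.rmem (\<lambda>a. norm (f a))" by (rule D.mem_norm[OF f(1)])
    have "AE a in M. f a = of_real (norm (f a))" using f(2) by eventually_elim (rule nonneg_Reals_of_real)
    then have eq: "P.app f = P.app (\<lambda>a. of_real (norm (f a)))" by (rule P.app_cong)
    show "AE c in N. P.app f c \<in> \<real>\<^sub>\<ge>\<^sub>0"
      unfolding eq using cone[OF m norm_ge_zero] nonneg[OF m norm_ge_zero] by eventually_elim simp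
  qed
  then show ?thesis using cone by (rule that)
qed

text \<open>On the cone |U u| \<le> Q u, hence P1 = Q + Re U and P2 = Q + Im U are positive there
  and extend to positive operators. Then U = P1 + i P2 - (1 + i) Q.\<close>

lemma dominated_imp_regular:
  assumes "U \<in> dominated_ops M N E H" shows "U \<in> regular_ops M N E H"
proof -
  obtain Q where Q: "Q \<in> positive_ops M N E H" "dominates M N E Q U" and U: "U \<in> linear_ops E H"
    using assms by (auto simp: dominated_ops_def)
  interpret U: lattice_op M E N H U by unfold_locales (rule U)
  interpret Q: positive_op M E N H Q by (rule positive_op_intro[OF U.lattice_op_axioms Q(1)])
  obtain C where C: "C \<ge> 0" "\<And>f. D.mem f \<Longrightarrow> R.fnorm (Q.app f) \<le> C * D.fnorm f"
    using Q(1) by (auto simp: positive_ops_def elim: bounded_opsD)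
  have dom: "AE c in N. norm (U.app (\<lambda>a. of_real (u a)) c) \<le> re_part (Q.app (\<lambda>a. of_real (u a)) c) \<and>
      of_real (re_part (Q.app (\<lambda>a. of_real (u a)) c)) = Q.app (\<lambda>a. of_real (u a)) c"
    if u: "D.rmem u" "\<And>a. 0 \<le> u a" for u
  proof -
    have "(\<lambda>a. of_real (norm (of_real (u a) :: 'k)) :: 'k) = (\<lambda>a. of_real (u a))" using u(2) by auto
    then have "AE c in N. Q.app (\<lambda>a. of_real (u a)) c = of_real (norm (Q.app (\<lambda>a. of_real (u a)) c)) \<and>
      norm (U.app (\<lambda>a. of_real (u a)) c) \<le> norm (Q.app (\<lambda>a. of_real (u a)) c)"
      using U.dominated_AE[OF Q u(1)] by simp
    then show ?thesis
    proof eventually_elim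
      case (elim c)
      then obtain r where "Q.app (\<lambda>a. of_real (u a)) c = of_real r" "r \<ge> 0" by (metis norm_ge_zero)
      then show ?case using elim by (simp add: part_simps)
    qed
  qed
  \<comment> \<open>One argument for both operators: \<open>part\<close> is \<open>re_part\<close>
    or \<open>im_part\<close>.\<close>
  have half: "\<exists>P. positive_op M E N H P \<and> (\<forall>u. D.rmem u \<longrightarrow> (\<forall>a. 0 \<le> u a) \<longrightarrow>
      (AE c in N. lattice_op.app M P (\<lambda>a. of_real (u a)) c =
        of_real (re_part (Q.app (\<lambda>a. of_real (u a)) c) + part (U.app (\<lambda>a. of_real (u a)) c))))"
    if part: "\<And>x y. part (x + y) = part x + part y" "\<And>r x. part (of_real r * x) = r * part x"
      "\<And>x. \<bar>part x\<bar> \<le> norm x" "\<And>f. R.mem f \<Longrightarrow> R.rmem (\<lambda>a. part (f a))" for part :: "'k \<Rightarrow> real"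
  proof -
    define K where "K u c = re_part (Q.app (\<lambda>a. of_real (u a)) c) + part (U.app (\<lambda>a. of_real (u a)) c)" for u c
    have KQ: "AE c in N. 0 \<le> K u c \<and> K u c \<le> 2 * norm (Q.app (\<lambda>a. of_real (u a)) c)"
      if u: "D.rmem u" "\<And>a. 0 \<le> u a" for u
      using dom[OF u]
    proof eventually_elim
      case (elim c)
      then show ?case using part(3)[of "U.app (\<lambda>a. of_real (u a)) c"] abs_re_part_le[of "Q.app (\<lambda>a. of_real (u a)) c"]
        unfolding K_def by linarith
    qed
    have Kmem: "R.rmem (K u)" if u: "D.rmem u" for u
      unfolding K_def by (intro R.rmem_add R.rmem_parts part(4) Q.app_mem U.app_mem u)
    obtain P where "positive_op M E N H P"
      "\<And>u. D.rmem u \<Longrightarrow> (\<And>a. 0 \<le> u a) \<Longrightarrow> AE c in N. lattice_op.app M P (\<lambda>a. of_real (u a)) c = of_real (K u c)"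
    proof (rule cone_extension[where K=K and C="2 * C"])
      fix u :: "'a \<Rightarrow> real" assume u: "D.rmem u" "\<And>a. 0 \<le> u a"
      show "AE c in N. 0 \<le> K u c" using KQ[OF u] by eventually_elim simp
      show "AE c in N. K (\<lambda>a. r * u a) c = r * K u c" for r
        using Q.app_scale[OF u(1), of "of_real r"] U.app_scale[OF u(1), of "of_real r"]
        unfolding K_def by eventually_elim (simp add: part part_simps algebra_simps)
      have "R.fnorm (\<lambda>c. of_real (K u c)) \<le> R.fnorm (\<lambda>c. of_real 2 * Q.app (\<lambda>a. of_real (u a)) c)"
        using KQ[OF u] by (intro R.fnorm_mono R.mem_scale Q.app_mem u R.mem_measurable Kmem)
          (auto elim!: AE_mp simp: norm_mult)
      also have "\<dots> = 2 * R.fnorm (Q.app (\<lambda>a. of_real (u a)))"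
        by (subst R.fnorm_scale[OF Q.app_mem[OF u(1)]]) simp
      also have "\<dots> \<le> 2 * (C * D.fnorm (\<lambda>a. of_real (u a)))" by (intro mult_left_mono C u) simp
      finally show "R.fnorm (\<lambda>c. of_real (K u c)) \<le> 2 * C * D.fnorm (\<lambda>a. of_real (u a))" by simp
      fix v assume v: "D.rmem v" "\<And>a. 0 \<le> v a"
      show "AE c in N. K (\<lambda>a. u a + v a) c = K u c + K v c"
        using Q.app_add[OF u(1) v(1)] U.app_add[OF u(1) v(1)]
        unfolding K_def by eventually_elim (simp add: part part_simps)
      assume "AE a in M. u a = v a"
      then have "AE a in M. (of_real (u a) :: 'k) = of_real (v a)" by eventually_elim simp
      then have "Q.app (\<lambda>a. of_real (u a)) = Q.app (\<lambda>a. of_real (v a))" "U.app (\<lambda>a. of_real (u a)) = U.app (\<lambda>a. of_real (v a))"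
        by (rule Q.app_cong, rule U.app_cong)
      then show "AE c in N. K u c = K v c" unfolding K_def by simp
    qed (erule Kmem, rule that, assumption, blast)
    then show ?thesis unfolding K_def by blast
  qed
  obtain P1 where P1: "positive_op M E N H P1" "\<And>u. D.rmem u \<Longrightarrow> (\<And>a. 0 \<le> u a) \<Longrightarrow>
      AE c in N. lattice_op.app M P1 (\<lambda>a. of_real (u a)) c =
        of_real (re_part (Q.app (\<lambda>a. of_real (u a)) c) + re_part (U.app (\<lambda>a. of_real (u a)) c))"
    using half[of re_part, OF part_simps(1) _ abs_re_part_le R.rmem_parts(1)] by (auto simp: part_simps)
  obtain P2 where P2: "positive_op M E N H P2" "\<And>u. D.rmem u \<Longrightarrow> (\<And>a. 0 \<le> u a) \<Longrightarrow>
      AE c in N. lattice_op.app M P2 (\<lambda>a. of_real (u a)) c =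
        of_real (re_part (Q.app (\<lambda>a. of_real (u a)) c) + im_part (U.app (\<lambda>a. of_real (u a)) c))"
    using half[of im_part, OF part_simps(2) _ abs_im_part_le R.rmem_parts(2)] by (auto simp: part_simps)
  interpret P1: positive_op M E N H P1 by (rule P1)
  interpret P2: positive_op M E N H P2 by (rule P2)
  \<comment> \<open>Over the real field \<open>iunit = 0\<close>, and the combination reduces to
    \<open>P1 - Q\<close>.\<close>
  let ?V2 = "comb iunit P2 zero_op" let ?V1 = "comb (- 1 - iunit) Q ?V2" let ?V = "comb 1 P1 ?V1"
  note l2 = comb_lattice_op[OF P2.lattice_op_axioms zero_op_lattice_op, of iunit]
  note l1 = comb_lattice_op[OF Q.lattice_op_axioms l2, of "- 1 - iunit"]
  interpret V: lattice_op M E N H ?V by (rule comb_lattice_op[OF P1.lattice_op_axioms l1])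
  have Vapp: "AE c in N. V.app f c = P1.app f c + ((- 1 - iunit) * Q.app f c + iunit * P2.app f c)" if f: "D.mem f" for f
    using comb_app[OF P1.lattice_op_axioms l1 f, of 1] comb_app[OF Q.lattice_op_axioms l2 f, of "- 1 - iunit"]
      comb_app[OF P2.lattice_op_axioms zero_op_lattice_op f, of iunit] zero_op_app[OF f] by eventually_elim simp
  have VU: "AE c in N. V.app (\<lambda>a. of_real (u a)) c = U.app (\<lambda>a. of_real (u a)) c"
    if u: "D.rmem u" "\<And>a. 0 \<le> u a" for u
    using Vapp[OF u(1)] P1(2)[OF u] P2(2)[OF u] dom[OF u]
  proof eventually_elim
    case (elim c)
    define q where "q = Q.app (\<lambda>a. of_real (u a)) c"
    define w where "w = U.app (\<lambda>a. of_real (u a)) c"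
    have "of_real (re_part q + re_part w) + ((- 1 - iunit) * q + iunit * of_real (re_part q + im_part w))
        = of_real (re_part w) + iunit * of_real (im_part w) + (1 + iunit) * (of_real (re_part q) - q)"
      by (simp add: algebra_simps)
    \<comment> \<open>On the cone \<open>q\<close> is real by \<open>dom\<close>, so the last
      summand vanishes; the rest is \<open>scalar_split\<close>.\<close>
    also have "\<dots> = w" using elim(4) scalar_split[of w] by (simp add: q_def)
    finally show ?case using elim(1-3) by (simp add: q_def w_def)
  qed
  have VUall: "AE c in N. V.app f c = U.app f c" if f: "D.mem f" for f
  proof -
    have neg: "D.rmem (\<lambda>a. - re_part (f a))" "D.rmem (\<lambda>a. - im_part (f a))"
      by (intro D.rmem_minus D.rmem_parts f)+
    have pn: "0 \<le> pos u a" for u :: "'a \<Rightarrow> real" and a by (simp add: pos_def)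
    show ?thesis
      using V.app_split[OF f] U.app_split[OF f] VU[OF D.rmem_pos[OF D.rmem_parts(1)[OF f]] pn] VU[OF D.rmem_pos[OF neg(1)] pn]
        VU[OF D.rmem_pos[OF D.rmem_parts(2)[OF f]] pn] VU[OF D.rmem_pos[OF neg(2)] pn]
      by eventually_elim simp
  qed
  have "?V = U"
  proof
    fix e
    show "?V e = U e"
    proof (cases "e \<in> vcarrier E")
      case True
      obtain f where f: "D.mem f" "e = ae_class M f" by (rule D.carrier_cases[OF True])
      show ?thesis unfolding f(2) V.U_class[OF f(1)] U.U_class[OF f(1)] by (rule ae_class_cong[OF VUall[OF f(1)]])
    next
      case False
      have "V \<in> extensional (vcarrier E)" if "V \<in> linear_ops E H" for V using that unfolding linear_ops_def PiE_def by blast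
      then show ?thesis using extensional_arb[OF _ False, of ?V] extensional_arb[OF _ False, of U] V.linear U.linear by presburger
    qed
  qed
  moreover have "?V \<in> vspan (op_space E H) (positive_ops M N E H)"
  proof -
    have z: "zero_op = vzero (op_space E H)" by (simp add: zero_op_def op_space_def)
    show ?thesis unfolding z by (intro vspan.intros P1.positive Q(1) P2.positive)
  qed
  ultimately show ?thesis by (simp add: regular_ops_def)
qed

text \<open>If \<open>Q\<close> dominates \<open>V\<close>, then \<open>4 * norm k\<close> times
  \<open>P\<close> plus \<open>Q\<close> dominates \<open>k * P + V\<close>, with the 4 of
  \<open>self_dominated\<close>.\<close>

lemma regular_imp_dominated:
  assumes "U \<in> regular_ops M N E H" shows "U \<in> dominated_ops M N E H"
  using assms unfolding regular_ops_def
proof (induction rule: vspan.induct)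
  case vspan_zero
  interpret Z: positive_op M E N H zero_op by (rule positive_zero)
  have "dominates M N E zero_op zero_op"
  proof (rule dominatesI[OF zero_op_lattice_op positive_zero])
    fix f assume f: "D.mem f"
    show "AE c in N. norm (Z.app f c) \<le> norm (Z.app (\<lambda>a. of_real (norm (f a))) c)"
      using zero_op_app[OF f] by eventually_elim simp
  qed
  moreover have "vzero (op_space E H) = zero_op" by (simp add: zero_op_def op_space_def)
  ultimately show ?case using Z.linear Z.positive by (auto simp: dominated_ops_def)
next
  case (vspan_step P V k)
  obtain Q where Q: "Q \<in> positive_ops M N E H" "dominates M N E Q V" and V: "V \<in> linear_ops E H"
    using vspan_step.IH by (auto simp: dominated_ops_def)
  interpret V: lattice_op M E N H V by unfold_locales (rule V)
  interpret Q: positive_op M E N H Q by (rule positive_op_intro[OF V.lattice_op_axioms Q(1)])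
  interpret P: positive_op M E N H P by (rule positive_op_intro[OF V.lattice_op_axioms vspan_step(1)])
  have r: "0 \<le> 4 * norm k" by simp
  interpret PQ: positive_op M E N H "comb (of_real (4 * norm k)) P Q"
    by (rule positive_comb[OF P.positive_op_axioms Q.positive_op_axioms r])
  note l = comb_lattice_op[OF P.lattice_op_axioms V.lattice_op_axioms, of k]
  have "dominates M N E (comb (of_real (4 * norm k)) P Q) (comb k P V)"
  proof (rule dominatesI[OF l PQ.positive_op_axioms])
    fix f assume f: "D.mem f"
    note n = D.mem_norm[OF f]
    have nn: "AE a in M. (of_real (norm (f a)) :: 'k) \<in> \<real>\<^sub>\<ge>\<^sub>0" by simp
    show "AE c in N. norm (lattice_op.app M (comb k P V) f c) \<le> norm (PQ.app (\<lambda>a. of_real (norm (f a))) c)"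
      using comb_app[OF P.lattice_op_axioms V.lattice_op_axioms f, of k]
        comb_app[OF P.lattice_op_axioms Q.lattice_op_axioms n, of "of_real (4 * norm k)"]
        P.self_dominated[OF f] V.dominated_AE[OF Q f] P.app_nonneg[OF n nn]
    proof eventually_elim
      case (elim c)
      define x y where "x = norm (P.app (\<lambda>a. of_real (norm (f a))) c)" and "y = norm (Q.app (\<lambda>a. of_real (norm (f a))) c)"
      have "norm (lattice_op.app M (comb k P V) f c) \<le> norm k * norm (P.app f c) + norm (V.app f c)"
        unfolding elim(1) by (metis norm_mult norm_triangle_ineq)
      also have "\<dots> \<le> norm k * (4 * x) + y" using elim(3,4) by (intro add_mono mult_left_mono) (auto simp: x_def y_def)
      also have "\<dots> = norm (of_real (4 * norm k * x + y) :: 'k)"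
        unfolding norm_of_real by (simp add: x_def y_def)
      also have "of_real (4 * norm k * x + y) = PQ.app (\<lambda>a. of_real (norm (f a))) c"
        using elim(2,4) nonneg_Reals_of_real[OF elim(5)] unfolding x_def y_def by simp
      finally show ?case .
    qed
  qed
  then show ?case using PQ.positive lattice_op.linear[OF l] by (auto simp: dominated_ops_def)
qed

lemma dominated_eq_regular: "dominated_ops M N E H = regular_ops M N E H"
  using dominated_imp_regular regular_imp_dominated by blast

end


section \<open>The modulus of an operator into \<open>L\<^sup>1\<close>\<close>

text \<open>An exhaustion argument: among the countable subfamilies one has a supremum
  \<open>h\<close> of largest integral. Enlarging it by a further member \<open>d\<close> cannot
  raise the integral, which is finite, so \<open>d\<close> lies below \<open>h\<close> almost
  everywhere. As a countable supremum, \<open>h\<close> is below every other upper bound.\<close>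

lemma ess_sup_of_family_exists:
  fixes \<Phi> :: "('a \<Rightarrow> ennreal) set"
  assumes meas: "\<And>d. d \<in> \<Phi> \<Longrightarrow> d \<in> borel_measurable M" and ne: "\<Phi> \<noteq> {}" and C: "C < \<infinity>"
    and bound: "\<And>s :: nat \<Rightarrow> 'a \<Rightarrow> ennreal. range s \<subseteq> \<Phi> \<Longrightarrow> (\<integral>\<^sup>+a. (SUP n. s n a) \<partial>M) \<le> C"
  obtains h where "h \<in> borel_measurable M" "(\<integral>\<^sup>+a. h a \<partial>M) \<le> C" "\<And>d. d \<in> \<Phi> \<Longrightarrow> AE a in M. d a \<le> h a"
    "\<And>g. (\<And>d. d \<in> \<Phi> \<Longrightarrow> AE a in M. d a \<le> g a) \<Longrightarrow> AE a in M. h a \<le> g a"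
proof -
  define I where "I s = (\<integral>\<^sup>+a. (SUP n. s n a) \<partial>M)" for s :: "nat \<Rightarrow> 'a \<Rightarrow> ennreal"
  let ?S = "{s. range s \<subseteq> \<Phi>}"
  have "?S \<noteq> {}"
  proof -
    obtain d where "d \<in> \<Phi>" using ne by blast
    then have "(\<lambda>_. d) \<in> ?S" by (simp add: image_subset_iff)
    then show ?thesis by (rule ex_in_conv[THEN iffD1, OF exI])
  qed
  then have "\<exists>F :: nat \<Rightarrow> ennreal. range F \<subseteq> I ` ?S \<and> Sup (I ` ?S) = Sup (range F)"
    by (rule ennreal_SUP_countable_SUP)
  then obtain F :: "nat \<Rightarrow> ennreal" where F: "range F \<subseteq> I ` ?S" "Sup (I ` ?S) = Sup (range F)"
    by (elim exE conjE)
  have "\<exists>s. range s \<subseteq> \<Phi> \<and> F k = I s" for k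
  proof -
    have "F k \<in> I ` ?S" using F(1) by (rule subsetD) simp
    then show ?thesis by auto
  qed
  then obtain s where s: "\<And>k. range (s k) \<subseteq> \<Phi>" "\<And>k. F k = I (s k)" by metis
  \<comment> \<open>Merges the countably many sequences that approach the supremum of the integrals
    into one, which attains it.\<close>
  define t where "t n = s (fst (prod_decode n)) (snd (prod_decode n))" for n
  have t: "range t \<subseteq> \<Phi>"
  proof (rule image_subsetI)
    show "t n \<in> \<Phi>" for n unfolding t_def by (rule subsetD[OF s(1)], rule rangeI)
  qed
  define h where "h a = (SUP n. t n a)" for a
  have tm[measurable]: "t n \<in> borel_measurable M" for n using t by (intro meas) (simp add: image_subset_iff)
  have hm[measurable]: "h \<in> borel_measurable M" unfolding h_def[abs_def] by measurable
  have It: "I t = (\<integral>\<^sup>+a. h a \<partial>M)" by (simp add: I_def h_def)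
  have "I (s k) \<le> I t" for k
    unfolding I_def
  proof (rule nn_integral_mono, rule SUP_least)
    fix a n
    show "s k n a \<le> (SUP n. t n a)"
      by (rule SUP_upper2[of "prod_encode (k, n)"]) (simp_all add: t_def)
  qed
  then have top: "I u \<le> I t" if "range u \<subseteq> \<Phi>" for u
  proof -
    have "I u \<le> Sup (I ` ?S)" using that by (intro SUP_upper) simp
    also have "\<dots> \<le> I t" unfolding F(2) by (rule SUP_least) (simp add: s(2) \<open>\<And>k. I (s k) \<le> I t\<close>)
    finally show ?thesis .
  qed
  have fin: "(\<integral>\<^sup>+a. h a \<partial>M) < \<infinity>" using bound[OF t] C by (simp add: h_def[symmetric])
  show ?thesis
  proof (rule that[OF hm])
    show "(\<integral>\<^sup>+a. h a \<partial>M) \<le> C" using bound[OF t] by (simp add: h_def)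
    show "AE a in M. d a \<le> h a" if d: "d \<in> \<Phi>" for d
    proof -
      note [measurable] = meas[OF d]
      \<comment> \<open>The sequence \<open>t\<close> with \<open>d\<close> put in front is again
        admissible, so its supremum has no larger integral than \<open>h\<close>.\<close>
      define u where "u n = (case n of 0 \<Rightarrow> d | Suc m \<Rightarrow> t m)" for n
      have u: "range u \<subseteq> \<Phi>" using d t by (auto simp: u_def image_subset_iff split: nat.splits)
      have "max (d a) (h a) \<le> (SUP n. u n a)" for a
      proof (intro max.boundedI)
        show "d a \<le> (SUP n. u n a)" by (rule SUP_upper2[of 0]) (simp_all add: u_def)
        show "h a \<le> (SUP n. u n a)" unfolding h_def
        proof (rule SUP_least)
          fix n show "t n a \<le> (SUP n. u n a)" by (rule SUP_upper2[of "Suc n"]) (simp_all add: u_def)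
        qed
      qed
      then have "(\<integral>\<^sup>+a. max (d a) (h a) \<partial>M) \<le> I u" unfolding I_def by (intro nn_integral_mono)
      also have "\<dots> \<le> (\<integral>\<^sup>+a. h a \<partial>M)" using top[OF u] It by simp
      finally have le: "(\<integral>\<^sup>+a. max (d a) (h a) \<partial>M) \<le> (\<integral>\<^sup>+a. h a \<partial>M)" .
      have "(\<integral>\<^sup>+a. max (d a) (h a) - h a \<partial>M) = (\<integral>\<^sup>+a. max (d a) (h a) \<partial>M) - (\<integral>\<^sup>+a. h a \<partial>M)"
        using fin by (intro nn_integral_diff) auto
      then have "(\<integral>\<^sup>+a. max (d a) (h a) - h a \<partial>M) = 0"
        using le fin by (simp add: diff_eq_0_iff_ennreal less_top)
      then have "AE a in M. max (d a) (h a) - h a = 0" by (subst (asm) nn_integral_0_iff_AE) auto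
      then show ?thesis by eventually_elim (meson ennreal_minus_eq_0 max.bounded_iff)
    qed
    show "AE a in M. h a \<le> g a" if g: "\<And>d. d \<in> \<Phi> \<Longrightarrow> AE a in M. d a \<le> g a" for g
    proof -
      have "AE a in M. \<forall>n. t n a \<le> g a" unfolding AE_all_countable using t by (intro allI g) (simp add: image_subset_iff)
      then show ?thesis unfolding h_def by eventually_elim (simp add: SUP_least)
    qed
  qed
qed

text \<open>The modulus of \<open>U\<close> is \<open>u \<mapsto> sup {\<Sum>\<bar>U f\<^sub>i\<bar> : \<Sum>\<bar>f\<^sub>i\<bar> \<le> u}\<close> (Riesz--Kantorovich); the set function \<open>\<rho>\<close> bounds
  the integrals of finite suprema, so that the supremum of the whole family exists in \<open>L\<^sup>1\<close>.\<close>

locale modulus = lattice_op M E N "L1 N :: ('k, _) nspace" U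
  for M :: "'a measure" and E :: "('k::real_or_complex, ('a \<Rightarrow> 'k) set) nspace"
    and N :: "'b measure" and U :: "('a \<Rightarrow> 'k) set \<Rightarrow> ('b \<Rightarrow> 'k) set" +
  fixes \<rho> :: "'b set \<Rightarrow> 'a \<Rightarrow> real" and C :: real
  assumes \<rho>_measurable: "X \<in> sets N \<Longrightarrow> \<rho> X \<in> borel_measurable M"
    and \<rho>_nonneg: "0 \<le> \<rho> X a"
    and \<rho>_add: "X \<in> sets N \<Longrightarrow> Y \<in> sets N \<Longrightarrow> X \<inter> Y = {} \<Longrightarrow> AE a in M. \<rho> (X \<union> Y) a = \<rho> X a + \<rho> Y a"
    and \<rho>_estimate: "D.mem f \<Longrightarrow> X \<in> sets N \<Longrightarrow>
      (\<integral>\<^sup>+c. ennreal (norm (app f c)) * indicator X c \<partial>N) \<le> (\<integral>\<^sup>+a. ennreal (norm (f a) * \<rho> X a) \<partial>M)"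
    and \<rho>_bounded: "D.mem f \<Longrightarrow> (\<integral>\<^sup>+a. ennreal (norm (f a) * \<rho> (space N) a) \<partial>M) \<le> ennreal (C * D.fnorm f)"
begin

text \<open>These are the families over which the supremum is taken. Lists make superadditivity of
  the supremum a matter of concatenation, see \<open>dom_list_append\<close>.\<close>

definition dom_list :: "('a \<Rightarrow> real) \<Rightarrow> ('a \<Rightarrow> 'k) list \<Rightarrow> bool" where
  "dom_list u l \<longleftrightarrow> (\<forall>f\<in>set l. D.mem f) \<and> (AE a in M. (\<Sum>f\<leftarrow>l. norm (f a)) \<le> u a)"

definition img :: "('a \<Rightarrow> 'k) list \<Rightarrow> 'b \<Rightarrow> real" where "img l c = (\<Sum>f\<leftarrow>l. norm (app f c))"

lemma img_measurable: "\<forall>f\<in>set l. D.mem f \<Longrightarrow> img l \<in> borel_measurable N"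
proof (induction l)
  case (Cons f l)
  have [measurable]: "app f \<in> borel_measurable N" "img l \<in> borel_measurable N"
    using Cons by (auto intro: R.mem_measurable app_mem)
  show ?case unfolding img_def[abs_def] by (simp add: img_def[symmetric])
qed (simp add: img_def[abs_def])

lemma img_estimate:
  assumes l: "\<forall>f\<in>set l. D.mem f" and X: "X \<in> sets N"
  shows "(\<integral>\<^sup>+c. ennreal (img l c) * indicator X c \<partial>N) \<le> (\<integral>\<^sup>+a. ennreal ((\<Sum>f\<leftarrow>l. norm (f a)) * \<rho> X a) \<partial>M)"
  using l
proof (induction l)
  case (Cons f l)
  have [measurable]: "app f \<in> borel_measurable N" "img l \<in> borel_measurable N" "\<rho> X \<in> borel_measurable M" "f \<in> borel_measurable M"
    using Cons.prems X by (auto intro: R.mem_measurable app_mem img_measurable \<rho>_measurable D.mem_measurable)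
  have lm[measurable]: "(\<lambda>a. \<Sum>f\<leftarrow>l. norm (f a)) \<in> borel_measurable M"
    using Cons.prems by (induction l) (auto dest: D.mem_measurable)
  have nn: "0 \<le> (\<Sum>f\<leftarrow>l. norm (f a))" for a by (intro sum_list_nonneg) auto
  have "(\<integral>\<^sup>+c. ennreal (img (f # l) c) * indicator X c \<partial>N)
      = (\<integral>\<^sup>+c. ennreal (norm (app f c)) * indicator X c + ennreal (img l c) * indicator X c \<partial>N)"
    by (intro nn_integral_cong) (auto simp: img_def indicator_def intro!: ennreal_plus sum_list_nonneg)
  also have "\<dots> = (\<integral>\<^sup>+c. ennreal (norm (app f c)) * indicator X c \<partial>N) + (\<integral>\<^sup>+c. ennreal (img l c) * indicator X c \<partial>N)"
    using X by (intro nn_integral_add) auto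
  also have "\<dots> \<le> (\<integral>\<^sup>+a. ennreal (norm (f a) * \<rho> X a) \<partial>M) + (\<integral>\<^sup>+a. ennreal ((\<Sum>f\<leftarrow>l. norm (f a)) * \<rho> X a) \<partial>M)"
    using Cons by (intro add_mono \<rho>_estimate X) auto
  also have "\<dots> = (\<integral>\<^sup>+a. ennreal (norm (f a) * \<rho> X a) + ennreal ((\<Sum>f\<leftarrow>l. norm (f a)) * \<rho> X a) \<partial>M)"
    by (intro nn_integral_add[symmetric]) auto
  also have "\<dots> = (\<integral>\<^sup>+a. ennreal ((\<Sum>f\<leftarrow>f # l. norm (f a)) * \<rho> X a) \<partial>M)"
    using nn \<rho>_nonneg by (intro nn_integral_cong) (simp add: distrib_right ennreal_plus[symmetric] del: ennreal_plus)
  finally show ?case .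
qed (simp add: img_def)

text \<open>Instead of directing the family, the domain is cut: on \<open>Y\<close> the last list
  beats all earlier ones, on the remainder the induction hypothesis applies, and additivity of
  \<open>\<rho>\<close> joins the two bounds. This is why \<open>X\<close> is arbitrary in the
  induction.\<close>

lemma sup_estimate:
  assumes u: "u \<in> borel_measurable M" "\<And>a. 0 \<le> u a" and l: "\<And>k. dom_list u (l k)" and X: "X \<in> sets N"
  shows "(\<integral>\<^sup>+c. (SUP k\<in>{..<n::nat}. ennreal (img (l k) c)) * indicator X c \<partial>N) \<le> (\<integral>\<^sup>+a. ennreal (u a * \<rho> X a) \<partial>M)"
  using X
proof (induction n arbitrary: X)
  case 0
  then show ?case by (simp add: bot_ennreal)
next
  case (Suc n)
  define m where "m c = (SUP k\<in>{..<n}. ennreal (img (l k) c))" for c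
  have [measurable]: "img (l k) \<in> borel_measurable N" for k using l by (intro img_measurable) (simp add: dom_list_def)
  have [measurable]: "m \<in> borel_measurable N" unfolding m_def[abs_def] by measurable
  note [measurable] = u(1) \<rho>_measurable Suc.prems
  define Y where "Y = {c \<in> X. m c < ennreal (img (l n) c)}"
  have Xs: "X \<subseteq> space N" using Suc.prems by (rule sets.sets_into_space)
  have Ym[measurable]: "Y \<in> sets N"
  proof -
    have "Y = X \<inter> {c \<in> space N. m c < ennreal (img (l n) c)}" using Xs by (auto simp: Y_def)
    then show ?thesis using Suc.prems by simp
  qed
  have Zm[measurable]: "X - Y \<in> sets N" using Suc.prems Ym by blast
  have "(\<integral>\<^sup>+c. (SUP k\<in>{..<Suc n}. ennreal (img (l k) c)) * indicator X c \<partial>N)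
      = (\<integral>\<^sup>+c. ennreal (img (l n) c) * indicator Y c + m c * indicator (X - Y) c \<partial>N)"
  proof (rule nn_integral_cong)
    fix c
    have "(SUP k\<in>{..<Suc n}. ennreal (img (l k) c)) = sup (ennreal (img (l n) c)) (m c)"
      by (simp add: lessThan_Suc m_def)
    then show "(SUP k\<in>{..<Suc n}. ennreal (img (l k) c)) * indicator X c
        = ennreal (img (l n) c) * indicator Y c + m c * indicator (X - Y) c"
      by (auto simp: Y_def indicator_def sup_max max_def)
  qed
  also have "\<dots> = (\<integral>\<^sup>+c. ennreal (img (l n) c) * indicator Y c \<partial>N) + (\<integral>\<^sup>+c. m c * indicator (X - Y) c \<partial>N)"
    by (intro nn_integral_add) auto
  also have "\<dots> \<le> (\<integral>\<^sup>+a. ennreal (u a * \<rho> Y a) \<partial>M) + (\<integral>\<^sup>+a. ennreal (u a * \<rho> (X - Y) a) \<partial>M)"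
  proof (rule add_mono)
    have "(\<integral>\<^sup>+c. ennreal (img (l n) c) * indicator Y c \<partial>N) \<le> (\<integral>\<^sup>+a. ennreal ((\<Sum>f\<leftarrow>l n. norm (f a)) * \<rho> Y a) \<partial>M)"
      using l[of n] by (intro img_estimate Ym) (simp add: dom_list_def)
    also have "\<dots> \<le> (\<integral>\<^sup>+a. ennreal (u a * \<rho> Y a) \<partial>M)"
    proof (rule nn_integral_mono_AE)
      have "AE a in M. (\<Sum>f\<leftarrow>l n. norm (f a)) \<le> u a" using l[of n] by (simp add: dom_list_def)
      then show "AE a in M. ennreal ((\<Sum>f\<leftarrow>l n. norm (f a)) * \<rho> Y a) \<le> ennreal (u a * \<rho> Y a)"
        by eventually_elim (intro ennreal_leI mult_right_mono \<rho>_nonneg)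
    qed
    finally show "(\<integral>\<^sup>+c. ennreal (img (l n) c) * indicator Y c \<partial>N) \<le> (\<integral>\<^sup>+a. ennreal (u a * \<rho> Y a) \<partial>M)" .
    show "(\<integral>\<^sup>+c. m c * indicator (X - Y) c \<partial>N) \<le> (\<integral>\<^sup>+a. ennreal (u a * \<rho> (X - Y) a) \<partial>M)"
      using Suc.IH[OF Zm] by (simp add: m_def)
  qed
  also have "\<dots> = (\<integral>\<^sup>+a. ennreal (u a * \<rho> Y a) + ennreal (u a * \<rho> (X - Y) a) \<partial>M)"
    by (intro nn_integral_add[symmetric]) auto
  also have "\<dots> = (\<integral>\<^sup>+a. ennreal (u a * \<rho> X a) \<partial>M)"
  proof (rule nn_integral_cong_AE)
    have "Y \<union> (X - Y) = X" by (auto simp: Y_def)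
    then have "AE a in M. \<rho> X a = \<rho> Y a + \<rho> (X - Y) a" using \<rho>_add[OF Ym Zm] by auto
    then show "AE a in M. ennreal (u a * \<rho> Y a) + ennreal (u a * \<rho> (X - Y) a) = ennreal (u a * \<rho> X a)"
      by eventually_elim (simp add: ennreal_plus[symmetric] distrib_left u(2) \<rho>_nonneg del: ennreal_plus)
  qed
  finally show ?case .
qed

text \<open>The supremum of a sequence is the increasing limit of its finite suprema, so monotone
  convergence and \<open>sup_estimate\<close> on the whole space give the uniform bound for
  \<open>ess_sup_of_family_exists\<close>. Minimality, the last clause, is what makes the modulus
  additive.\<close>

lemma modulus_exists:
  assumes u: "D.rmem u" "\<And>a. 0 \<le> u a"
  shows "\<exists>K :: 'b \<Rightarrow> real. integrable N K \<and> (\<forall>c. 0 \<le> K c) \<and> (\<integral>c. K c \<partial>N) \<le> \<bar>C\<bar> * D.fnorm (\<lambda>a. of_real (u a)) \<and>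
    (\<forall>l. dom_list u l \<longrightarrow> (AE c in N. img l c \<le> K c)) \<and>
    (\<forall>g. (\<forall>l. dom_list u l \<longrightarrow> (AE c in N. img l c \<le> g c)) \<longrightarrow> (AE c in N. K c \<le> g c))"
proof -
  let ?\<Phi> = "{\<lambda>c. ennreal (img l c) | l. dom_list u l}"
  let ?C = "\<bar>C\<bar> * D.fnorm (\<lambda>a. of_real (u a))"
  have Cn: "0 \<le> ?C" by (intro mult_nonneg_nonneg D.fnorm_nonneg u) simp
  note um[measurable] = D.rmem_measurable[OF u(1)]
  obtain h where h: "h \<in> borel_measurable N" "(\<integral>\<^sup>+c. h c \<partial>N) \<le> ennreal ?C"
    "\<And>d. d \<in> ?\<Phi> \<Longrightarrow> AE c in N. d c \<le> h c"
    "\<And>g. (\<And>d. d \<in> ?\<Phi> \<Longrightarrow> AE c in N. d c \<le> g c) \<Longrightarrow> AE c in N. h c \<le> g c"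
  proof (rule ess_sup_of_family_exists[of ?\<Phi> N "ennreal ?C"])
    show "d \<in> borel_measurable N" if "d \<in> ?\<Phi>" for d
    proof -
      obtain l where l: "d = (\<lambda>c. ennreal (img l c))" "dom_list u l" using \<open>d \<in> ?\<Phi>\<close> by blast
      have [measurable]: "img l \<in> borel_measurable N" using l(2) by (intro img_measurable) (simp add: dom_list_def)
      show ?thesis unfolding l(1) by measurable
    qed
    have "dom_list u []" using u(2) by (simp add: dom_list_def)
    then show "?\<Phi> \<noteq> {}" by blast
    fix s :: "nat \<Rightarrow> 'b \<Rightarrow> ennreal" assume s: "range s \<subseteq> ?\<Phi>"
    then have "\<forall>k. \<exists>l. s k = (\<lambda>c. ennreal (img l c)) \<and> dom_list u l" by blast
    then obtain l where l: "\<And>k. s k = (\<lambda>c. ennreal (img (l k) c))" "\<And>k. dom_list u (l k)" by metis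
    have [measurable]: "img (l k) \<in> borel_measurable N" for k using l by (intro img_measurable) (simp add: dom_list_def)
    have "(SUP k. s k c) = (SUP n. SUP k\<in>{..<n::nat}. s k c)" for c
    proof (rule antisym)
      show "(SUP k. s k c) \<le> (SUP n. SUP k\<in>{..<n::nat}. s k c)"
      proof (rule SUP_least)
        fix k show "s k c \<le> (SUP n. SUP k\<in>{..<n::nat}. s k c)"
          by (rule SUP_upper2[of "Suc k"]) (auto intro: SUP_upper2[of k])
      qed
      show "(SUP n. SUP k\<in>{..<n::nat}. s k c) \<le> (SUP k. s k c)"
        by (intro SUP_least) (auto intro: SUP_upper)
    qed
    then have "(\<integral>\<^sup>+c. (SUP k. s k c) \<partial>N) = (\<integral>\<^sup>+c. (SUP n. SUP k\<in>{..<n::nat}. s k c) \<partial>N)" by simp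
    also have "\<dots> = (SUP n. \<integral>\<^sup>+c. (SUP k\<in>{..<n::nat}. s k c) \<partial>N)"
      by (rule nn_integral_monotone_convergence_SUP)
        (auto simp: l(1) incseq_def le_fun_def intro!: SUP_subset_mono)
    also have "\<dots> \<le> ennreal ?C"
    proof (rule SUP_least)
      fix n :: nat
      have "(\<integral>\<^sup>+c. (SUP k\<in>{..<n}. s k c) \<partial>N) = (\<integral>\<^sup>+c. (SUP k\<in>{..<n}. ennreal (img (l k) c)) * indicator (space N) c \<partial>N)"
        by (intro nn_integral_cong) (simp add: l(1))
      also have "\<dots> \<le> (\<integral>\<^sup>+a. ennreal (u a * \<rho> (space N) a) \<partial>M)"
        by (rule sup_estimate[OF um u(2) l(2)]) simp
      also have "\<dots> \<le> ennreal (C * D.fnorm (\<lambda>a. of_real (u a)))"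
        using \<rho>_bounded[OF u(1)] u(2) by simp
      also have "\<dots> \<le> ennreal ?C" by (intro ennreal_leI mult_right_mono D.fnorm_nonneg u) simp
      finally show "(\<integral>\<^sup>+c. (SUP k\<in>{..<n}. s k c) \<partial>N) \<le> ennreal ?C" .
    qed
    finally show "(\<integral>\<^sup>+c. (SUP k. s k c) \<partial>N) \<le> ennreal ?C" .
  qed auto
  define K where "K c = enn2real (h c)" for c
  have Km[measurable]: "K \<in> borel_measurable N" unfolding K_def[abs_def] using h(1) by measurable
  have "(\<integral>\<^sup>+c. h c \<partial>N) \<noteq> \<infinity>" using h(2) by (auto simp: top_unique)
  then have fin: "AE c in N. h c \<noteq> \<infinity>" by (rule nn_integral_PInf_AE[OF h(1)])
  then have hK: "AE c in N. h c = ennreal (K c)" by eventually_elim (simp add: K_def less_top)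
  have int: "(\<integral>\<^sup>+c. ennreal (K c) \<partial>N) = (\<integral>\<^sup>+c. h c \<partial>N)" using hK by (intro nn_integral_cong_AE) (auto elim: AE_mp)
  have Kn: "0 \<le> K c" for c by (simp add: K_def)
  have Ki: "integrable N K" using int Kn le_less_trans[OF h(2) ennreal_less_top] by (intro integrableI_nonneg) auto
  show ?thesis
  proof (intro exI[of _ K] conjI allI impI Ki Kn)
    have "ennreal (\<integral>c. K c \<partial>N) \<le> ennreal ?C"
      using nn_integral_eq_integral[OF Ki] Kn h(2) int by simp
    then show "(\<integral>c. K c \<partial>N) \<le> ?C" using Cn by simp
    fix l assume l: "dom_list u l"
    have "AE c in N. ennreal (img l c) \<le> h c" by (rule h(3)) (use l in auto)
    then show "AE c in N. img l c \<le> K c" using hK by eventually_elim (simp add: Kn)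
  next
    fix g assume g: "\<forall>l. dom_list u l \<longrightarrow> (AE c in N. img l c \<le> g c)"
    \<comment> \<open>The image of the empty list is 0; so every upper bound is nonnegative almost
      everywhere, and passing to \<open>ennreal (g c)\<close> loses nothing.\<close>
    have "dom_list u []" using u(2) by (simp add: dom_list_def)
    then have g0: "AE c in N. 0 \<le> g c" using g by (auto simp: img_def)
    have "AE c in N. h c \<le> ennreal (g c)"
    proof (rule h(4))
      fix d assume "d \<in> ?\<Phi>"
      then obtain l where l: "d = (\<lambda>c. ennreal (img l c))" "dom_list u l" by blast
      have "AE c in N. img l c \<le> g c" using g l(2) by blast
      then show "AE c in N. d c \<le> ennreal (g c)" unfolding l(1) by eventually_elim (rule ennreal_leI)
    qed
    then show "AE c in N. K c \<le> g c" using hK g0 by eventually_elim (simp add: ennreal_le_iff)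
  qed
qed

end

context modulus begin

lemma dom_list_append:
  "dom_list u l \<Longrightarrow> dom_list v l' \<Longrightarrow> dom_list (\<lambda>a. u a + v a) (l @ l')"
  unfolding dom_list_def by (auto intro: add_mono elim!: AE_mp)

lemma img_append: "img (l @ l') c = img l c + img l' c"
  by (simp add: img_def)

lemma dom_list_scale:
  assumes "dom_list u l" "0 < r"
  shows "dom_list (\<lambda>a. r * u a) (map (\<lambda>f a. of_real r * f a) l)"
    and "AE c in N. img (map (\<lambda>f a. of_real r * f a) l) c = r * img l c"
proof -
  have m: "\<forall>f\<in>set l. D.mem f" using assms by (simp add: dom_list_def)
  have "AE a in M. (\<Sum>f\<leftarrow>l. norm (f a)) \<le> u a" using assms by (simp add: dom_list_def)
  then have "AE a in M. (\<Sum>f\<leftarrow>map (\<lambda>f a. of_real r * f a) l. norm (f a)) \<le> r * u a"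
  proof eventually_elim
    case (elim a)
    have "(\<Sum>f\<leftarrow>map (\<lambda>f a. of_real r * f a) l. norm (f a)) = r * (\<Sum>f\<leftarrow>l. norm (f a))"
      using assms(2) by (simp add: comp_def norm_mult sum_list_const_mult)
    then show ?case using elim assms(2) by simp
  qed
  then show "dom_list (\<lambda>a. r * u a) (map (\<lambda>f a. of_real r * f a) l)"
    using m by (auto simp: dom_list_def intro: D.mem_scale)
  have "AE c in N. \<forall>f\<in>set l. app (\<lambda>a. of_real r * f a) c = of_real r * app f c"
    using m app_scale by (subst AE_ball_countable) (auto intro: countable_finite)
  then show "AE c in N. img (map (\<lambda>f a. of_real r * f a) l) c = r * img l c"
  proof eventually_elim
    case (elim c)
    have "img (map (\<lambda>f a. of_real r * f a) l) c = (\<Sum>f\<leftarrow>l. norm (app (\<lambda>a. of_real r * f a) c))"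
      by (simp add: img_def comp_def)
    also have "\<dots> = (\<Sum>f\<leftarrow>l. r * norm (app f c))"
      using elim assms(2) by (intro arg_cong[where f=sum_list] map_cong) (auto simp: norm_mult)
    finally show ?case by (simp add: img_def sum_list_const_mult)
  qed
qed

text \<open>Riesz decomposition: the members are multiplied by \<open>u / (u + v)\<close> and by
  \<open>v / (u + v)\<close>. Where \<open>u + v\<close> vanishes the quotients are 0, and there
  every member of \<open>l\<close> vanishes almost everywhere as well.\<close>

lemma dom_list_split:
  assumes u: "D.rmem u" "\<And>a. 0 \<le> u a" and v: "D.rmem v" "\<And>a. 0 \<le> v a"
    and l: "dom_list (\<lambda>a. u a + v a) l"
  obtains l1 l2 where "dom_list u l1" "dom_list v l2" "AE c in N. img l c \<le> img l1 c + img l2 c"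
proof -
  define part where "part w f a = (of_real (w a / (u a + v a)) * f a :: 'k)" for w :: "'a \<Rightarrow> real" and f a
  have [measurable]: "u \<in> borel_measurable M" "v \<in> borel_measurable M"
    by (rule D.rmem_measurable[OF u(1)], rule D.rmem_measurable[OF v(1)])
  have m: "D.mem f" if "f \<in> set l" for f using l that by (simp add: dom_list_def)
  have w: "dom_list w (map (part w) l)" and pm: "\<And>f. f \<in> set l \<Longrightarrow> D.mem (part w f)"
    if wm[measurable]: "w \<in> borel_measurable M" and w: "\<And>a. 0 \<le> w a" "\<And>a. w a \<le> u a + v a" for w
  proof -
    have le: "w a / (u a + v a) \<le> 1" "0 \<le> w a / (u a + v a)" for a
      using w[of a] by (auto simp: divide_le_eq_1)
    show pm: "D.mem (part w f)" if f: "f \<in> set l" for f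
    proof (rule D.mem_solid[OF m[OF f]])
      have [measurable]: "f \<in> borel_measurable M" by (rule D.mem_measurable[OF m[OF f]])
      show "part w f \<in> borel_measurable M" unfolding part_def[abs_def] by measurable
      show "AE a in M. norm (part w f a) \<le> norm (f a)"
      proof (rule AE_I2)
        fix a
        have "norm (part w f a) = (w a / (u a + v a)) * norm (f a)"
          unfolding part_def norm_mult norm_of_real abs_of_nonneg[OF le(2)] ..
        then show "norm (part w f a) \<le> norm (f a)" using mult_right_mono[OF le(1)[of a], of "norm (f a)"] by simp
      qed
    qed
    have "AE a in M. (\<Sum>f\<leftarrow>l. norm (f a)) \<le> u a + v a" using l by (simp add: dom_list_def)
    then have "AE a in M. (\<Sum>f\<leftarrow>map (part w) l. norm (f a)) \<le> w a"
    proof eventually_elim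
      case (elim a)
      have p: "norm (part w f a) = (w a / (u a + v a)) * norm (f a)" for f
        unfolding part_def norm_mult norm_of_real abs_of_nonneg[OF le(2)] ..
      have "(\<Sum>f\<leftarrow>map (part w) l. norm (f a)) = (w a / (u a + v a)) * (\<Sum>f\<leftarrow>l. norm (f a))"
        unfolding map_map comp_def p sum_list_const_mult ..
      also have "\<dots> \<le> (w a / (u a + v a)) * (u a + v a)" using elim le(2)[of a] by (rule mult_left_mono)
      also have "\<dots> \<le> w a" using w[of a] by simp
      finally show ?case .
    qed
    then show "dom_list w (map (part w) l)" using pm by (auto simp: dom_list_def)
  qed
  have ule: "u a \<le> u a + v a" and vle: "v a \<le> u a + v a" for a using u(2)[of a] v(2)[of a] by auto
  have "AE c in N. norm (app f c) \<le> norm (app (part u f) c) + norm (app (part v f) c)" if f: "f \<in> set l" for f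
  proof -
    have "AE a in M. (\<Sum>f\<leftarrow>l. norm (f a)) \<le> u a + v a" using l by (simp add: dom_list_def)
    then have "AE a in M. f a = part u f a + part v f a"
    proof eventually_elim
      case (elim a)
      have e: "part u f a + part v f a = of_real ((u a + v a) / (u a + v a)) * f a"
        unfolding part_def add_divide_distrib of_real_add distrib_right ..
      show ?case
      proof (cases "u a + v a = 0")
        case True
        have "norm (f a) \<le> (\<Sum>f\<leftarrow>l. norm (f a))" using f by (intro member_le_sum_list) auto
        then have "norm (f a) \<le> 0" using elim True by linarith
        then have "f a = 0" by simp
        then show ?thesis using e by simp
      qed (use e in simp)
    qed
    then have eq: "app f = app (\<lambda>a. part u f a + part v f a)" by (rule app_cong)
    show ?thesis unfolding eq using app_add[OF pm[of u, OF _ u(2) ule f] pm[of v, OF _ v(2) vle f]]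
      by (auto elim!: AE_mp simp: norm_triangle_ineq)
  qed
  then have "AE c in N. \<forall>f\<in>set l. norm (app f c) \<le> norm (app (part u f) c) + norm (app (part v f) c)"
    by (subst AE_ball_countable) (auto intro: countable_finite)
  then have "AE c in N. img l c \<le> img (map (part u) l) c + img (map (part v) l) c"
  proof eventually_elim
    case (elim c)
    have "img l c \<le> (\<Sum>f\<leftarrow>l. norm (app (part u f) c) + norm (app (part v f) c))"
      unfolding img_def using elim by (intro sum_list_mono) auto
    then show ?case by (simp add: img_def comp_def sum_list_addf)
  qed
  then show ?thesis using w[of u] w[of v] u(2) v(2) ule vle by (intro that[of "map (part u) l" "map (part v) l"]) auto
qed

text \<open>The modulus is subadditive by splitting lists and superadditive by joining them. So
  \<open>cone_extension\<close> makes it a positive operator on all of \<open>E\<close>, and lists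
  with one entry show that it dominates \<open>U\<close>.\<close>

lemma dominated: "U \<in> dominated_ops M N E (L1 N)"
proof -
  interpret lattice_pair M E N "L1 N :: ('k, _) nspace" ..
  define good where "good u K \<longleftrightarrow> integrable N K \<and> (\<forall>c. 0 \<le> K c) \<and> (\<integral>c. K c \<partial>N) \<le> \<bar>C\<bar> * D.fnorm (\<lambda>a. of_real (u a)) \<and>
    (\<forall>l. dom_list u l \<longrightarrow> (AE c in N. img l c \<le> K c)) \<and>
    (\<forall>g. (\<forall>l. dom_list u l \<longrightarrow> (AE c in N. img l c \<le> g c)) \<longrightarrow> (AE c in N. K c \<le> g c))" for u and K :: "'b \<Rightarrow> real"
  define K where "K u = (SOME k. good u k)" for u
  have "good u (K u)" if "D.rmem u" "\<And>a. 0 \<le> u a" for u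
    unfolding K_def using modulus_exists[OF that] by (intro someI_ex[of "good u"]) (simp add: good_def)
  then have K: "integrable N (K u)" "\<And>c. 0 \<le> K u c" "(\<integral>c. K u c \<partial>N) \<le> \<bar>C\<bar> * D.fnorm (\<lambda>a. of_real (u a))"
    "\<And>l. dom_list u l \<Longrightarrow> AE c in N. img l c \<le> K u c"
    "\<And>g. (\<And>l. dom_list u l \<Longrightarrow> AE c in N. img l c \<le> g c) \<Longrightarrow> AE c in N. K u c \<le> g c"
    if "D.rmem u" "\<And>a. 0 \<le> u a" for u
    using that unfolding good_def by blast+
  \<comment> \<open>The reverse inequality is the same one for \<open>1 / r\<close>, applied to
    \<open>r * u\<close>.\<close>
  have Kscale_le: "AE c in N. K (\<lambda>a. r * u a) c \<le> r * K u c" if u: "D.rmem u" "\<And>a. 0 \<le> u a" and r: "0 < r" for u r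
  proof (rule K(5))
    show "D.rmem (\<lambda>a. r * u a)" by (rule D.rmem_scale[OF u(1)])
    show "0 \<le> r * u a" for a using u(2)[of a] r by simp
    fix l assume l: "dom_list (\<lambda>a. r * u a) l"
    have i: "0 < 1 / r" using r by simp
    have "dom_list u (map (\<lambda>f a. of_real (1 / r) * f a) l)" using dom_list_scale(1)[OF l i] r by simp
    from K(4)[OF u this] dom_list_scale(2)[OF l i] show "AE c in N. img l c \<le> r * K u c"
    proof eventually_elim
      case (elim c)
      then have "(1 / r) * img l c \<le> K u c" by (simp only:)
      then show ?case using r by (simp add: field_simps)
    qed
  qed
  obtain P where P: "positive_op M E N (L1 N) P"
    "\<And>u. D.rmem u \<Longrightarrow> (\<And>a. 0 \<le> u a) \<Longrightarrow> AE c in N. lattice_op.app M P (\<lambda>a. of_real (u a)) c = of_real (K u c)"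
  proof (rule cone_extension[where K=K and C="\<bar>C\<bar>"])
    fix u :: "'a \<Rightarrow> real" assume u: "D.rmem u" "\<And>a. 0 \<le> u a"
    show "R.rmem (K u)" unfolding L1_mem by (rule integrable_of_real[OF K(1)[OF u]])
    show "AE c in N. 0 \<le> K u c" using K(2)[OF u] by simp
    have "R.fnorm (\<lambda>c. of_real (K u c)) = (\<integral>c. K u c \<partial>N)"
      using K(1,2)[OF u] by (subst L1_fnorm) auto
    then show "R.fnorm (\<lambda>c. of_real (K u c)) \<le> \<bar>C\<bar> * D.fnorm (\<lambda>a. of_real (u a))" using K(3)[OF u] by simp
    show "AE c in N. K (\<lambda>a. r * u a) c = r * K u c" if r: "0 < r" for r
    proof -
      have "AE c in N. K (\<lambda>a. (1 / r) * (r * u a)) c \<le> (1 / r) * K (\<lambda>a. r * u a) c"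
        using u r by (intro Kscale_le D.rmem_scale) auto
      moreover have "(\<lambda>a. (1 / r) * (r * u a)) = u" using r by auto
      ultimately show ?thesis using Kscale_le[OF u r] r by (auto elim!: AE_mp simp: field_simps intro: antisym)
    qed
    fix v assume v: "D.rmem v" "\<And>a. 0 \<le> v a"
    have uv: "D.rmem (\<lambda>a. u a + v a)" "\<And>a. 0 \<le> u a + v a" using D.rmem_add[OF u(1) v(1)] u(2) v(2) by auto
    show "AE c in N. K (\<lambda>a. u a + v a) c = K u c + K v c"
    proof -
      have "AE c in N. K (\<lambda>a. u a + v a) c \<le> K u c + K v c"
      proof (rule K(5)[OF uv])
        fix l assume l: "dom_list (\<lambda>a. u a + v a) l"
        obtain l1 l2 where s: "dom_list u l1" "dom_list v l2" "AE c in N. img l c \<le> img l1 c + img l2 c"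
          by (rule dom_list_split[OF u v l])
        show "AE c in N. img l c \<le> K u c + K v c"
          using s(3) K(4)[OF u s(1)] K(4)[OF v s(2)] by eventually_elim linarith
      qed
      \<comment> \<open>Superadditivity uses minimality twice: first over the lists for
        \<open>v\<close> with a list for \<open>u\<close> held fixed, then over the lists for
        \<open>u\<close>.\<close>
      moreover have "AE c in N. K u c \<le> K (\<lambda>a. u a + v a) c - K v c"
      proof (rule K(5)[OF u])
        fix l assume l: "dom_list u l"
        have "AE c in N. K v c \<le> K (\<lambda>a. u a + v a) c - img l c"
        proof (rule K(5)[OF v])
          fix l' assume l': "dom_list v l'"
          show "AE c in N. img l' c \<le> K (\<lambda>a. u a + v a) c - img l c"
            using K(4)[OF uv dom_list_append[OF l l']] unfolding img_append by eventually_elim linarith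
        qed
        then show "AE c in N. img l c \<le> K (\<lambda>a. u a + v a) c - K v c" by eventually_elim linarith
      qed
      ultimately show ?thesis by eventually_elim linarith
    qed
    \<comment> \<open>\<open>K\<close> is a choice for each function, but its values are pinned down
      by minimality, and functions that agree almost everywhere admit the same lists.\<close>
    assume eq: "AE a in M. u a = v a"
    have "dom_list u l \<longleftrightarrow> dom_list v l" for l
      unfolding dom_list_def using eq by (intro conj_cong refl eventually_subst) (auto elim: AE_mp)
    then have "AE c in N. K u c \<le> K v c" "AE c in N. K v c \<le> K u c"
      using K(4,5)[OF u] K(4,5)[OF v] by blast+
    then show "AE c in N. K u c = K v c" by eventually_elim simp
  qed (rule that, assumption, blast)
  interpret P: positive_op M E N "L1 N" P by (rule P(1))
  have "dominates M N E P U"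
  proof (rule dominatesI[OF lattice_op_axioms P(1)])
    fix f assume f: "D.mem f"
    have n: "D.rmem (\<lambda>a. norm (f a))" by (rule D.mem_norm[OF f])
    have "dom_list (\<lambda>a. norm (f a)) [f]" using f by (simp add: dom_list_def)
    then have "AE c in N. img [f] c \<le> K (\<lambda>a. norm (f a)) c" by (rule K(4)[OF n norm_ge_zero])
    then show "AE c in N. norm (app f c) \<le> norm (P.app (\<lambda>a. of_real (norm (f a))) c)"
      using P(2)[OF n norm_ge_zero] by eventually_elim (simp add: img_def K(2)[OF n norm_ge_zero])
  qed
  then show ?thesis using linear P.positive by (auto simp: dominated_ops_def)
qed

end


section \<open>Adjoint pairs\<close>

text \<open>The dual pair and the adjoint relation in terms of functions. Its near symmetry gives
  two instances of \<open>adjoint_op\<close>: \<open>TA\<close> with test functions from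
  \<open>F\<close>, and \<open>SA\<close> with essentially bounded ones.\<close>

locale adjoint_pair = T: lattice_op A "Linf A :: ('k, _) nspace" B G T + S: lattice_op B F A "L1 A :: ('k, _) nspace" S
  for A :: "'a measure" and B :: "'b measure"
    and F G :: "('k::real_or_complex, ('b \<Rightarrow> 'k) set) nspace"
    and T :: "('a \<Rightarrow> 'k) set \<Rightarrow> ('b \<Rightarrow> 'k) set"
    and S :: "('b \<Rightarrow> 'k) set \<Rightarrow> ('a \<Rightarrow> 'k) set" +
  assumes integrable: "S.D.mem f \<Longrightarrow> T.R.mem g \<Longrightarrow> integrable B (\<lambda>c. f c * g c)"
    and adjoint: "T.D.mem e \<Longrightarrow> S.D.mem f \<Longrightarrow> (\<integral>a. S.app f a * e a \<partial>A) = (\<integral>c. f c * T.app e c \<partial>B)"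
    and separating: "T.R.mem g \<Longrightarrow> (\<And>f. S.D.mem f \<Longrightarrow> (\<integral>c. f c * g c \<partial>B) = 0) \<Longrightarrow> AE c in B. g c = 0"
    and bounded: "\<exists>C\<ge>0. \<forall>f g. S.D.mem f \<longrightarrow> T.R.mem g \<longrightarrow> norm (\<integral>c. f c * g c \<partial>B) \<le> C * S.D.fnorm f * T.R.fnorm g"
begin

lemma integrable_Linf_L1: "S.R.mem f \<Longrightarrow> T.D.mem g \<Longrightarrow> integrable A (\<lambda>a. f a * g a)"
proof -
  assume f: "S.R.mem f" and g: "T.D.mem g"
  obtain C where C: "AE a in A. norm (g a) \<le> C" using g by (auto simp: Linf_mem)
  have [measurable]: "f \<in> borel_measurable A" "g \<in> borel_measurable A" using f g by (auto simp: S.R.mem_def T.D.mem_def)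
  have "integrable A (\<lambda>a. norm (f a) * C)" using f by (simp add: L1_mem)
  then show ?thesis
  proof (rule Bochner_Integration.integrable_bound)
    show "AE a in A. norm (f a * g a) \<le> norm (norm (f a) * C)"
      using C
    proof eventually_elim
      case (elim a)
      have "norm (f a) * norm (g a) \<le> norm (f a) * C" using elim by (intro mult_left_mono) auto
      then show ?case by (simp add: norm_mult)
    qed
  qed measurable
qed

text \<open>The quotient is \<open>0\<close> where \<open>f\<close> vanishes.\<close>

definition phase :: "('a \<Rightarrow> 'k) \<Rightarrow> 'a \<Rightarrow> 'k" where "phase f a = of_real (norm (f a)) / f a"

lemma phase: "f a * phase f a = of_real (norm (f a))" "norm (phase f a) \<le> 1"
  by (simp_all add: phase_def norm_divide)

lemma phase_measurable: "f \<in> borel_measurable A \<Longrightarrow> phase f \<in> borel_measurable A"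
  unfolding phase_def[abs_def] by measurable

text \<open>Integrated against its own phase, which is bounded by 1, the function yields its norm in
  \<open>L1 A\<close>.\<close>

lemma separating_L1:
  assumes h: "S.R.mem h" and z: "\<And>g. T.D.mem g \<Longrightarrow> (\<integral>a. g a * h a \<partial>A) = 0"
  shows "AE a in A. h a = 0"
proof -
  have "T.D.mem (phase h)" using phase(2) phase_measurable S.R.mem_measurable[OF h] by (auto simp: Linf_mem)
  then have "(\<integral>a. phase h a * h a \<partial>A) = 0" by (rule z)
  moreover have "(\<lambda>a. phase h a * h a) = (\<lambda>a. of_real (norm (h a)))"
    by (rule ext) (subst mult.commute, rule phase(1))
  ultimately have "(\<integral>a. of_real (norm (h a)) \<partial>A) = (0::'k)" by simp
  moreover have "integrable A (\<lambda>a. norm (h a))" using h by (simp add: L1_mem)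
  ultimately have "(\<integral>a. norm (h a) \<partial>A) = 0" by (simp add: integral_of_real)
  with \<open>integrable A (\<lambda>a. norm (h a))\<close> show ?thesis by (subst (asm) integral_nonneg_eq_0_iff_AE) auto
qed

sublocale TA: adjoint_op A "Linf A :: ('k, _) nspace" B G T S.D.mem S.app
  using S.D.mem_measurable S.R.mem_measurable[OF S.app_mem] integrable integrable_Linf_L1[OF S.app_mem] adjoint separating
  by unfold_locales auto

sublocale SA: adjoint_op B F A "L1 A :: ('k, _) nspace" S T.D.mem T.app
proof
  show "integrable A (\<lambda>a. g a * h a)" if "T.D.mem g" "S.R.mem h" for g h
    using integrable_Linf_L1[OF that(2,1)] by (simp add: mult.commute)
  show "integrable B (\<lambda>c. T.app g c * f c)" if "T.D.mem g" "S.D.mem f" for g f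
    using integrable[OF that(2) T.app_mem[OF that(1)]] by (simp add: mult.commute)
  show "(\<integral>c. T.app g c * f c \<partial>B) = (\<integral>a. g a * S.app f a \<partial>A)" if "T.D.mem g" "S.D.mem f" for g f
    using adjoint[OF that] by (simp add: mult.commute)
qed (use T.D.mem_measurable T.R.mem_measurable[OF T.app_mem] separating_L1 in auto)

text \<open>For bounded \<theta> supported in X with |\<theta>| \<le> 1, the integral of S f
  \<theta> equals that of f T \<theta>, which is at most the integral of |f| R 1_X. The phase of S f
  on X makes the left-hand side the integral of |S f| over X, so R 1_X can serve as the set function
  required by \<open>modulus\<close>.\<close>

lemma adjoint_dominated:
  assumes "T \<in> dominated_ops A B (Linf A) G" shows "S \<in> dominated_ops B A F (L1 A)"
proof -
  obtain R where R: "R \<in> positive_ops A B (Linf A) G" "dominates A B (Linf A) R T"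
    using assms by (auto simp: dominated_ops_def)
  interpret R: positive_op A "Linf A" B G R by (rule positive_op_intro[OF T.lattice_op_axioms R(1)])
  let ?i = "\<lambda>X a. of_real (indicat_real X a) :: 'k"
  have im: "T.D.mem (?i X)" if X: "X \<in> sets A" for X
    unfolding Linf_mem
    by (intro conjI exI[of _ 1] measurable_compose[OF borel_measurable_indicator[OF X] of_real_measurable_scalar])
      (auto simp: indicator_def)
  \<comment> \<open>The norm makes this real and nonnegative at every point; by
    \<open>im_nonneg\<close> it changes \<open>R 1_X\<close> on a null set only, so additivity in
    \<open>X\<close> persists almost everywhere.\<close>
  define \<rho> where "\<rho> X c = norm (R.app (?i X) c)" for X c
  have im_nonneg: "AE c in B. R.app (?i X) c = of_real (\<rho> X c)" if "X \<in> sets A" for X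
  proof -
    have "AE c in B. R.app (?i X) c \<in> \<real>\<^sub>\<ge>\<^sub>0" by (rule R.app_nonneg[OF im[OF that]]) simp
    then show ?thesis unfolding \<rho>_def by eventually_elim (rule nonneg_Reals_of_real)
  qed
  obtain C where C: "C \<ge> 0" "\<And>f g. S.D.mem f \<Longrightarrow> T.R.mem g \<Longrightarrow> norm (\<integral>c. f c * g c \<partial>B) \<le> C * S.D.fnorm f * T.R.fnorm g"
    using bounded by blast
  have \<rho>m[measurable]: "\<rho> X \<in> borel_measurable B" if "X \<in> sets A" for X
    unfolding \<rho>_def[abs_def] using T.R.mem_measurable[OF R.app_mem[OF im[OF that]]] by measurable
  have int: "integrable B (\<lambda>c. norm (f c) * \<rho> X c)" if "S.D.mem f" "X \<in> sets A" for f X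
    using integrable_norm[OF integrable[OF that(1) R.app_mem[OF im[OF that(2)]]]] by (simp add: \<rho>_def norm_mult)
  have nn: "(\<integral>\<^sup>+c. ennreal (norm (f c) * \<rho> X c) \<partial>B) = ennreal (\<integral>c. norm (f c) * \<rho> X c \<partial>B)"
    if "S.D.mem f" "X \<in> sets A" for f X
    by (rule nn_integral_eq_integral[OF int[OF that]]) (simp add: \<rho>_def)
  \<comment> \<open>The constant comes from boundedness of the duality: the integral of |f| R 1 is
    at most \<open>C\<close> times the norm of f times the norm of R 1.\<close>
  interpret modulus B F A S \<rho> "C * T.R.fnorm (R.app (?i (space A)))"
  proof
    show "AE c in B. \<rho> (X \<union> Y) c = \<rho> X c + \<rho> Y c" if X: "X \<in> sets A" and Y: "Y \<in> sets A" and d: "X \<inter> Y = {}" for X Y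
    proof -
      have "?i (X \<union> Y) = (\<lambda>a. ?i X a + ?i Y a)" 
      proof
        show "?i (X \<union> Y) a = ?i X a + ?i Y a" for a using d by (cases "a \<in> X"; cases "a \<in> Y") auto
      qed
      then have "AE c in B. R.app (?i (X \<union> Y)) c = R.app (?i X) c + R.app (?i Y) c"
        using R.app_add[OF im[OF X] im[OF Y]] by simp
      then show ?thesis using im_nonneg[OF X] im_nonneg[OF Y]
      proof eventually_elim
        case (elim c)
        then have "\<rho> (X \<union> Y) c = norm (of_real (\<rho> X c + \<rho> Y c) :: 'k)" unfolding \<rho>_def[of "X \<union> Y"] by simp
        then show ?case unfolding norm_of_real by (simp add: \<rho>_def)
      qed
    qed
    fix f assume f: "S.D.mem f"
    have [measurable]: "S.app f \<in> borel_measurable A" by (rule S.R.mem_measurable[OF S.app_mem[OF f]])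
    have fi: "integrable A (S.app f)" using S.app_mem[OF f] by (simp add: L1_mem)
    show "(\<integral>\<^sup>+c. ennreal (norm (S.app f c)) * indicator X c \<partial>A) \<le> (\<integral>\<^sup>+a. ennreal (norm (f a) * \<rho> X a) \<partial>B)"
      if X[measurable]: "X \<in> sets A" for X
    proof -
      \<comment> \<open>Turns \<open>S.app f\<close> into its absolute value on \<open>X\<close> and
        cuts off the rest, while staying below the indicator of \<open>X\<close>, where
        \<open>R\<close> is under control.\<close>
      define \<theta> where "\<theta> a = ?i X a * phase (S.app f) a" for a
      have [measurable]: "\<theta> \<in> borel_measurable A" unfolding \<theta>_def[abs_def] using phase_measurable[of "S.app f"] by measurable
      have \<theta>le: "norm (\<theta> a) \<le> indicat_real X a" for a
        using phase(2)[of "S.app f" a] by (simp add: \<theta>_def norm_mult indicator_def)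
      then have "norm (\<theta> a) \<le> 1" for a using order_trans[OF \<theta>le[of a] indicator_le_1] by simp
      then have \<theta>: "T.D.mem \<theta>" unfolding Linf_mem by auto
      have eq: "S.app f a * \<theta> a = of_real (norm (S.app f a) * indicat_real X a)" for a
        using phase(1)[of "S.app f" a] by (simp add: \<theta>_def mult_ac)
      have Ri: "integrable A (\<lambda>a. norm (S.app f a) * indicat_real X a)"
        using fi by (intro integrable_real_mult_indicator) auto
      have "AE c in B. norm (T.app \<theta> c) \<le> \<rho> X c"
      proof -
        have "AE c in B. norm (R.app (\<lambda>a. of_real (norm (\<theta> a))) c) \<le> norm (R.app (?i X) c)"
          by (rule R.app_mono[OF T.D.mem_norm[OF \<theta>] im[OF X]]) (use \<theta>le in auto)
        then show ?thesis using T.dominated_AE[OF R \<theta>] unfolding \<rho>_def by eventually_elim simp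
      qed
      then have le: "AE c in B. norm (f c * T.app \<theta> c) \<le> norm (f c) * \<rho> X c"
        by eventually_elim (simp add: norm_mult mult_left_mono)
      have "(\<integral>\<^sup>+c. ennreal (norm (S.app f c)) * indicator X c \<partial>A) = (\<integral>\<^sup>+c. ennreal (norm (S.app f c) * indicat_real X c) \<partial>A)"
        by (intro nn_integral_cong) (simp add: indicator_def)
      also have "\<dots> = ennreal (\<integral>a. norm (S.app f a) * indicat_real X a \<partial>A)"
        by (rule nn_integral_eq_integral[OF Ri]) simp
      also have "(\<integral>a. norm (S.app f a) * indicat_real X a \<partial>A) = norm (\<integral>a. S.app f a * \<theta> a \<partial>A)"
        unfolding eq integral_of_real[OF Ri] norm_of_real by (simp add: integral_nonneg_AE)
      also have "\<dots> = norm (\<integral>c. f c * T.app \<theta> c \<partial>B)" by (simp only: adjoint[OF \<theta> f])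
      also have "\<dots> \<le> (\<integral>c. norm (f c * T.app \<theta> c) \<partial>B)" by (rule integral_norm_bound)
      also have "\<dots> \<le> (\<integral>c. norm (f c) * \<rho> X c \<partial>B)"
        by (rule integral_mono_AE[OF integrable_norm[OF integrable[OF f T.app_mem[OF \<theta>]]] int[OF f X] le])
      finally show ?thesis unfolding nn[OF f X] by (simp add: ennreal_leI)
    qed
    show "(\<integral>\<^sup>+a. ennreal (norm (f a) * \<rho> (space A) a) \<partial>B) \<le> ennreal (C * T.R.fnorm (R.app (?i (space A))) * S.D.fnorm f)"
    proof -
      have "AE c in B. of_real (norm (f c)) * R.app (?i (space A)) c = of_real (norm (f c) * \<rho> (space A) c)"
        using im_nonneg[OF sets.top] by eventually_elim simp
      then have "(\<integral>c. of_real (norm (f c)) * R.app (?i (space A)) c \<partial>B) = (\<integral>c. of_real (norm (f c) * \<rho> (space A) c) \<partial>B)"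
        using S.D.mem_measurable[OF f] T.R.mem_measurable[OF R.app_mem[OF im[of "space A"]]]
        by (intro integral_cong_AE) auto
      then have "(\<integral>c. norm (f c) * \<rho> (space A) c \<partial>B) \<le> norm (\<integral>c. of_real (norm (f c)) * R.app (?i (space A)) c \<partial>B)"
        unfolding integral_of_real[OF int[OF f sets.top]] by (simp only: norm_of_real abs_ge_self)
      also have "\<dots> \<le> C * S.D.fnorm (\<lambda>c. of_real (norm (f c))) * T.R.fnorm (R.app (?i (space A)))"
        by (intro C S.D.mem_norm f R.app_mem im) simp
      finally show ?thesis unfolding nn[OF f sets.top] S.D.fnorm_norm[OF f] by (intro ennreal_leI) (simp add: mult_ac)
    qed
  qed (simp_all add: \<rho>m, simp add: \<rho>_def)
  show ?thesis by (rule dominated)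
qed

end

section \<open>Integration of vector-valued pairings\<close>

lemma integrable_pairing:
  assumes b: "pairing sX sY b"
    and E: "function_lattice M E" "function_lattice M E'"
    and int: "\<And>f g. function_ideal.mem M E f \<Longrightarrow> function_ideal.mem M E' g \<Longrightarrow> integrable M (\<lambda>a. f a * g a :: 'k::real_or_complex)"
    and f: "function_lattice.vmem M E f" and g: "function_lattice.vmem M E' g"
  shows "integrable M (\<lambda>a. b (f a) (g a))"
proof -
  interpret E: function_lattice M E by (rule E)
  interpret E': function_lattice M E' by (rule E)
  obtain C where C: "C \<ge> 0" "\<And>x y. norm (b x y) \<le> C * norm x * norm y" by (rule pairing.bound[OF b]) blast
  have "integrable M (\<lambda>a. of_real (norm (f a)) * of_real (norm (g a)) :: 'k)"
    using f g by (intro int) (simp_all add: E.vmem_def E'.vmem_def)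
  then have "integrable M (\<lambda>a. C * norm (of_real (norm (f a)) * of_real (norm (g a)) :: 'k))" by simp
  then show ?thesis
  proof (rule Bochner_Integration.integrable_bound)
    show "(\<lambda>a. b (f a) (g a)) \<in> borel_measurable M"
      using f g by (intro pairing.measurable[OF b]) (simp_all add: E.vmem_def E'.vmem_def)
    show "AE a in M. norm (b (f a) (g a)) \<le> norm (C * norm (of_real (norm (f a)) * of_real (norm (g a)) :: 'k))"
      using C by (simp add: norm_mult mult.assoc abs_mult)
  qed
qed

text \<open>Dominated convergence with majorant C |K| |g|, where C bounds the form. It is used on
  both sides of the vector adjoint identity and for the weak density of finite sums.\<close>

lemma pairing_sums_lim:
  fixes sX :: "'k::real_or_complex \<Rightarrow> 'x::banach \<Rightarrow> 'x" and sY :: "'k \<Rightarrow> 'y::banach \<Rightarrow> 'y"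
  assumes b: "pairing sX sY b" and fl: "function_lattice M E" "function_lattice M E'"
    and int: "\<And>f g. function_ideal.mem M E f \<Longrightarrow> function_ideal.mem M E' g \<Longrightarrow> integrable M (\<lambda>a. f a * g a :: 'k)"
    and K: "function_ideal.mem M E K" and \<phi>: "\<And>j. function_ideal.mem M E (\<phi> j)" and g: "function_lattice.vmem M E' g"
    and le: "AE a in M. \<forall>n. (\<Sum>j<n. norm (\<phi> j a) * norm (x j)) \<le> norm (K a)"
    and f: "strongly_measurable M f" and sums: "AE a in M. (\<lambda>j. sX (\<phi> j a) (x j)) sums f a"
  shows "(\<lambda>n. \<integral>a. b (\<Sum>j<n. sX (\<phi> j a) (x j)) (g a) \<partial>M) \<longlonglongrightarrow> (\<integral>a. b (f a) (g a) \<partial>M)"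
proof -
  interpret E: function_lattice M E by (rule fl)
  interpret E': function_lattice M E' by (rule fl)
  interpret b: pairing sX sY b by (rule b)
  obtain C where C: "C \<ge> 0" "\<And>x y. norm (b x y) \<le> C * norm x * norm y" by (rule b.bound) blast
  have gm: "strongly_measurable M g" using g by (simp add: E'.vmem_def)
  show ?thesis
  proof (rule integral_dominated_convergence)
    show "(\<lambda>a. b (f a) (g a)) \<in> borel_measurable M" by (rule b.measurable[OF f gm])
    show "(\<lambda>a. b (\<Sum>j<n. sX (\<phi> j a) (x j)) (g a)) \<in> borel_measurable M" for n
      by (intro b.measurable gm strongly_measurable_sum b.X.strongly_measurable_left E.mem_measurable \<phi>)
    have "integrable M (\<lambda>a. K a * of_real (norm (g a)))" using g by (intro int K) (simp add: E'.vmem_def)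
    then have "integrable M (\<lambda>a. C * norm (K a * of_real (norm (g a))))" by simp
    then show "integrable M (\<lambda>a. C * norm (K a) * norm (g a))" by (simp add: norm_mult mult.assoc)
    show "AE a in M. (\<lambda>n. b (\<Sum>j<n. sX (\<phi> j a) (x j)) (g a)) \<longlonglongrightarrow> b (f a) (g a)"
      using sums unfolding sums_def
      by eventually_elim (rule bounded_bilinear.tendsto[OF b.bounded_bilinear _ tendsto_const])
    show "AE a in M. norm (b (\<Sum>j<n. sX (\<phi> j a) (x j)) (g a)) \<le> C * norm (K a) * norm (g a)" for n
      using le
    proof eventually_elim
      case (elim a)
      have "norm (\<Sum>j<n. sX (\<phi> j a) (x j)) \<le> norm (K a)"
        by (rule order_trans[OF norm_sum]) (use elim in \<open>simp add: b.X.norm_eq\<close>)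
      then have "C * norm (\<Sum>j<n. sX (\<phi> j a) (x j)) * norm (g a) \<le> C * norm (K a) * norm (g a)"
        using C(1) by (intro mult_right_mono mult_left_mono) auto
      then show ?case using C(2) order_trans by blast
    qed
  qed
qed


section \<open>Weak topologies\<close>

text \<open>Balls of the weak topology see the form through differences only, and a nonempty
  \<open>W\<close> makes them cover the carrier of \<open>V\<close>.\<close>

locale bilinear_form =
  fixes V :: "('k::real_or_complex, 'v) nspace" and W :: "('k, 'w) nspace" and b :: "'v \<Rightarrow> 'w \<Rightarrow> 'k"
  assumes nonempty: "vcarrier W \<noteq> {}"
    and diff: "v \<in> vcarrier V \<Longrightarrow> v' \<in> vcarrier V \<Longrightarrow> w \<in> vcarrier W \<Longrightarrow> b (vdiff V v v') w = b v w - b v' w"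
begin

abbreviation balls where "balls \<equiv> {{u \<in> vcarrier V. norm (b (vdiff V u v) w) < \<epsilon>} | v w \<epsilon>.
  v \<in> vcarrier V \<and> w \<in> vcarrier W \<and> 0 < \<epsilon>}"

lemma topspace_weak: "topspace (weak_topology V W b) = vcarrier V"
proof -
  obtain w where w: "w \<in> vcarrier W" using nonempty by blast
  have "v \<in> \<Union>balls" if "v \<in> vcarrier V" for v
  proof (rule UnionI)
    show "{u \<in> vcarrier V. norm (b (vdiff V u v) w) < 1} \<in> balls" using that w zero_less_one by blast
    show "v \<in> {u \<in> vcarrier V. norm (b (vdiff V u v) w) < 1}" using that w by (simp add: diff)
  qed
  then show ?thesis unfolding weak_topology_def topology_generated_by_topspace by blast
qed

lemma ball_open:
  "v \<in> vcarrier V \<Longrightarrow> w \<in> vcarrier W \<Longrightarrow> 0 < \<epsilon> \<Longrightarrow>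
    openin (weak_topology V W b) {u \<in> vcarrier V. norm (b (vdiff V u v) w) < \<epsilon>}"
  unfolding weak_topology_def by (rule topology_generated_by_Basis) blast

text \<open>Convergence of all pairings is tested on the generating balls and is carried to finite
  intersections and unions by induction over the generated topology.\<close>

lemma eventually_in_open:
  assumes x: "x \<in> vcarrier V" "\<And>n. X n \<in> vcarrier V" "\<And>w. w \<in> vcarrier W \<Longrightarrow> (\<lambda>n. b (X n) w) \<longlonglongrightarrow> b x w"
    and op: "openin (weak_topology V W b) O'" "x \<in> O'"
  shows "\<forall>\<^sub>F n in sequentially. X n \<in> O'"
proof -
  have "generate_topology_on balls O'" using op(1) unfolding weak_topology_def by (rule openin_topology_generated_by)
  then show ?thesis using op(2)
  proof induction
    case (Int a b)
    then show ?case using eventually_conj[of "\<lambda>n. X n \<in> a" sequentially "\<lambda>n. X n \<in> b"] by simp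
  next
    case (UN K)
    then obtain k where "k \<in> K" "x \<in> k" by blast
    then have "\<forall>\<^sub>F n in sequentially. X n \<in> k" using UN.IH by blast
    then show ?case using \<open>k \<in> K\<close> by (auto elim: eventually_mono)
  next
    case (Basis s)
    then obtain v w e where s: "s = {u \<in> vcarrier V. norm (b (vdiff V u v) w) < e}"
      "v \<in> vcarrier V" "w \<in> vcarrier W" by blast
    have "(\<lambda>n. norm (b (X n) w - b v w)) \<longlonglongrightarrow> norm (b x w - b v w)"
      by (intro tendsto_norm tendsto_diff x(3) s(3) tendsto_const)
    moreover have "norm (b x w - b v w) < e" using Basis(2) s x(1) by (simp add: diff)
    ultimately have "\<forall>\<^sub>F n in sequentially. norm (b (X n) w - b v w) < e" by (rule order_tendstoD(2))
    then show ?case by (rule eventually_mono) (use s x(2) in \<open>simp add: diff\<close>)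
  qed simp
qed

end

text \<open>By the adjoint relation, the seminorm of \<open>w\<close> composed with \<open>U\<close>
  is the seminorm of \<open>U' w\<close>; so preimages of balls contain balls around each of their
  points.\<close>

lemma weak_continuous_of_adjoint:
  assumes 1: "bilinear_form V1 W1 b1" and 2: "bilinear_form V2 W2 b2"
    and U: "\<And>v. v \<in> vcarrier V1 \<Longrightarrow> U v \<in> vcarrier V2" and U': "\<And>w. w \<in> vcarrier W2 \<Longrightarrow> U' w \<in> vcarrier W1"
    and adj: "\<And>v w. v \<in> vcarrier V1 \<Longrightarrow> w \<in> vcarrier W2 \<Longrightarrow> b1 v (U' w) = b2 (U v) w"
  shows "continuous_map (weak_topology V1 W1 b1) (weak_topology V2 W2 b2) U"
proof -
  interpret B1: bilinear_form V1 W1 b1 by (rule 1)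
  interpret B2: bilinear_form V2 W2 b2 by (rule 2)
  have "openin (weak_topology V1 W1 b1) (U -` Z \<inter> topspace (weak_topology V1 W1 b1))" if Z: "Z \<in> B2.balls" for Z
  proof -
    obtain v w e where Z: "Z = {u \<in> vcarrier V2. norm (b2 (vdiff V2 u v) w) < e}" "v \<in> vcarrier V2" "w \<in> vcarrier W2"
      using Z by blast
    show ?thesis unfolding B1.topspace_weak
    proof (subst openin_subopen, intro ballI)
      fix x assume "x \<in> U -` Z \<inter> vcarrier V1"
      then have x: "x \<in> vcarrier V1" "norm (b2 (U x) w - b2 v w) < e" using Z U by (auto simp: B2.diff)
      \<comment> \<open>The radius is what the triangle inequality leaves between \<open>U x\<close>
        and the boundary of the ball \<open>Z\<close>.\<close>
      let ?Y = "{u \<in> vcarrier V1. norm (b1 (vdiff V1 u x) (U' w)) < e - norm (b2 (U x) w - b2 v w)}"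
      have "openin (weak_topology V1 W1 b1) ?Y" using x Z(3) by (intro B1.ball_open U') auto
      moreover have "x \<in> ?Y" using x Z(3) by (simp add: B1.diff U')
      moreover have "?Y \<subseteq> U -` Z \<inter> vcarrier V1"
      proof
        fix u assume "u \<in> ?Y"
        then have u: "u \<in> vcarrier V1" "norm (b2 (U u) w - b2 (U x) w) < e - norm (b2 (U x) w - b2 v w)"
          using x Z(3) by (auto simp: B1.diff U' adj)
        have "norm (b2 (U u) w - b2 v w) \<le> norm (b2 (U u) w - b2 (U x) w) + norm (b2 (U x) w - b2 v w)"
          using norm_triangle_ineq[of "b2 (U u) w - b2 (U x) w" "b2 (U x) w - b2 v w"] by simp
        then show "u \<in> U -` Z \<inter> vcarrier V1" using u Z U by (simp add: B2.diff)
      qed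
      ultimately show "\<exists>O'. openin (weak_topology V1 W1 b1) O' \<and> x \<in> O' \<and> O' \<subseteq> U -` Z \<inter> vcarrier V1" by blast
    qed
  qed
  moreover have "U ` topspace (weak_topology V1 W1 b1) \<subseteq> \<Union>B2.balls"
    using U B2.topspace_weak unfolding B1.topspace_weak unfolding weak_topology_def topology_generated_by_topspace by blast
  ultimately show ?thesis
    unfolding weak_topology_def[of V2] by (subst continuous_on_generated_topo_iff) blast
qed

text \<open>Sequences suffice for uniqueness, since a function is approximated by the partial sums
  of its series.\<close>

lemma weak_continuous_sequentially:
  assumes 1: "bilinear_form V1 W1 b1" and 2: "bilinear_form V2 W2 b2"
    and U: "\<And>v. v \<in> vcarrier V1 \<Longrightarrow> U v \<in> vcarrier V2"
    and c: "continuous_map (weak_topology V1 W1 b1) (weak_topology V2 W2 b2) U"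
    and x: "x \<in> vcarrier V1" "\<And>n. X n \<in> vcarrier V1" "\<And>w. w \<in> vcarrier W1 \<Longrightarrow> (\<lambda>n. b1 (X n) w) \<longlonglongrightarrow> b1 x w"
    and w: "w \<in> vcarrier W2"
  shows "(\<lambda>n. b2 (U (X n)) w) \<longlonglongrightarrow> b2 (U x) w"
proof (rule tendstoI)
  interpret B1: bilinear_form V1 W1 b1 by (rule 1)
  interpret B2: bilinear_form V2 W2 b2 by (rule 2)
  fix e :: real assume e: "0 < e"
  let ?Z = "{z \<in> vcarrier V2. norm (b2 (vdiff V2 z (U x)) w) < e}"
  have 1: "openin (weak_topology V1 W1 b1) {v \<in> topspace (weak_topology V1 W1 b1). U v \<in> ?Z}"
    by (rule openin_continuous_map_preimage[OF c B2.ball_open[OF U[OF x(1)] w e]])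
  have 2: "x \<in> {v \<in> topspace (weak_topology V1 W1 b1). U v \<in> ?Z}"
    using x(1) U w e by (simp add: B1.topspace_weak B2.diff)
  have "\<forall>\<^sub>F n in sequentially. X n \<in> {v \<in> topspace (weak_topology V1 W1 b1). U v \<in> ?Z}"
    by (rule B1.eventually_in_open[OF x(1,2) _ 1 2]) (rule x(3))
  then show "\<forall>\<^sub>F n in sequentially. dist (b2 (U (X n)) w) (b2 (U x) w) < e"
    by (rule eventually_mono) (use U x w in \<open>simp add: B2.diff dist_norm B1.topspace_weak\<close>)
qed

section \<open>Uniqueness by norm density, and pairings of classes\<close>

context lattice_pair begin

text \<open>For \<open>g\<close> in the algebraic tensor product V u - V' u = V (u - g) - V' (u -
  g), and boundedness makes the right-hand side small. Definiteness of the norm of \<open>H\<close>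
  is an assumption, because \<open>function_lattice\<close> provides a seminorm.\<close>

lemma closed_tensor_op_unique:
  fixes s :: "'k \<Rightarrow> 'y::banach \<Rightarrow> 'y"
  assumes s: "scaling s"
    and V: "V \<in> bounded_ops (closed_tensor M E s) (valued N H s)"
    and V': "V' \<in> bounded_ops (closed_tensor M E s) (valued N H s)"
    and eq: "\<And>h. h \<in> vcarrier (alg_tensor M E s) \<Longrightarrow> V h = V' h"
    and definite: "\<And>h. R.mem h \<Longrightarrow> R.fnorm h = 0 \<Longrightarrow> AE c in N. h c = 0"
  shows "V = V'"
proof -
  let ?X = "vcarrier (closed_tensor M E s)"
  note clos = D.closed_tensor_add[OF s] D.closed_tensor_scale[OF s]
  have ran: "Z u \<in> vcarrier (valued N H s)" if "Z \<in> bounded_ops (closed_tensor M E s) (valued N H s)" "u \<in> ?X" for Z u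
    using that by (auto simp: bounded_ops_def linear_ops_def)
  have "V u = V' u" if u: "u \<in> ?X" for u
  proof -
    obtain f where f: "D.vmem f" "u = ae_class M f" using D.closed_tensor_cases[OF s u] by blast
    obtain v where v: "R.vmem v" "V u = ae_class N v" using R.valued_cases[OF ran[OF V u]] by blast
    obtain w where w: "R.vmem w" "V' u = ae_class N w" using R.valued_cases[OF ran[OF V' u]] by blast
    obtain C where C: "\<And>u. u \<in> ?X \<Longrightarrow> vnorm (valued N H s) (V u) \<le> C * vnorm (valued M E s) u"
      using V by (auto simp: bounded_ops_def)
    obtain C' where C': "\<And>u. u \<in> ?X \<Longrightarrow> vnorm (valued N H s) (V' u) \<le> C' * vnorm (valued M E s) u"
      using V' by (auto simp: bounded_ops_def)
    have "R.vfnorm (\<lambda>c. v c - w c) \<le> 0 + \<epsilon>" if \<epsilon>: "0 < \<epsilon>" for \<epsilon>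
    proof -
      \<comment> \<open>The bounds in \<open>bounded_ops\<close> may be negative or zero, hence the
        absolute values and the added 1.\<close>
      define \<delta> where "\<delta> = \<epsilon> / (\<bar>C\<bar> + \<bar>C'\<bar> + 1)"
      have \<delta>: "0 < \<delta>" using \<epsilon> by (simp add: \<delta>_def add_nonneg_pos)
      obtain g where g: "D.vmem g" "ae_class M g \<in> vcarrier (alg_tensor M E s)" "D.vfnorm (\<lambda>a. f a - g a) < \<delta>"
        using u \<delta> unfolding f(2) D.closed_tensor_iff[OF s f(1)] by blast
      have d: "D.vmem (\<lambda>a. f a - g a)" by (rule D.vmem_diff[OF f(1) g(1)])
      have gX: "ae_class M g \<in> ?X" by (rule D.alg_tensor_closed[OF s g(2)])
      have dX: "ae_class M (\<lambda>a. f a - g a) \<in> ?X"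
        using clos(1)[OF u clos(2)[OF gX, of "-1"]] D.valued_vdiff[OF s f(1) g(1)] unfolding f(2) vdiff_def by simp
      have ud: "u = vadd (valued M E s) (ae_class M (\<lambda>a. f a - g a)) (ae_class M g)"
        by (simp add: D.valued_vadd d g(1) f(2))
      obtain k where k: "R.vmem k" "V (ae_class M g) = ae_class N k" using R.valued_cases[OF ran[OF V gX]] by blast
      have k': "V' (ae_class M g) = ae_class N k" using eq[OF g(2)] k(2) by simp
      obtain p where p: "R.vmem p" "V (ae_class M (\<lambda>a. f a - g a)) = ae_class N p" using R.valued_cases[OF ran[OF V dX]] by blast
      obtain q where q: "R.vmem q" "V' (ae_class M (\<lambda>a. f a - g a)) = ae_class N q" using R.valued_cases[OF ran[OF V' dX]] by blast
      have "V u = vadd (valued N H s) (V (ae_class M (\<lambda>a. f a - g a))) (V (ae_class M g))"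
        unfolding ud using V dX gX by (simp add: bounded_ops_def linear_ops_def)
      then have "ae_class N v = ae_class N (\<lambda>c. p c + k c)" by (simp add: v(2) p k R.valued_vadd)
      then have 1: "AE c in N. v c = p c + k c" using v(1) by (intro ae_class_eqD) (auto simp: R.vmem_def)
      have "V' u = vadd (valued N H s) (V' (ae_class M (\<lambda>a. f a - g a))) (V' (ae_class M g))"
        unfolding ud using V' dX gX by (simp add: bounded_ops_def linear_ops_def)
      then have "ae_class N w = ae_class N (\<lambda>c. q c + k c)" by (simp add: w(2) q k(1) k' R.valued_vadd)
      then have 2: "AE c in N. w c = q c + k c" using w(1) by (intro ae_class_eqD) (auto simp: R.vmem_def)
      have "R.vfnorm (\<lambda>c. v c - w c) = R.vfnorm (\<lambda>c. p c + - q c)"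
        unfolding R.vfnorm_def using 1 2 by (intro R.fnorm_cong) (auto elim!: AE_mp)
      also have "\<dots> \<le> R.vfnorm p + R.vfnorm q"
        using R.vfnorm_triangle[OF p(1) R.vmem_minus[OF q(1)]] by (simp add: R.vfnorm_def)
      also have "\<dots> \<le> C * D.vfnorm (\<lambda>a. f a - g a) + C' * D.vfnorm (\<lambda>a. f a - g a)"
        using C[OF dX] C'[OF dX] p q by (simp add: R.valued_vfnorm D.valued_vfnorm d)
      also have "\<dots> \<le> (\<bar>C\<bar> + \<bar>C'\<bar> + 1) * D.vfnorm (\<lambda>a. f a - g a)"
        unfolding distrib_right[symmetric] by (intro mult_right_mono D.vfnorm_nonneg d) auto
      also have "\<dots> \<le> (\<bar>C\<bar> + \<bar>C'\<bar> + 1) * \<delta>" using g(3) by (intro mult_left_mono) auto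
      also have "\<dots> = \<epsilon>" using \<delta> \<epsilon> unfolding \<delta>_def by (simp add: add_nonneg_pos less_imp_neq)
      finally show ?thesis by simp
    qed
    then have "R.vfnorm (\<lambda>c. v c - w c) \<le> 0" by (rule field_le_epsilon)
    then have "R.vfnorm (\<lambda>c. v c - w c) = 0" using R.vfnorm_nonneg[OF R.vmem_diff[OF v(1) w(1)]] by simp
    then have "AE c in N. (of_real (norm (v c - w c)) :: 'k) = 0"
      unfolding R.vfnorm_def by (intro definite R.vmem_norm R.vmem_diff v w)
    then have "AE c in N. v c = w c" by eventually_elim simp
    then show ?thesis unfolding v(2) w(2) by (rule ae_class_cong)
  qed
  then show ?thesis using V V'
    by (intro PiE_ext[of V ?X "\<lambda>_. vcarrier (valued N H s)" V']) (auto simp: bounded_ops_def linear_ops_def)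
qed

end

lemma int_pairing_class:
  assumes "strongly_measurable M f" "strongly_measurable M g" "(\<lambda>a. b (f a) (g a)) \<in> borel_measurable M"
    "(\<lambda>a. b (rep (ae_class M f) a) (rep (ae_class M g) a)) \<in> borel_measurable M"
  shows "int_pairing M b (ae_class M f) (ae_class M g) = (\<integral>a. b (f a) (g a) \<partial>M)"
  unfolding int_pairing_def
proof (rule integral_cong_AE[OF assms(4,3)])
  show "AE a in M. b (rep (ae_class M f) a) (rep (ae_class M g) a) = b (f a) (g a)"
    using rep_ae_class(2)[OF assms(1)] rep_ae_class(2)[OF assms(2)] by eventually_elim simp
qed

lemma (in pairing) int_pairing_class:
  assumes "strongly_measurable M f" "strongly_measurable M g"
  shows "int_pairing M b (ae_class M f) (ae_class M g) = (\<integral>a. b (f a) (g a) \<partial>M)"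
  by (rule int_pairing_class[OF assms measurable[OF assms] measurable[OF rep_ae_class(1)[OF assms(1)] rep_ae_class(1)[OF assms(2)]]])

lemma int_pairing_mult_class:
  fixes f g :: "'a \<Rightarrow> 'k::real_or_complex"
  assumes "f \<in> borel_measurable M" "g \<in> borel_measurable M"
  shows "int_pairing M (*) (ae_class M f) (ae_class M g) = (\<integral>a. f a * g a \<partial>M)"
  using assms rep_ae_class(1)[of M f] rep_ae_class(1)[of M g]
  by (intro int_pairing_class borel_measurable_times) (simp_all add: strongly_measurable_scalar)

lemma bilinear_form_pairing:
  fixes sX :: "'k::real_or_complex \<Rightarrow> 'x::banach \<Rightarrow> 'x" and sY :: "'k \<Rightarrow> 'y::banach \<Rightarrow> 'y"
  assumes b: "pairing sX sY b" and E: "function_lattice M E" and E': "function_lattice M E'"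
    and int: "\<And>f g. function_ideal.mem M E' f \<Longrightarrow> function_ideal.mem M E g \<Longrightarrow> integrable M (\<lambda>a. f a * g a :: 'k)"
    and W: "vcarrier W \<subseteq> vcarrier (valued M E' sX)" "vcarrier W \<noteq> {}"
  shows "bilinear_form (valued M E sY) W (\<lambda>e d. int_pairing M b d e)"
proof
  interpret E: function_lattice M E by (rule E)
  interpret E': function_lattice M E' by (rule E')
  interpret b: pairing sX sY b by (rule b)
  show "vcarrier W \<noteq> {}" by (rule W)
  fix u v d assume u: "u \<in> vcarrier (valued M E sY)" and v: "v \<in> vcarrier (valued M E sY)" and d: "d \<in> vcarrier W"
  obtain f where f: "E.vmem f" "u = ae_class M f" using E.valued_cases[OF u] by blast
  obtain g where g: "E.vmem g" "v = ae_class M g" using E.valued_cases[OF v] by blast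
  obtain k where k: "E'.vmem k" "d = ae_class M k" using E'.valued_cases[OF subsetD[OF W(1) d]] by blast
  note m = E.vmem_measurable[OF f(1)] E.vmem_measurable[OF g(1)] E'.vmem_measurable[OF k(1)]
    E.vmem_measurable[OF E.vmem_diff[OF f(1) g(1)]]
  have "(\<integral>a. b (k a) (f a - g a) \<partial>M) = (\<integral>a. b (k a) (f a) \<partial>M) - (\<integral>a. b (k a) (g a) \<partial>M)"
    unfolding bounded_bilinear.diff_right[OF b.bounded_bilinear]
    by (intro Bochner_Integration.integral_diff integrable_pairing[OF b E' E int k(1)] f g)
  then show "int_pairing M b d (vdiff (valued M E sY) u v) = int_pairing M b d u - int_pairing M b d v"
    by (simp add: f(2) g(2) k(2) E.valued_vdiff[OF b.Y.scaling_axioms f(1) g(1)] b.int_pairing_class m)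
qed

section \<open>The vector-valued adjoint identity and the weakly continuous extension\<close>

context adjoint_pair begin

text \<open>The argument \<open>f\<close> of \<open>S\<close> is expanded into a series of tensors
  \<phi>_j x_j. Against the tensor \<phi>_j x_j only the scalar function b x_j e matters, so each
  term is an instance of the scalar adjoint identity, and both series may be integrated
  termwise.\<close>

lemma vector_adjoint:
  fixes sX :: "'k \<Rightarrow> 'x::banach \<Rightarrow> 'x" and sY :: "'k \<Rightarrow> 'y::banach \<Rightarrow> 'y"
  assumes b: "pairing sX sY b" "pairing sY sX (\<lambda>y x. b x y)" and dom: "S \<in> dominated_ops B A F (L1 A)"
    and f: "S.D.vmem f" "SA.is_ext (\<lambda>y x. b x y) f k" and e: "T.D.vmem e" "TA.is_ext b e h"
  shows "(\<integral>a. b (k a) (e a) \<partial>A) = (\<integral>c. b (f c) (h c) \<partial>B)"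
proof -
  interpret b: pairing sX sY b by (rule b)
  interpret SW: dominated_adjoint_op B F A "L1 A" S T.D.mem T.app sY sX "\<lambda>y x. b x y"
    by (intro dominated_adjoint_op.intro SA.adjoint_op_axioms b dominated_adjoint_op_axioms.intro dom)
  obtain \<phi> and x and K where d: "\<And>j. S.D.mem (\<phi> j)" "S.R.mem K"
    "\<And>c n. c \<in> space B \<Longrightarrow> (\<Sum>j<n. norm (\<phi> j c) * norm (x j)) \<le> 2 * norm (f c)"
    "\<And>c. c \<in> space B \<Longrightarrow> (\<lambda>j. sX (\<phi> j c) (x j)) sums f c"
    "AE a in A. (\<lambda>j. sX (S.app (\<phi> j) a) (x j)) sums k a"
    "AE a in A. \<forall>n. (\<Sum>j<n. norm (S.app (\<phi> j) a) * norm (x j)) \<le> norm (K a)"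
    by (rule SW.ext_decomposition[OF f]) blast
  have km: "S.R.vmem k" using f(2) by (simp add: SA.is_ext_def)
  have hm: "T.R.vmem h" and hx: "\<And>x. AE c in B. b x (h c) = T.app (\<lambda>a. b x (e a)) c"
    using e(2) by (simp_all add: TA.is_ext_def)
  have 2: "S.D.mem (\<lambda>c. 2 * of_real (norm (f c)))" by (intro S.D.mem_scale S.D.vmem_norm f)
  have limB: "(\<lambda>n. \<integral>c. b (\<Sum>j<n. sX (\<phi> j c) (x j)) (h c) \<partial>B) \<longlonglongrightarrow> (\<integral>c. b (f c) (h c) \<partial>B)"
    by (rule pairing_sums_lim[OF b(1) S.D.function_lattice_axioms T.R.function_lattice_axioms integrable 2 d(1) hm])
      (use d(3,4) S.D.vmem_measurable[OF f(1)] in \<open>auto simp: norm_mult\<close>)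
  \<comment> \<open>The images S \<phi>_j have no pointwise bound by \<open>f\<close>; their
    majorant \<open>K\<close> comes from an operator that dominates \<open>S\<close>.\<close>
  have limA: "(\<lambda>n. \<integral>a. b (\<Sum>j<n. sX (S.app (\<phi> j) a) (x j)) (e a) \<partial>A) \<longlonglongrightarrow> (\<integral>a. b (k a) (e a) \<partial>A)"
    by (rule pairing_sums_lim[OF b(1) S.R.function_lattice_axioms T.D.function_lattice_axioms integrable_Linf_L1 d(2)
          S.app_mem[OF d(1)] e(1) d(6) S.R.vmem_measurable[OF km] d(5)])
  have "(\<integral>a. b (\<Sum>j<n. sX (S.app (\<phi> j) a) (x j)) (e a) \<partial>A) = (\<integral>c. b (\<Sum>j<n. sX (\<phi> j c) (x j)) (h c) \<partial>B)" for n
  proof -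
    have ex: "T.D.mem (\<lambda>a. b x (e a))" for x by (rule T.D.mem_pairing[OF b(1) e(1)])
    have hmem: "T.R.mem (\<lambda>c. b x (h c))" for x by (rule T.R.mem_pairing[OF b(1) hm])
    have "(\<integral>a. b (\<Sum>j<n. sX (S.app (\<phi> j) a) (x j)) (e a) \<partial>A) = (\<Sum>j<n. \<integral>a. S.app (\<phi> j) a * b (x j) (e a) \<partial>A)"
      unfolding bounded_bilinear.sum_left[OF b.bounded_bilinear] b.scale_left
      by (intro Bochner_Integration.integral_sum integrable_Linf_L1 S.app_mem d ex)
    \<comment> \<open>The scalar adjoint identity moves \<open>S\<close> to
      \<open>T (b x_j e)\<close>, which is \<open>b x_j h\<close> by the property that characterises
      \<open>h\<close>.\<close>
    also have "\<dots> = (\<Sum>j<n. \<integral>c. \<phi> j c * b (x j) (h c) \<partial>B)"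
    proof (rule sum.cong[OF refl])
      fix j
      have "(\<integral>a. S.app (\<phi> j) a * b (x j) (e a) \<partial>A) = (\<integral>c. \<phi> j c * T.app (\<lambda>a. b (x j) (e a)) c \<partial>B)"
        by (rule adjoint[OF ex d(1)])
      also have "\<dots> = (\<integral>c. \<phi> j c * b (x j) (h c) \<partial>B)"
      proof (rule integral_cong_AE)
        show "AE c in B. \<phi> j c * T.app (\<lambda>a. b (x j) (e a)) c = \<phi> j c * b (x j) (h c)"
          using hx[of "x j"] by eventually_elim simp
      qed (intro borel_measurable_times S.D.mem_measurable T.R.mem_measurable T.app_mem ex hmem d)+
      finally show "(\<integral>a. S.app (\<phi> j) a * b (x j) (e a) \<partial>A) = (\<integral>c. \<phi> j c * b (x j) (h c) \<partial>B)" .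
    qed
    also have "\<dots> = (\<integral>c. b (\<Sum>j<n. sX (\<phi> j c) (x j)) (h c) \<partial>B)"
      unfolding bounded_bilinear.sum_left[OF b.bounded_bilinear] b.scale_left
      by (intro Bochner_Integration.integral_sum[symmetric] integrable d hmem)
    finally show ?thesis .
  qed
  then show ?thesis using LIMSEQ_unique[OF limA] limB by simp
qed

lemma weakly_continuous_extension:
  fixes sX :: "'k \<Rightarrow> 'x::banach \<Rightarrow> 'x" and sY :: "'k \<Rightarrow> 'y::banach \<Rightarrow> 'y"
  assumes dual: "banach_dual_pair (type_space sX) (type_space sY) b" and domT: "T \<in> dominated_ops A B (Linf A) G"
  defines "LinfY \<equiv> valued A (Linf A) sY" and "L1X \<equiv> valued A (L1 A) sX"
    and "GY \<equiv> valued B G sY" and "FX \<equiv> closed_tensor B F sX"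
    and "pairA \<equiv> \<lambda>e d. int_pairing A b d e" and "pairB \<equiv> \<lambda>g f. int_pairing B b f g"
  shows "\<exists>T\<^sub>Y \<in> bounded_ops LinfY GY.
            extends_tensor_id A B (Linf A) G sY T T\<^sub>Y \<and>
            continuous_map (weak_topology LinfY L1X pairA) (weak_topology GY FX pairB) T\<^sub>Y \<and>
            (\<forall>U \<in> linear_ops LinfY GY.
               extends_tensor_id A B (Linf A) G sY T U \<and>
               continuous_map (weak_topology LinfY L1X pairA) (weak_topology GY FX pairB) U \<longrightarrow> U = T\<^sub>Y) \<and>
            is_valued_extension A B (Linf A) G sY b T T\<^sub>Y \<and>
            op_norm LinfY GY T\<^sub>Y \<le> dominated_norm A B (Linf A) G T \<and>
            (\<exists>S\<^sub>X \<in> bounded_ops FX L1X.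
               is_adjoint LinfY L1X pairA FX pairB T\<^sub>Y S\<^sub>X \<and>
               extends_tensor_id B A F (L1 A) sX S S\<^sub>X \<and>
               (\<forall>V \<in> bounded_ops FX L1X.
                  extends_tensor_id B A F (L1 A) sX S V \<longrightarrow> V = S\<^sub>X) \<and>
               op_norm FX L1X S\<^sub>X \<le> regular_norm B A F (L1 A) S)"
proof -
  note b = pairing_of_dual_pair[OF dual]
  note domS = adjoint_dominated[OF domT]
  interpret TW: dominated_adjoint_op A "Linf A" B G T S.D.mem S.app sX sY b
    by (intro dominated_adjoint_op.intro TA.adjoint_op_axioms b dominated_adjoint_op_axioms.intro domT)
  interpret SW: dominated_adjoint_op B F A "L1 A" S T.D.mem T.app sY sX "\<lambda>y x. b x y"
    by (intro dominated_adjoint_op.intro SA.adjoint_op_axioms b dominated_adjoint_op_axioms.intro domS)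
  interpret SP: lattice_pair B F A "L1 A :: ('k, _) nspace" ..
  have sX: "scaling sX" and sY: "scaling sY" using b(1) by (auto simp: pairing_def)
  \<comment> \<open>The extension of \<open>S\<close> acts on all of F(X); on the closed tensor
    product it is determined by its values on algebraic tensors.\<close>
  define SX where "SX = restrict SW.W (vcarrier FX)"
  have FXv: "c \<in> vcarrier (valued B F sX)" if "c \<in> vcarrier FX" for c
    using that S.D.closed_tensor_valued[OF sX] by (simp add: FX_def)
  have zeroFX: "ae_class B (\<lambda>_. 0) \<in> vcarrier FX"
    using S.D.alg_tensor_closed[OF sX, of "ae_class B (\<lambda>_. 0)"] vspan.vspan_zero[of "valued B F sX"]
    by (simp add: FX_def S.D.valued_vzero)
  have bfA: "bilinear_form LinfY L1X pairA" unfolding LinfY_def L1X_def pairA_def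
    using S.R.vmem_carrier[OF S.R.vmem_zero]
    by (intro bilinear_form_pairing[OF b(1) T.D.function_lattice_axioms S.R.function_lattice_axioms integrable_Linf_L1]) auto
  have bfB: "bilinear_form GY FX pairB" unfolding GY_def pairB_def
    using FXv zeroFX
    by (intro bilinear_form_pairing[OF b(1) T.R.function_lattice_axioms S.D.function_lattice_axioms integrable]) auto
  have adj: "pairA e (SW.W f) = pairB (TW.W e) f" if f: "f \<in> vcarrier FX" and e: "e \<in> vcarrier LinfY" for e f
  proof -
    obtain f' k where f': "S.D.vmem f'" "f = ae_class B f'" "SA.is_ext (\<lambda>y x. b x y) f' k" "S.R.vmem k" "SW.W f = ae_class A k"
      by (rule SW.W_cases[OF FXv[OF f]])
    obtain e' h where e': "T.D.vmem e'" "e = ae_class A e'" "TA.is_ext b e' h" "T.R.vmem h" "TW.W e = ae_class B h"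
      by (rule TW.W_cases[OF e[unfolded LinfY_def]])
    show ?thesis unfolding pairA_def pairB_def f'(5) e'(5) unfolding f'(2) e'(2)
      using vector_adjoint[OF b domS f'(1,3) e'(1,3)] f'(1,4) e'(1,4)
      by (simp add: TW.int_pairing_class S.D.vmem_measurable S.R.vmem_measurable T.D.vmem_measurable T.R.vmem_measurable)
  qed
  have Tran: "TW.W e \<in> vcarrier GY" if "e \<in> vcarrier LinfY" for e
    using TW.W_linear that unfolding LinfY_def GY_def linear_ops_def by blast
  have Sran: "SW.W f \<in> vcarrier L1X" if "f \<in> vcarrier FX" for f
    using SW.W_linear FXv[OF that] unfolding L1X_def linear_ops_def by blast
  have cont: "continuous_map (weak_topology LinfY L1X pairA) (weak_topology GY FX pairB) TW.W"
    by (rule weak_continuous_of_adjoint[OF bfA bfB Tran Sran adj])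
  \<comment> \<open>The partial sums of the series for \<open>e\<close> are algebraic tensors, on
    which both operators agree, and they converge weakly to \<open>e\<close>. Weak continuity
    carries the agreement to \<open>e\<close>.\<close>
  have uniqueT: "U = TW.W" if U: "U \<in> linear_ops LinfY GY" "extends_tensor_id A B (Linf A) G sY T U"
    "continuous_map (weak_topology LinfY L1X pairA) (weak_topology GY FX pairB) U" for U
  proof -
    have Uran: "U e \<in> vcarrier GY" if "e \<in> vcarrier LinfY" for e
      using U(1) that unfolding linear_ops_def by blast
    have "U e = TW.W e" if e: "e \<in> vcarrier LinfY" for e
    proof -
      obtain e' h where e': "T.D.vmem e'" "e = ae_class A e'" "TA.is_ext b e' h" "T.R.vmem h" "TW.W e = ae_class B h"
        by (rule TW.W_cases[OF e[unfolded LinfY_def]])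
      obtain \<phi> and y and K where d: "\<And>j. T.D.mem (\<phi> j)" "T.R.mem K"
        "\<And>a n. a \<in> space A \<Longrightarrow> (\<Sum>j<n. norm (\<phi> j a) * norm (y j)) \<le> 2 * norm (e' a)"
        "\<And>a. a \<in> space A \<Longrightarrow> (\<lambda>j. sY (\<phi> j a) (y j)) sums e' a"
        by (rule TW.ext_decomposition[OF e'(1,3)]) blast
      define X where "X n = ae_class A (\<lambda>a. \<Sum>j<n::nat. sY (\<phi> j a) (y j))" for n
      note t = T.D.tensor_sum_alg[where y=y and \<phi>=\<phi>, OF sY d(1)]
      have XL: "X n \<in> vcarrier LinfY" for n unfolding X_def LinfY_def by (rule T.D.vmem_carrier[OF t(1)])
      have eq: "U (X n) = TW.W (X n)" for n
        using U(2) TW.W_extends t(2)[of n] unfolding extends_tensor_id_def X_def by simp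
      have 2: "T.D.mem (\<lambda>a. 2 * of_real (norm (e' a)))" by (intro T.D.mem_scale T.D.vmem_norm e')
      have int: "integrable A (\<lambda>a. f a * g a)" if "T.D.mem f" "S.R.mem g" for f g
        using integrable_Linf_L1[OF that(2,1)] by (simp add: mult.commute)
      have lim: "(\<lambda>n. pairA (X n) g) \<longlonglongrightarrow> pairA e g" if g: "g \<in> vcarrier L1X" for g
      proof -
        obtain g' where g': "S.R.vmem g'" "g = ae_class A g'" using S.R.valued_cases[OF g[unfolded L1X_def]] by blast
        have "(\<lambda>n. \<integral>a. b (g' a) (\<Sum>j<n. sY (\<phi> j a) (y j)) \<partial>A) \<longlonglongrightarrow> (\<integral>a. b (g' a) (e' a) \<partial>A)"
          by (rule pairing_sums_lim[OF b(2) T.D.function_lattice_axioms S.R.function_lattice_axioms int 2 d(1) g'(1)])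
            (use d(3,4) T.D.vmem_measurable[OF e'(1)] in \<open>auto simp: norm_mult\<close>)
        then show ?thesis unfolding pairA_def X_def g'(2) e'(2)
          using g'(1) e'(1) t(1) by (simp add: TW.int_pairing_class T.D.vmem_measurable S.R.vmem_measurable)
      qed
      obtain u where u: "T.R.vmem u" "U e = ae_class B u" using T.R.valued_cases[OF Uran[OF e, unfolded GY_def]] by blast
      \<comment> \<open>Limits of equal scalar sequences: the pairings of \<open>U (X n)\<close> and
        \<open>TW.W (X n)\<close> with \<open>f\<close> coincide.\<close>
      have same: "pairB (U e) f = pairB (TW.W e) f" if f: "f \<in> vcarrier FX" for f
        using LIMSEQ_unique[OF weak_continuous_sequentially[OF bfA bfB Uran U(3) e XL lim f]]
          weak_continuous_sequentially[OF bfA bfB Tran cont e XL lim f] eq by simp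
      have "AE c in B. u c - h c = 0"
      proof (rule AE_zero_if_separated[where b=b])
        show "strongly_measurable B (\<lambda>c. u c - h c)" by (intro T.R.vmem_measurable T.R.vmem_diff u e')
        show "AE c in B. b x (u c - h c) = 0" for x
        proof (rule separating[OF T.R.mem_pairing[OF b(1) T.R.vmem_diff[OF u(1) e'(4)]]])
          fix f assume f: "S.D.mem f"
          have v: "S.D.vmem (\<lambda>c. sX (f c) x)" by (rule S.D.vmem_tensor[OF sX f])
          \<comment> \<open>Elementary tensors already suffice to separate: \<open>f\<close>
            separates the scalar functions in \<open>G\<close>, and the vectors \<open>x\<close>
            separate the points of Y.\<close>
          have "elem_tensor B sX (ae_class B f) x \<in> vcarrier FX"
            unfolding FX_def by (intro S.D.alg_tensor_closed[OF sX] S.D.elem_tensor_alg[OF sX] S.D.mem_carrier f)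
          then have "ae_class B (\<lambda>c. sX (f c) x) \<in> vcarrier FX" unfolding S.D.elem_tensor_class[OF f] .
          from same[OF this] have "(\<integral>c. f c * b x (u c) \<partial>B) = (\<integral>c. f c * b x (h c) \<partial>B)"
            using u(1) e'(4) v unfolding pairB_def u(2) e'(5)
            by (simp add: TW.int_pairing_class S.D.vmem_measurable T.R.vmem_measurable TW.scale_left)
          moreover have "integrable B (\<lambda>c. f c * b x (u c))" "integrable B (\<lambda>c. f c * b x (h c))"
            by (intro integrable f T.R.mem_pairing[OF b(1)] u(1) e'(4))+
          ultimately show "(\<integral>c. f c * b x (u c - h c) \<partial>B) = 0"
            unfolding bounded_bilinear.diff_right[OF TW.bounded_bilinear] right_diff_distrib by simp
        qed
      qed (rule TW.continuous, rule TW.separating, blast)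
      then have "AE c in B. u c = h c" by eventually_elim simp
      then show ?thesis unfolding u(2) e'(5) by (rule ae_class_cong)
    qed
    moreover have "U \<in> vcarrier LinfY \<rightarrow>\<^sub>E vcarrier GY" "TW.W \<in> vcarrier LinfY \<rightarrow>\<^sub>E vcarrier GY"
      using U(1) TW.W_linear unfolding linear_ops_def LinfY_def GY_def by blast+
    ultimately show ?thesis by (intro PiE_ext[of U "vcarrier LinfY" "\<lambda>_. vcarrier GY"]) auto
  qed
  have SXeq: "SX f = SW.W f" if "f \<in> vcarrier FX" for f using that by (simp add: SX_def)
  have Sbounded: "SX \<in> bounded_ops FX L1X"
  proof -
    have "SX \<in> linear_ops FX L1X"
    proof -
      have add: "SX (vadd FX u v) = vadd L1X (SX u) (SX v)" if "u \<in> vcarrier FX" "v \<in> vcarrier FX" for u v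
      proof -
        have "vadd (valued B F sX) u v \<in> vcarrier FX" using S.D.closed_tensor_add[OF sX] that by (simp add: FX_def)
        then show ?thesis using SXeq that FXv SW.W_linear by (simp add: FX_def L1X_def linear_ops_def)
      qed
      have scale: "SX (vscale FX c u) = vscale L1X c (SX u)" if "u \<in> vcarrier FX" for u c
      proof -
        have "vscale (valued B F sX) c u \<in> vcarrier FX" using S.D.closed_tensor_scale[OF sX] that by (simp add: FX_def)
        then show ?thesis using SXeq that FXv SW.W_linear by (simp add: FX_def L1X_def linear_ops_def)
      qed
      have "SX \<in> vcarrier FX \<rightarrow>\<^sub>E vcarrier L1X" using Sran by (auto simp: SX_def)
      then show ?thesis using add scale unfolding linear_ops_def by blast
    qed
    moreover obtain C where "\<And>v. v \<in> vcarrier (valued B F sX) \<Longrightarrow> vnorm L1X (SW.W v) \<le> C * vnorm (valued B F sX) v"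
      using SW.W_bounded by (auto simp: bounded_ops_def L1X_def)
    then have "\<forall>v\<in>vcarrier FX. vnorm L1X (SX v) \<le> C * vnorm FX v" using FXv SXeq by (simp add: FX_def)
    ultimately show ?thesis unfolding bounded_ops_def by blast
  qed
  have algFX: "h \<in> vcarrier FX" if "h \<in> vcarrier (alg_tensor B F sX)" for h
    using S.D.alg_tensor_closed[OF sX that] by (simp add: FX_def)
  have Sext: "extends_tensor_id B A F (L1 A) sX S SX"
    using SW.W_extends algFX SXeq unfolding extends_tensor_id_def by simp
  show ?thesis
  proof (intro bexI[of _ TW.W] conjI ballI impI bexI[of _ SX])
    show "TW.W \<in> bounded_ops LinfY GY" unfolding LinfY_def GY_def by (rule TW.W_bounded)
    show "extends_tensor_id A B (Linf A) G sY T TW.W" by (rule TW.W_extends)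
    show "is_valued_extension A B (Linf A) G sY b T TW.W" by (rule TW.W_valued_extension)
    show "op_norm LinfY GY TW.W \<le> dominated_norm A B (Linf A) G T"
      unfolding LinfY_def GY_def by (rule TW.W_op_norm_le) (auto intro: T.D.vmem_carrier T.D.vmem_zero)
    show "op_norm FX L1X SX \<le> regular_norm B A F (L1 A) S"
      unfolding L1X_def regular_norm_def
      by (rule SW.W_op_norm_le) (use FXv zeroFX SXeq in \<open>auto simp: FX_def\<close>)
    show "is_adjoint LinfY L1X pairA FX pairB TW.W SX"
      unfolding is_adjoint_def using adj SXeq Sran by (auto simp: SX_def)
    show "V = SX" if V: "V \<in> bounded_ops FX L1X" "extends_tensor_id B A F (L1 A) sX S V" for V
    proof (rule SP.closed_tensor_op_unique[OF sX])
      show "V \<in> bounded_ops (closed_tensor B F sX) (valued A (L1 A) sX)"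
        "SX \<in> bounded_ops (closed_tensor B F sX) (valued A (L1 A) sX)"
        using V(1) Sbounded by (simp_all add: FX_def L1X_def)
      show "V h = SX h" if "h \<in> vcarrier (alg_tensor B F sX)" for h
        using V(2) Sext that unfolding extends_tensor_id_def by simp
      \<comment> \<open>The definiteness required for uniqueness: a function whose absolute value
        has integral 0 vanishes almost everywhere.\<close>
      show "AE a in A. h a = 0" if h: "S.R.mem h" "S.R.fnorm h = 0" for h
      proof -
        have i: "integrable A (\<lambda>a. norm (h a))" using h(1) by (simp add: L1_mem)
        have "(\<integral>a. norm (h a) \<partial>A) = 0" using h L1_fnorm[OF S.R.mem_measurable[OF h(1)]] by simp
        then show ?thesis using i by (subst (asm) integral_nonneg_eq_0_iff_AE) auto
      qed
    qed
  qed (use cont uniqueT Sbounded Sext in auto)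
qed

end

text \<open>Passes from classes to functions. The separation clause is injectivity of the map from
  \<open>G\<close> into the dual of \<open>F\<close>, applied to a class and the zero class.\<close>

lemma adjoint_pair_of_koethe:
  fixes A :: "'a measure" and B :: "'b measure" and F G :: "('k::real_or_complex, ('b \<Rightarrow> 'k) set) nspace"
  assumes koethe: "koethe_dual_pair B F G" and T: "T \<in> bounded_ops (Linf A) G" and S: "S \<in> bounded_ops F (L1 A)"
    and adj: "is_adjoint (Linf A) (L1 A) (\<lambda>e d. int_pairing A (*) d e) F (\<lambda>g f. int_pairing B (*) f g) T S"
  shows "adjoint_pair A B F G T S"
proof -
  note k = koethe[unfolded koethe_dual_pair_def]
  interpret T: lattice_op A "Linf A" B G T
    using T k function_lattice_Linf function_lattice_of_bfs
    by (intro lattice_op.intro lattice_op_axioms.intro) (auto simp: bounded_ops_def)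
  interpret S: lattice_op B F A "L1 A" S
    using S k function_lattice_L1 function_lattice_of_bfs
    by (intro lattice_op.intro lattice_op_axioms.intro) (auto simp: bounded_ops_def)
  have pair: "int_pairing B (*) (ae_class B f) (ae_class B g) = (\<integral>c. f c * g c \<partial>B)" if "S.D.mem f" "T.R.mem g" for f g
    using that by (intro int_pairing_mult_class S.D.mem_measurable T.R.mem_measurable)
  show ?thesis
  proof
    show "integrable B (\<lambda>c. f c * g c)" if f: "S.D.mem f" and g: "T.R.mem g" for f g
    proof -
      have "integrable B (\<lambda>c. rep (ae_class B f) c * rep (ae_class B g) c)"
        using k S.D.mem_carrier[OF f] T.R.mem_carrier[OF g] by blast
      moreover have "AE c in B. rep (ae_class B f) c * rep (ae_class B g) c = f c * g c"
        using S.D.rep_class[OF f] T.R.rep_class[OF g] by eventually_elim simp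
      ultimately show ?thesis
        using S.D.mem_measurable[OF f] T.R.mem_measurable[OF g]
          S.D.mem_measurable[OF S.D.mem_rep[OF S.D.mem_carrier[OF f]]] T.R.mem_measurable[OF T.R.mem_rep[OF T.R.mem_carrier[OF g]]]
        by (subst (asm) integrable_cong_AE) auto
    qed
    show "(\<integral>a. S.app f a * e a \<partial>A) = (\<integral>c. f c * T.app e c \<partial>B)" if e: "T.D.mem e" and f: "S.D.mem f" for e f
    proof -
      have "int_pairing A (*) (S (ae_class B f)) (ae_class A e) = int_pairing B (*) (ae_class B f) (T (ae_class A e))"
        using adj T.D.mem_carrier[OF e] S.D.mem_carrier[OF f] by (simp add: is_adjoint_def)
      moreover have "int_pairing A (*) (ae_class A (S.app f)) (ae_class A e) = (\<integral>a. S.app f a * e a \<partial>A)"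
        by (intro int_pairing_mult_class S.R.mem_measurable S.app_mem T.D.mem_measurable e f)
      ultimately show ?thesis by (simp add: S.U_class T.U_class pair T.app_mem e f)
    qed
    show "AE c in B. g c = 0" if g: "T.R.mem g" and z: "\<And>f. S.D.mem f \<Longrightarrow> (\<integral>c. f c * g c \<partial>B) = 0" for g
    proof -
      have inj: "inj_on (\<lambda>w. \<lambda>v\<in>vcarrier F. int_pairing B (*) v w) (vcarrier G)"
        using k by (simp add: banach_dual_pair_def)
      have "int_pairing B (*) v (ae_class B g) = int_pairing B (*) v (ae_class B (\<lambda>_. 0))" if v: "v \<in> vcarrier F" for v
        using pair[OF S.D.mem_rep[OF v] g] pair[OF S.D.mem_rep[OF v] T.R.mem_zero] z[OF S.D.mem_rep[OF v]]
        by (simp add: S.D.ae_class_rep[OF v])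
      then have "ae_class B g = ae_class B (\<lambda>_. 0)"
        using T.R.mem_carrier[OF g] T.R.mem_carrier[OF T.R.mem_zero] by (intro inj_onD[OF inj]) auto
      then show ?thesis using T.R.mem_measurable[OF g] by (intro ae_class_eqD) (simp_all add: strongly_measurable_scalar)
    qed
    obtain C where C: "\<And>v w. v \<in> vcarrier F \<Longrightarrow> w \<in> vcarrier G \<Longrightarrow> norm (int_pairing B (*) v w) \<le> C * vnorm F v * vnorm G w"
      using k unfolding banach_dual_pair_def by blast
    show "\<exists>C\<ge>0. \<forall>f g. S.D.mem f \<longrightarrow> T.R.mem g \<longrightarrow> norm (\<integral>c. f c * g c \<partial>B) \<le> C * S.D.fnorm f * T.R.fnorm g"
    proof (intro exI[of _ "\<bar>C\<bar>"] conjI allI impI)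
      fix f g assume f: "S.D.mem f" and g: "T.R.mem g"
      have "norm (\<integral>c. f c * g c \<partial>B) \<le> C * S.D.fnorm f * T.R.fnorm g"
        using C[OF S.D.mem_carrier[OF f] T.R.mem_carrier[OF g]] by (simp add: pair f g S.D.fnorm_def T.R.fnorm_def)
      also have "\<dots> \<le> \<bar>C\<bar> * S.D.fnorm f * T.R.fnorm g"
        by (intro mult_right_mono S.D.fnorm_nonneg T.R.fnorm_nonneg f g) simp
      finally show "norm (\<integral>c. f c * g c \<partial>B) \<le> \<bar>C\<bar> * S.D.fnorm f * T.R.fnorm g" .
    qed simp
  qed
qed

theorem theorem3p13:
  fixes A :: "'a measure" and B :: "'b measure"
    and F G :: "('k::real_or_complex, ('b \<Rightarrow> 'k) set) nspace"
    and T :: "('a \<Rightarrow> 'k) set \<Rightarrow> ('b \<Rightarrow> 'k) set"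
    and S :: "('b \<Rightarrow> 'k) set \<Rightarrow> ('a \<Rightarrow> 'k) set"
  assumes "semi_finite A"
    and "koethe_dual_pair B F G"
    and "T \<in> bounded_ops (Linf A) G"
    and "continuous_map
           (weak_topology (Linf A) (L1 A) (\<lambda>e d. int_pairing A (*) d e))
           (weak_topology G F (\<lambda>g f. int_pairing B (*) f g)) T"
    and "S \<in> bounded_ops F (L1 A)"
    and "is_adjoint (Linf A) (L1 A) (\<lambda>e d. int_pairing A (*) d e)
           F (\<lambda>g f. int_pairing B (*) f g) T S"
    and "T \<in> dominated_ops A B (Linf A) G"
  shows "S \<in> dominated_ops B A F (L1 A) \<and>
    dominated_ops B A F (L1 A) = regular_ops B A F (L1 A) \<and>
    (\<forall>(sX :: 'k \<Rightarrow> 'x::banach \<Rightarrow> 'x) (sY :: 'k \<Rightarrow> 'y::banach \<Rightarrow> 'y) (b :: 'x \<Rightarrow> 'y \<Rightarrow> 'k).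
      banach_dual_pair (type_space sX) (type_space sY) b \<longrightarrow>
      (let LinfY = valued A (Linf A) sY;
           L1X = valued A (L1 A) sX;
           GY = valued B G sY;
           FX = closed_tensor B F sX;
           pairA = (\<lambda>e d. int_pairing A b d e);
           pairB = (\<lambda>g f. int_pairing B b f g);
           weakly_continuous = continuous_map (weak_topology LinfY L1X pairA)
                                              (weak_topology GY FX pairB)
       in \<exists>T\<^sub>Y \<in> bounded_ops LinfY GY.
            extends_tensor_id A B (Linf A) G sY T T\<^sub>Y \<and> weakly_continuous T\<^sub>Y \<and>
            (\<forall>U \<in> linear_ops LinfY GY.
               extends_tensor_id A B (Linf A) G sY T U \<and> weakly_continuous U \<longrightarrow> U = T\<^sub>Y) \<and>
            is_valued_extension A B (Linf A) G sY b T T\<^sub>Y \<and>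
            op_norm LinfY GY T\<^sub>Y \<le> dominated_norm A B (Linf A) G T \<and>
            (\<exists>S\<^sub>X \<in> bounded_ops FX L1X.
               is_adjoint LinfY L1X pairA FX pairB T\<^sub>Y S\<^sub>X \<and>
               extends_tensor_id B A F (L1 A) sX S S\<^sub>X \<and>
               (\<forall>V \<in> bounded_ops FX L1X.
                  extends_tensor_id B A F (L1 A) sX S V \<longrightarrow> V = S\<^sub>X) \<and>
               op_norm FX L1X S\<^sub>X \<le> regular_norm B A F (L1 A) S)))"
proof -
  interpret adjoint_pair A B F G T S using assms(2,3,5,6) by (rule adjoint_pair_of_koethe)
  interpret SP: lattice_pair B F A "L1 A :: ('k, _) nspace" ..
  show ?thesis
    unfolding Let_def
    by (intro conjI allI impI adjoint_dominated assms(7) SP.dominated_eq_regular weakly_continuous_extension)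
qed

end
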